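(* Let $p$, $q$ and $r$ be distinct prime numbers with $p \equiv 3 \pmod{4}$ and $q \equiv r \equiv 1 \pmod{8}$. Assume that $\left(\frac{q}{r}\right) = -1$, where $\left(\frac{\cdot}{r}\right)$ denotes the Legendre symbol. Then for the bi-quadratic field $K' = \mathbb{Q}(\sqrt{p}, \sqrt{qr})$ we have $Po(K') \simeq \mathbb{Z}/2\mathbb{Z}$. In particular, $K'$ is not a Pólya field.
   Context: Let $K$ be a number field with ring of integers $\mathcal{O}_K$ and ideal class group $Cl_K$. Define $Int(\mathcal{O}_K) = \{f(X) \in K[X] : f(\mathcal{O}_K) \subseteq \mathcal{O}_K\}$, regarded as an $\mathcal{O}_K$-module. A basis $\{f_j\}_{j \geq 0}$ of the $\mathcal{O}_K$-module $Int(\mathcal{O}_K)$ is called regular if $\deg(f_j) = j$ for all $j \geq 0$. The field $K$ is called a Pólya field if the $\mathcal{O}_K$-module $Int(\mathcal{O}_K)$ admits a regular basis. For each integer $n \geq 1$, let $\mathfrak{J}_n(K) = \{\text{leading coefficients of elements of } Int(\mathcal{O}_K) \text{ of degree } n\} \cup \{0\}$; this is a fractional ideal of $K$. The Pólya group $Po(K)$ is the subgroup of $Cl_K$ generated by the ideal classes $[\mathfrak{J}_n(K)]$, $n \geq 1$. *)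

theory Defs
  imports
    "HOL-Algebra.Algebra"
    "HOL-Algebra.Algebraic_Closure_Type"
    "HOL-Number_Theory.Number_Theory"
    "HOL-Analysis.Analysis"
begin

text \<open>Number fields are taken as subfields \<open>K\<close> of the complex numbers. The definitions below make
  sense for any set \<open>K\<close>, but have their usual meaning only when \<open>K\<close> is a number field.\<close>

abbreviation complex_field :: "complex ring" where
  "complex_field \<equiv> ring_of_type_algebra"

text \<open>In characteristic 0 every subfield contains the rationals, so this is
  \<open>\<rat>(\<surd>a, \<surd>b)\<close>.\<close>

definition biquadratic_field :: "nat \<Rightarrow> nat \<Rightarrow> complex set" where
  "biquadratic_field a b =
     generate_field complex_field {of_real (sqrt (real a)), of_real (sqrt (real b))}"

definition ring_of_integers :: "complex set \<Rightarrow> complex set" where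
  "ring_of_integers K = {x \<in> K. algebraic_int x}"

definition int_valued_polys :: "complex set \<Rightarrow> complex poly set" where
  "int_valued_polys K =
     {f. (\<forall>i. Polynomial.coeff f i \<in> K) \<and>
         (\<forall>x \<in> ring_of_integers K. poly f x \<in> ring_of_integers K)}"

definition int_valued_basis :: "complex set \<Rightarrow> (nat \<Rightarrow> complex poly) \<Rightarrow> bool" where
  "int_valued_basis K f \<longleftrightarrow>
     (\<forall>j. f j \<in> int_valued_polys K) \<and>
     (\<forall>g \<in> int_valued_polys K.
        \<exists>!c :: nat \<Rightarrow> complex. (\<forall>j. c j \<in> ring_of_integers K) \<and> finite {j. c j \<noteq> 0} \<and>
          g = (\<Sum>j | c j \<noteq> 0. Polynomial.smult (c j) (f j)))"

definition regular_basis :: "complex set \<Rightarrow> (nat \<Rightarrow> complex poly) \<Rightarrow> bool" where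
  "regular_basis K f \<longleftrightarrow> int_valued_basis K f \<and> (\<forall>j. Polynomial.degree (f j) = j)"

definition polya_field :: "complex set \<Rightarrow> bool" where
  "polya_field K \<longleftrightarrow> (\<exists>f. regular_basis K f)"

definition char_ideal :: "complex set \<Rightarrow> nat \<Rightarrow> complex set" where
  "char_ideal K n =
     {Polynomial.lead_coeff f | f. f \<in> int_valued_polys K \<and> Polynomial.degree f = n} \<union> {0}"

text \<open>Nonzero fractional ideals. Closure under negation is the case \<open>a = - 1\<close>.\<close>

definition fractional_ideals :: "complex set \<Rightarrow> complex set set" where
  "fractional_ideals K =
     {I. I \<subseteq> K \<and> 0 \<in> I \<and> I \<noteq> {0} \<and>
         (\<forall>x \<in> I. \<forall>y \<in> I. x + y \<in> I) \<and>
         (\<forall>a \<in> ring_of_integers K. \<forall>x \<in> I. a * x \<in> I) \<and>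
         (\<exists>d \<in> ring_of_integers K. d \<noteq> 0 \<and> (\<forall>x \<in> I. d * x \<in> ring_of_integers K))}"

text \<open>The library operation \<^const>\<open>ideal_prod\<close> forms the set of finite sums of products \<open>x * y\<close> with
  \<open>x \<in> I\<close> and \<open>y \<in> J\<close>, so it is the product of fractional ideals as well.\<close>

definition fractional_ideal_group :: "complex set \<Rightarrow> complex set monoid" where
  "fractional_ideal_group K =
     \<lparr>carrier = fractional_ideals K, monoid.mult = ideal_prod complex_field, one = ring_of_integers K\<rparr>"

definition principal_fractional_ideals :: "complex set \<Rightarrow> complex set set" where
  "principal_fractional_ideals K = {(\<lambda>x. a * x) ` ring_of_integers K | a. a \<in> K \<and> a \<noteq> 0}"

definition class_group :: "complex set \<Rightarrow> complex set set monoid" where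
  "class_group K = fractional_ideal_group K Mod principal_fractional_ideals K"

definition ideal_class :: "complex set \<Rightarrow> complex set \<Rightarrow> complex set set" where
  "ideal_class K I = principal_fractional_ideals K #>\<^bsub>fractional_ideal_group K\<^esub> I"

definition polya_group :: "complex set \<Rightarrow> complex set set monoid" where
  "polya_group K =
     (class_group K)\<lparr>carrier :=
        generate (class_group K) {ideal_class K (char_ideal K n) | n. n \<ge> 1}\<rparr>"

end

theory Submission
  imports Defs "Jordan_Normal_Form.Char_Poly"
begin

text \<open>
  Write \<open>s = \<surd>p\<close>, \<open>t = \<surd>(qr)\<close>, and \<open>\<qq>\<close> for the ideal generated by \<open>q\<close> and \<open>t\<close> (\<open>QI\<close>
  below), which satisfies \<open>\<qq>\<^sup>2 = (q)\<close>. The characteristic ideals \<open>\<JJ>\<^sub>n\<close> are stable under the Galois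
  group. An invariant fractional ideal \<open>I\<close> of \<open>\<rat>(s, t)\<close> is generated by its intersections with \<open>\<rat>(s)\<close> and \<open>\<rat>(t)\<close>, since
  their discriminants \<open>4p\<close> and \<open>qr\<close> are coprime; a computation in these two quadratic fields
  shows that \<open>I\<close> is principal or a multiple of \<open>\<qq>\<close>. Here the prime above \<open>2\<close> is principal because
  \<open>x\<^sup>2 - p y\<^sup>2 = \<plusminus>2\<close> is solvable, by descent on a solution of Pell's equation.

  If \<open>\<qq> = (\<gamma>)\<close>, then \<open>\<gamma>\<^sup>2 = q v\<^sub>1 v\<^sub>2 v\<^sub>3\<close>, where the \<open>v\<^sub>i = a\<^sub>i + b\<^sub>i \<surd>D\<close> are units of norm \<open>1\<close> of the
  three quadratic subfields. As \<open>2(a\<^sub>i + 1) v\<^sub>i = (1 + v\<^sub>i)\<^sup>2\<close>, the number \<open>q \<Prod> 2(a\<^sub>i + 1)\<close> is a square times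
  \<open>1\<close>, \<open>p\<close>, \<open>qr\<close> or \<open>pqr\<close>. This contradicts the fact that \<open>2(a\<^sub>i + 1)\<close> has an even total multiplicity
  at \<open>q\<close> and \<open>r\<close>, which holds because \<open>q\<close> is not a square modulo \<open>r\<close> while \<open>\<plusminus>1\<close> and \<open>\<plusminus>2\<close> are.

  Finally, let \<open>n\<close> be the smaller of the norms of the primes above \<open>q\<close> and \<open>r\<close>, say that of \<open>q\<close>.
  A polynomial that vanishes on the residues modulo \<open>q\<close> shows that \<open>\<JJ>\<^sub>n\<close> contains \<open>t / q\<close>, and divided
  differences bound \<open>\<JJ>\<^sub>n\<close> locally at \<open>q\<close> and \<open>r\<close>; so \<open>\<JJ>\<^sub>n\<close> is not principal.
\<close>

subsection \<open>Algebraic integers form a ring\<close>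

text \<open>No integral basis of the field is computed. Elements are coordinate vectors
  \<open>el a b c d\<close>, integrality is tested by traces and norms to the quadratic subfields,
  and denominators are removed by comparing two coprime integer multiples
  (\<open>module_coprime\<close>): 2p and qr for ideals, 4p and q for residues. The unit group is
  not determined either: non-principality uses only the units attached to a hypothetical generator,
  namely its relative norms divided by q. Their norms have a common value 1 or -1, and -1 cannot
  occur in Q(s) because p = 3 mod 4. The congruences mod 8 make -1 and 2 squares modulo q and r and
  give those units of Q(t) integral coordinates. The invariant that decides is the parity of the
  total multiplicity at q and r: it ignores squares, p and qr, but is odd at q. Since q and r are
  distinct primes, the residue counts above them differ, so exchanging q and r brings the smaller
  one to q.\<close>

lemma algebraic_int_of_int_matrix:
  fixes z :: complex and v :: "nat \<Rightarrow> complex" and A :: "nat \<Rightarrow> nat \<Rightarrow> int"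
  assumes "i0 < n" "v i0 \<noteq> 0"
    and "\<And>i. i < n \<Longrightarrow> z * v i = (\<Sum>j<n. of_int (A i j) * v j)"
  shows "algebraic_int z"
proof -
  define M :: "int mat" where "M = Matrix.mat n n (\<lambda>(i,j). A i j)"
  define M' :: "complex mat" where "M' = map_mat of_int M"
  define w where "w = Matrix.vec n v"
  have M: "M \<in> carrier_mat n n" and M': "M' \<in> carrier_mat n n"
    by (simp_all add: M_def M'_def)
  have w: "w \<in> carrier_vec n" by (simp add: w_def)
  have "w \<noteq> 0\<^sub>v n"
    using assms(1,2) by (metis index_vec index_zero_vec(1) w_def)
  moreover have "M' *\<^sub>v w = z \<cdot>\<^sub>v w"
  proof (rule eq_vecI)
    fix i assume "i < dim_vec (z \<cdot>\<^sub>v w)"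
    hence i: "i < n" by (simp add: w_def)
    have "(M' *\<^sub>v w) $ i = (\<Sum>j<n. of_int (A i j) * v j)"
      using i by (simp add: M'_def M_def w_def scalar_prod_def atLeast0LessThan)
    thus "(M' *\<^sub>v w) $ i = (z \<cdot>\<^sub>v w) $ i"
      using assms(3)[OF i] i by (simp add: w_def)
  qed (simp add: M'_def M_def w_def)
  ultimately have "eigenvector M' w z"
    using M' w by (auto simp: eigenvector_def)
  hence "eigenvalue M' z" by (auto simp: eigenvalue_def)
  hence "poly (char_poly M') z = 0"
    using M' eigenvalue_root_char_poly by blast
  moreover have "char_poly M' = map_poly of_int (char_poly M)"
    unfolding M'_def by (rule of_int_hom.char_poly_hom[OF M])
  moreover have "monic (char_poly M)"
    using degree_monic_char_poly[OF M] by simp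
  ultimately show ?thesis
    unfolding algebraic_int_altdef_ipoly by metis
qed

text \<open>The \<open>f i\<close> may be linearly dependent; it is enough that one of them is
  nonzero, since the vector of all of them is then an eigenvector of an integer matrix. This is what
  permits monomials in two algebraic integers as generators.\<close>

lemma algebraic_int_of_int_span:
  fixes z :: complex and f :: "'a \<Rightarrow> complex"
  assumes "finite I" "i0 \<in> I" "f i0 \<noteq> 0"
    and "\<And>i. i \<in> I \<Longrightarrow> \<exists>c :: 'a \<Rightarrow> int. z * f i = (\<Sum>j\<in>I. of_int (c j) * f j)"
  shows "algebraic_int z"
proof -
  obtain h where h: "bij_betw h {..<card I} I"
    using ex_bij_betw_nat_finite[OF assms(1)] by (auto simp: atLeast0LessThan)
  obtain c :: "'a \<Rightarrow> 'a \<Rightarrow> int" where c: "\<And>i. i \<in> I \<Longrightarrow> z * f i = (\<Sum>j\<in>I. of_int (c i j) * f j)"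
    using assms(4) by metis
  obtain k where k: "k < card I" "h k = i0"
    using h assms(2) by (metis bij_betw_iff_bijections lessThan_iff)
  show ?thesis
  proof (rule algebraic_int_of_int_matrix[of k "card I" "f \<circ> h" z "\<lambda>i j. c (h i) (h j)"])
    show "k < card I" "(f \<circ> h) k \<noteq> 0" using k assms(3) by auto
    fix i assume i: "i < card I"
    hence "h i \<in> I" using h by (auto simp: bij_betw_def)
    from c[OF this] show "z * (f \<circ> h) i = (\<Sum>j<card I. of_int (c (h i) (h j)) * (f \<circ> h) j)"
      using sum.reindex_bij_betw[OF h, of "\<lambda>j. of_int (c (h i) j) * f j"] by simp
  qed
qed

lemma monic_power_reduce:
  fixes x :: complex
  assumes "algebraic_int x"
  obtains n and c :: "nat \<Rightarrow> int" where "n > 0" "x ^ n = (\<Sum>i<n. of_int (c i) * x ^ i)"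
proof -
  obtain P :: "int poly" where P: "poly (map_poly of_int P) x = 0" "lead_coeff P = 1"
    using assms algebraic_int_altdef_ipoly by blast
  define n where "n = Polynomial.degree P"
  have "n > 0"
  proof (rule ccontr)
    assume "\<not> n > 0"
    hence "Polynomial.degree P = 0" by (simp add: n_def)
    then obtain a where "P = [:a:]" using degree_eq_zeroE by blast
    with P show False by (auto simp: map_poly_pCons)
  qed
  have "(\<Sum>i\<le>n. of_int (Polynomial.coeff P i) * x ^ i) = 0"
    using P(1) by (simp add: poly_altdef n_def coeff_map_poly degree_map_poly)
  moreover have "{..n} = insert n {..<n}" by auto
  ultimately have "x ^ n + (\<Sum>i<n. of_int (Polynomial.coeff P i) * x ^ i) = 0"
    using P(2) by (simp add: n_def)
  hence "x ^ n = (\<Sum>i<n. of_int (- Polynomial.coeff P i) * x ^ i)"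
    by (simp add: add_eq_0_iff2 sum_negf)
  with \<open>n > 0\<close> show ?thesis by (rule that)
qed

text \<open>\<open>M\<close> is the additive group of Z[x, y]. Multiplication by \<open>x\<close>
  leaves the range of exponents only at \<open>x ^ n\<close>, where the monic relation brings it
  back, and likewise for \<open>y\<close>. So \<open>M\<close> is a finitely generated group stable
  under \<open>x + y\<close> and \<open>x * y\<close>.\<close>

lemma int_span_closed_under_polynomials:
  fixes x y :: complex
  assumes n: "n > 0" "x ^ n = (\<Sum>i<n. of_int (c i) * x ^ i)"
    and m: "m > 0" "y ^ m = (\<Sum>i<m. of_int (d i) * y ^ i)"
  defines "f \<equiv> \<lambda>(i::nat, j::nat). x ^ i * y ^ j" and "I \<equiv> {..<n} \<times> {..<m}"
  defines "M \<equiv> {w. \<exists>e :: nat \<times> nat \<Rightarrow> int. w = (\<Sum>k\<in>I. of_int (e k) * f k)}"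
  shows "w \<in> M \<Longrightarrow> x * w \<in> M" and "w \<in> M \<Longrightarrow> y * w \<in> M"
    and "w \<in> M \<Longrightarrow> w' \<in> M \<Longrightarrow> w + w' \<in> M" and "k \<in> I \<Longrightarrow> f k \<in> M"
proof -
  have fin: "finite I" by (simp add: I_def)
  have MI: "w \<in> M" if "w = (\<Sum>k\<in>I. of_int (e k) * f k)" for w and e :: "nat \<times> nat \<Rightarrow> int"
    using that unfolding M_def by (intro CollectI exI)
  have gen: "f k \<in> M" if "k \<in> I" for k
  proof -
    have "f k = (\<Sum>l\<in>I. of_int (if l = k then 1 else 0) * f l)"
      using that fin by (simp add: if_distrib[of of_int] if_distrib[of "\<lambda>x. x * _"] sum.delta cong: if_cong)
    thus ?thesis by (rule MI)
  qed
  have add: "w + w' \<in> M" if w: "w \<in> M" "w' \<in> M" for w w'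
  proof -
    from w obtain e e' :: "nat \<times> nat \<Rightarrow> int" where "w = (\<Sum>k\<in>I. of_int (e k) * f k)"
      "w' = (\<Sum>k\<in>I. of_int (e' k) * f k)" unfolding M_def by blast
    hence "w + w' = (\<Sum>k\<in>I. of_int (e k + e' k) * f k)"
      by (simp add: sum.distrib ring_distribs)
    thus ?thesis by (rule MI)
  qed
  have scale: "of_int a * w \<in> M" if w: "w \<in> M" for a w
  proof -
    from w obtain e :: "nat \<times> nat \<Rightarrow> int" where "w = (\<Sum>k\<in>I. of_int (e k) * f k)"
      unfolding M_def by blast
    hence "of_int a * w = (\<Sum>k\<in>I. of_int (a * e k) * f k)"
      by (simp add: sum_distrib_left mult_ac)
    thus ?thesis by (rule MI)
  qed
  have zero: "0 \<in> M" unfolding M_def by (auto intro!: exI[of _ "\<lambda>_. 0"])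
  have sum: "(\<Sum>a\<in>A. g a) \<in> M" if "\<And>a. a \<in> A \<Longrightarrow> g a \<in> M" for A and g :: "nat \<Rightarrow> complex"
    using that by (induction A rule: infinite_finite_induct) (auto intro: zero add)
  have sum2: "(\<Sum>a\<in>A. g a) \<in> M" if "\<And>a. a \<in> A \<Longrightarrow> g a \<in> M" for A and g :: "nat \<times> nat \<Rightarrow> complex"
    using that by (induction A rule: infinite_finite_induct) (auto intro: zero add)
  have xgen: "x * f k \<in> M" if kI: "k \<in> I" for k
  proof -
    obtain i j where k: "k = (i,j)" "i < n" "j < m" using kI by (auto simp: I_def)
    show ?thesis
    proof (cases "Suc i < n")
      case True
      hence "x * f k = f (Suc i, j)" by (simp add: f_def k)
      thus ?thesis using gen[of "(Suc i, j)"] True k by (simp add: I_def)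
    next
      case False
      hence "Suc i = n" using k by simp
      hence "x * f k = x ^ n * y ^ j" by (simp add: f_def k flip: power_Suc mult.assoc)
      also have "\<dots> = (\<Sum>a<n. of_int (c a) * f (a, j))"
        unfolding n(2) sum_distrib_right by (simp add: f_def mult_ac)
      also have "\<dots> \<in> M" using k by (intro sum scale gen) (auto simp: I_def)
      finally show ?thesis .
    qed
  qed
  have ygen: "y * f k \<in> M" if kI: "k \<in> I" for k
  proof -
    obtain i j where k: "k = (i,j)" "i < n" "j < m" using kI by (auto simp: I_def)
    show ?thesis
    proof (cases "Suc j < m")
      case True
      hence "y * f k = f (i, Suc j)" by (simp add: f_def k)
      thus ?thesis using gen[of "(i, Suc j)"] True k by (simp add: I_def)
    next
      case False
      hence "Suc j = m" using k by simp
      hence "y * f k = x ^ i * y ^ m" by (auto simp add: f_def k)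
      also have "\<dots> = (\<Sum>a<m. of_int (d a) * f (i, a))"
        unfolding m(2) sum_distrib_left by (simp add: f_def mult_ac)
      also have "\<dots> \<in> M" using k by (intro sum scale gen) (auto simp: I_def)
      finally show ?thesis .
    qed
  qed
  have lin: "u * w \<in> M" if w: "w \<in> M" and u: "\<And>k. k \<in> I \<Longrightarrow> u * f k \<in> M" for u w
  proof -
    from w obtain e :: "nat \<times> nat \<Rightarrow> int" where "w = (\<Sum>k\<in>I. of_int (e k) * f k)"
      unfolding M_def by blast
    hence "u * w = (\<Sum>k\<in>I. of_int (e k) * (u * f k))" by (simp add: sum_distrib_left mult_ac)
    thus ?thesis using sum2[of I "\<lambda>k. of_int (e k) * (u * f k)"] scale u by simp
  qed
  show "w \<in> M \<Longrightarrow> x * w \<in> M" and "w \<in> M \<Longrightarrow> y * w \<in> M"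
    and "w \<in> M \<Longrightarrow> w' \<in> M \<Longrightarrow> w + w' \<in> M" and "k \<in> I \<Longrightarrow> f k \<in> M"
    using lin xgen ygen add gen by blast+
qed

lemma
  fixes x y :: complex
  assumes "algebraic_int x" "algebraic_int y"
  shows algebraic_int_add: "algebraic_int (x + y)" and algebraic_int_mult: "algebraic_int (x * y)"
proof -
  obtain n and c :: "nat \<Rightarrow> int" where n: "n > 0" "x ^ n = (\<Sum>i<n. of_int (c i) * x ^ i)"
    using monic_power_reduce[OF assms(1)] by metis
  obtain m and d :: "nat \<Rightarrow> int" where m: "m > 0" "y ^ m = (\<Sum>i<m. of_int (d i) * y ^ i)"
    using monic_power_reduce[OF assms(2)] by metis
  define f where "f = (\<lambda>(i::nat, j::nat). x ^ i * y ^ j)"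
  define I where "I = {..<n} \<times> {..<m}"
  note cl = int_span_closed_under_polynomials[OF n m, folded f_def I_def]
  have I: "finite I" "(0,0) \<in> I" "f (0,0) \<noteq> 0" using n m by (auto simp: I_def f_def)
  show "algebraic_int (x + y)"
  proof (rule algebraic_int_of_int_span[of I "(0,0)" f, OF I])
    fix k assume "k \<in> I"
    note k = cl(4)[OF this]
    from cl(3)[OF cl(1)[OF k] cl(2)[OF k]]
    show "\<exists>c. (x + y) * f k = (\<Sum>j\<in>I. of_int (c j) * f j)"
      by (simp add: ring_distribs)
  qed
  show "algebraic_int (x * y)"
  proof (rule algebraic_int_of_int_span[of I "(0,0)" f, OF I])
    fix k assume "k \<in> I"
    note k = cl(4)[OF this]
    from cl(1)[OF cl(2)[OF k]]
    show "\<exists>c. (x * y) * f k = (\<Sum>j\<in>I. of_int (c j) * f j)"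
      by (simp add: mult.assoc)
  qed
qed

lemma algebraic_int_diff:
  fixes x y :: complex
  shows "algebraic_int x \<Longrightarrow> algebraic_int y \<Longrightarrow> algebraic_int (x - y)"
  using algebraic_int_add[of x "- y"] by auto

section \<open>Coprime factors of a square, or of a prime times a square\<close>

lemma coprime_mult_square_int:
  fixes a b c :: int
  assumes "coprime a b" "a * b = c\<^sup>2" "c \<noteq> 0"
  obtains x where "a = x\<^sup>2 \<or> a = - x\<^sup>2"
proof -
  have "nat \<bar>a\<bar> * nat \<bar>b\<bar> = (nat \<bar>c\<bar>)\<^sup>2"
    using assms(2) by (metis abs_mult abs_ge_zero nat_mult_distrib nat_power_eq power_abs)
  hence "is_nth_power 2 (nat \<bar>a\<bar> * nat \<bar>b\<bar>)" by (auto simp: is_nth_power_def)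
  moreover have "coprime (nat \<bar>a\<bar>) (nat \<bar>b\<bar>)"
    using assms(1) by (metis coprime_abs_left_iff coprime_abs_right_iff coprime_int_iff int_nat_eq abs_ge_zero)
  moreover have "nat \<bar>a\<bar> > 0" "nat \<bar>b\<bar> > 0" using assms(2,3) by auto
  ultimately have "is_nth_power 2 (nat \<bar>a\<bar>)" using is_nth_power_mult_coprime_natD(1) by blast
  then obtain n where "nat \<bar>a\<bar> = n ^ 2" by (auto simp: is_nth_power_def)
  hence "\<bar>a\<bar> = (int n)\<^sup>2" by (metis abs_ge_zero int_nat_eq of_nat_power)
  thus ?thesis using that[of "int n"] by (auto simp: abs_if split: if_splits)
qed

lemma coprime_mult_square_int_nonneg:
  fixes a b c :: int
  assumes "coprime a b" "a * b = c\<^sup>2" "c \<noteq> 0" "a > 0"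
  obtains x where "a = x\<^sup>2"
proof -
  obtain x where "a = x\<^sup>2 \<or> a = - x\<^sup>2" using coprime_mult_square_int[OF assms(1-3)] .
  thus ?thesis using assms(4) that[of x] zero_le_power2[of x] by linarith
qed

text \<open>The prime goes into one of the coprime factors; cancelling it leaves two coprime factors
  of a square. In the Pell descent the factors are \<open>a + 1\<close> and \<open>a - 1\<close>, or
  their halves.\<close>

lemma coprime_mult_prime_square:
  fixes u v l b :: int
  assumes l: "Factorial_Ring.prime l" and cop: "coprime u v"
    and uv: "u * v = l * b\<^sup>2" "b \<noteq> 0" "u > 0" "v > 0"
  obtains x y where "u = l * x\<^sup>2 \<and> v = y\<^sup>2 \<or> u = x\<^sup>2 \<and> v = l * y\<^sup>2" "x\<^sup>2 * y\<^sup>2 = b\<^sup>2"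
proof -
  have l0: "l > 0" using l by (simp add: prime_gt_0_int)
  have sq: "\<exists>x y. a = x\<^sup>2 \<and> c = y\<^sup>2" if ac: "coprime a c" "a * c = b\<^sup>2" "a > 0" "c > 0" for a c
  proof -
    have "c * a = b\<^sup>2" "coprime c a" using ac by (simp_all only: mult.commute coprime_commute)
    thus ?thesis using coprime_mult_square_int_nonneg[of a c b] coprime_mult_square_int_nonneg[of c a b] ac uv(2)
      by metis
  qed
  have "l dvd u \<or> l dvd v" using uv(1) l by (metis dvd_triv_left prime_dvd_mult_iff)
  thus ?thesis
  proof
    assume "l dvd u"
    then obtain w where w: "u = l * w" by (auto elim: dvdE)
    have "l * (w * v) = l * b\<^sup>2" using uv(1) w by (simp only: mult.assoc)
    hence wv: "w * v = b\<^sup>2" using l0 by simp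
    have "w > 0" using uv(3) l0 w by (simp add: zero_less_mult_iff)
    moreover have "coprime w v" using cop w by simp
    ultimately obtain x y where "w = x\<^sup>2" "v = y\<^sup>2" using sq[OF _ wv] uv(4) by blast
    thus ?thesis using that w wv by blast
  next
    assume "l dvd v"
    then obtain w where w: "v = l * w" by (auto elim: dvdE)
    have "l * (u * w) = l * b\<^sup>2" using uv(1) w by (simp only: mult.left_commute)
    hence wv: "u * w = b\<^sup>2" using l0 by simp
    have "w > 0" using uv(4) l0 w by (simp add: zero_less_mult_iff)
    moreover have "coprime u w" using cop w by simp
    ultimately obtain x y where "u = x\<^sup>2" "w = y\<^sup>2" using sq[OF _ wv] uv(3) by blast
    thus ?thesis using that w wv by blast
  qed
qed

subsection \<open>Quadratic residues\<close>

text \<open>A primitive root yields \<open>y\<close> with \<open>y ^ 4 = - 1\<close> modulo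
  \<open>r\<close>, a primitive eighth root of unity. Then \<open>y\<^sup>2\<close> is a root of -1,
  and \<open>y - y ^ 3\<close>, which is \<open>y\<close> plus its inverse, is a root of 2; their
  product settles -2.\<close>

lemma sqrt_minus_one_and_two_mod_prime:
  fixes r :: nat
  assumes "Factorial_Ring.prime r" "[r = 1] (mod 8)" and e: "e \<in> {1, 2, -1, -2 :: int}"
  shows "QuadRes (int r) e"
proof -
  have r8: "r mod 8 = 1" using assms(2) by (simp add: unique_euclidean_semiring_class.cong_def)
  have r2: "r > 2" using assms(1) r8 prime_ge_2_nat[of r] by (cases "r = 2") auto
  obtain g where g: "residue_primroot r g"
    using prime_primitive_root_exists[of r] assms(1) r2 by auto
  define k where "k = (r - 1) div 8"
  have rk: "r = 8 * k + 1" using r8 unfolding k_def by presburger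
  have k0: "k > 0" using rk r2 by simp
  have cop: "coprime r g" using g by (auto simp: residue_primroot_def)
  have "ord r g = r - 1" using g assms(1) by (auto simp: residue_primroot_def totient_prime)
  hence og: "ord r g = 8 * k" using rk by simp
  have "[g ^ (8 * k) = 1] (mod r)" using ord[of g r] og by simp
  hence "int r dvd (int g) ^ (8 * k) - 1"
    by (metis cong_iff_dvd_diff cong_int_iff of_nat_1 of_nat_power)
  moreover have "(int g) ^ (8 * k) - 1 = (int g ^ (4 * k) - 1) * (int g ^ (4 * k) + 1)"
    by (simp add: algebra_simps flip: power_add)
  ultimately have "int r dvd int g ^ (4 * k) - 1 \<or> int r dvd int g ^ (4 * k) + 1"
    using assms(1) by (metis prime_dvd_mult_iff prime_int_nat_transfer prime_nat_int_transfer)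
  moreover have "\<not> int r dvd int g ^ (4 * k) - 1"
  proof
    assume "int r dvd int g ^ (4 * k) - 1"
    hence "[g ^ (4 * k) = 1] (mod r)"
      by (metis cong_iff_dvd_diff cong_int_iff of_nat_1 of_nat_power)
    hence "ord r g dvd 4 * k" using ord_divides by blast
    thus False using og k0 by (auto dest: dvd_imp_le)
  qed
  ultimately have "int r dvd int g ^ (4 * k) + 1" by blast
  define y where "y = int g ^ k"
  have y: "int r dvd y ^ 4 + 1"
    using \<open>int r dvd int g ^ (4 * k) + 1\<close> by (simp add: y_def mult.commute flip: power_mult)
  have "[(y - y ^ 3)\<^sup>2 = 2] (mod int r)"
  proof -
    have "(y - y ^ 3)\<^sup>2 - 2 = (y ^ 4 + 1) * (y\<^sup>2 - 2)"
      by (simp add: algebra_simps power2_eq_square eval_nat_numeral)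
    thus ?thesis using y by (simp add: cong_iff_dvd_diff)
  qed
  moreover have "[(y\<^sup>2)\<^sup>2 = - 1] (mod int r)"
  proof -
    have "(y\<^sup>2)\<^sup>2 - (- 1) = y ^ 4 + 1" by (simp flip: power_mult)
    thus ?thesis using y by (simp add: cong_iff_dvd_diff)
  qed
  moreover have "[(y\<^sup>2 * (y - y ^ 3))\<^sup>2 = - 2] (mod int r)"
    using cong_mult[OF calculation(2,1)] by (simp add: power_mult_distrib)
  moreover have "[1\<^sup>2 = 1] (mod int r)" by simp
  ultimately show ?thesis using e unfolding QuadRes_def by blast
qed

lemma QuadRes_of_mult_square:
  fixes r :: nat and a c x :: int
  assumes "Factorial_Ring.prime r" "[a * x\<^sup>2 = c] (mod int r)" "QuadRes (int r) c" "\<not> int r dvd x"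
  shows "QuadRes (int r) a"
proof -
  obtain d where d: "[d\<^sup>2 = c] (mod int r)" using assms(3) by (auto simp: QuadRes_def)
  have "coprime (int r) x" using assms(1,4) by (simp add: prime_imp_coprime)
  then obtain x' where x': "[x * x' = 1] (mod int r)"
    by (metis coprime_commute cong_solve_coprime_int)
  have "[(d * x')\<^sup>2 = c * x'\<^sup>2] (mod int r)"
    using d by (simp add: power_mult_distrib cong_mult)
  also have "[c * x'\<^sup>2 = (a * x\<^sup>2) * x'\<^sup>2] (mod int r)"
    using assms(2) by (simp add: cong_mult cong_sym)
  also have "(a * x\<^sup>2) * x'\<^sup>2 = a * (x * x')\<^sup>2" by (simp add: power_mult_distrib)
  also have "[a * (x * x')\<^sup>2 = a * 1\<^sup>2] (mod int r)"
    using x' by (intro cong_mult cong_pow) auto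
  finally show ?thesis unfolding QuadRes_def by auto
qed

text \<open>If \<open>q\<close> divides \<open>u\<close> while \<open>r\<close> divides
  \<open>v\<close>, then \<open>u = q * u1\<close>, \<open>v = r * v1\<close>, and \<open>u1\<close>
  or \<open>v1\<close> is a square up to sign. As \<open>u\<close> and \<open>v\<close> differ by
  \<open>e\<close>, this makes \<open>q\<close> times a square congruent to \<open>e\<close> or
  \<open>- e\<close> modulo \<open>r\<close>, or \<open>r\<close> times a square modulo
  \<open>q\<close>, although 1, -1, 2 and -2 are squares there. The values \<open>s = 1\<close> and
  \<open>s = p\<close> serve the subfields of \<open>q * r\<close> and
  \<open>p * q * r\<close>.\<close>

lemma coprime_pair_dvd_transfer:
  fixes q r :: nat and u v e s b :: int
  assumes q: "Factorial_Ring.prime q" "[q = 1] (mod 8)" and r: "Factorial_Ring.prime r" "[r = 1] (mod 8)"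
    and nqr: "\<not> QuadRes (int r) (int q)" and nrq: "\<not> QuadRes (int q) (int r)"
    and s: "s = 1 \<or> Factorial_Ring.prime s"
    and uv: "coprime u v" "u * v = int q * int r * s * b\<^sup>2" "v = u - e" "e \<in> {1, 2}"
    and qu: "int q dvd u"
  shows "int r dvd u"
proof (rule ccontr)
  assume nr: "\<not> int r dvd u"
  have pr: "Factorial_Ring.prime (int r)" "Factorial_Ring.prime (int q)" using q r by simp_all
  have "int r dvd u * v" using uv(2) by simp
  hence rv: "int r dvd v" using nr pr by (simp add: prime_dvd_mult_iff)
  from qu obtain u1 where u1: "u = int q * u1" by (auto elim: dvdE)
  from rv obtain v1 where v1: "v = int r * v1" by (auto elim: dvdE)
  have q0: "int q \<noteq> 0" "int r \<noteq> 0" using pr by auto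
  have "int q * int r * (u1 * v1) = int q * int r * (s * b\<^sup>2)" using uv(2) u1 v1 by (simp add: mult_ac)
  hence uv1: "u1 * v1 = s * b\<^sup>2" using q0 by simp
  have big: "q > 2" "r > 2" using q r prime_ge_2_nat[of q] prime_ge_2_nat[of r]
    by (auto simp: unique_euclidean_semiring_class.cong_def intro!: le_neq_implies_less)
  have b0: "b \<noteq> 0"
  proof
    assume "b = 0"
    hence "u = 0 \<or> v = 0" using uv by simp
    thus False using uv(1) u1 v1 big by auto
  qed
  have cop1: "coprime u1 v1" using uv(1) u1 v1 by simp
  \<comment> \<open>Only one of the coprime cofactors can absorb the prime \<open>s\<close>; the
    other is a square up to sign.\<close>
  have cases: "(\<exists>x. u1 = x\<^sup>2 \<or> u1 = - x\<^sup>2) \<or> (\<exists>x. v1 = x\<^sup>2 \<or> v1 = - x\<^sup>2)"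
    using s
  proof
    assume "s = 1"
    hence "u1 * v1 = b\<^sup>2" using uv1 by simp
    from coprime_mult_square_int[OF cop1 this b0] show ?thesis by metis
  next
    assume s: "Factorial_Ring.prime s"
    hence s0: "s \<noteq> 0" by auto
    have "s dvd u1 * v1" using uv1 by simp
    hence "s dvd u1 \<or> s dvd v1" using s by (simp add: prime_dvd_mult_iff)
    thus ?thesis
    proof
      assume "s dvd u1"
      then obtain w where w: "u1 = s * w" by (auto elim: dvdE)
      have "s * (v1 * w) = s * b\<^sup>2" using uv1 w by (simp add: mult_ac)
      hence "v1 * w = b\<^sup>2" using s0 by simp
      moreover have "coprime w v1" using cop1 w by simp
      hence "coprime v1 w" by (simp only: coprime_commute)
      ultimately have "v1 * w = b\<^sup>2" "coprime v1 w" by blast+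
      from coprime_mult_square_int[OF this(2,1) b0] show ?thesis by metis
    next
      assume "s dvd v1"
      then obtain w where w: "v1 = s * w" by (auto elim: dvdE)
      have "s * (u1 * w) = s * b\<^sup>2" using uv1 w by (simp add: mult_ac)
      hence "u1 * w = b\<^sup>2" "coprime u1 w" using s0 cop1 w by simp_all
      from coprime_mult_square_int[OF this(2,1) b0] show ?thesis by metis
    qed
  qed
  thus False
  proof
    assume "\<exists>x. u1 = x\<^sup>2 \<or> u1 = - x\<^sup>2"
    then obtain x where x: "u1 = x\<^sup>2 \<or> u1 = - x\<^sup>2" by blast
    have nx: "\<not> int r dvd x" using nr x u1 by (auto simp: power2_eq_square)
    have "int r dvd u - e" using rv uv(3) by simp
    have "[int q * x\<^sup>2 = e] (mod int r) \<or> [int q * x\<^sup>2 = - e] (mod int r)"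
      using x
    proof
      assume "u1 = x\<^sup>2"
      thus ?thesis using \<open>int r dvd u - e\<close> u1 by (simp add: cong_iff_dvd_diff)
    next
      assume "u1 = - x\<^sup>2"
      hence "int q * x\<^sup>2 - (- e) = - (u - e)" using u1 by simp
      hence "int r dvd int q * x\<^sup>2 - (- e)" using \<open>int r dvd u - e\<close> by (simp only: dvd_minus_iff)
      thus ?thesis unfolding cong_iff_dvd_diff by blast
    qed
    moreover have "QuadRes (int r) e" "QuadRes (int r) (- e)"
      using sqrt_minus_one_and_two_mod_prime[OF r] uv(4) by auto
    ultimately show False using QuadRes_of_mult_square[OF r(1) _ _ nx] nqr by blast
  next
    assume "\<exists>x. v1 = x\<^sup>2 \<or> v1 = - x\<^sup>2"
    then obtain x where x: "v1 = x\<^sup>2 \<or> v1 = - x\<^sup>2" by blast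
    have "\<not> int q dvd v"
      using uv(1) qu pr by (meson coprime_common_divisor not_prime_unit)
    hence nx: "\<not> int q dvd x" using x v1 by (auto simp: power2_eq_square)
    have "int q dvd v + e" using qu uv(3) by simp
    have "[int r * x\<^sup>2 = e] (mod int q) \<or> [int r * x\<^sup>2 = - e] (mod int q)"
      using x
    proof
      assume "v1 = x\<^sup>2"
      hence "int r * x\<^sup>2 - (- e) = v + e" using v1 by simp
      hence "int q dvd int r * x\<^sup>2 - (- e)" using \<open>int q dvd v + e\<close> by (simp only:)
      thus ?thesis unfolding cong_iff_dvd_diff by blast
    next
      assume "v1 = - x\<^sup>2"
      hence "int r * x\<^sup>2 - e = - (v + e)" using v1 by simp
      hence "int q dvd int r * x\<^sup>2 - e" using \<open>int q dvd v + e\<close> by (simp only: dvd_minus_iff)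
      thus ?thesis unfolding cong_iff_dvd_diff by blast
    qed
    moreover have "QuadRes (int q) e" "QuadRes (int q) (- e)"
      using sqrt_minus_one_and_two_mod_prime[OF q] uv(4) by auto
    ultimately show False using QuadRes_of_mult_square[OF q(1) _ _ nx] nrq by blast
  qed
qed

section \<open>Multiplicities at q and r for solutions of norm one\<close>

lemma coprime_neighbours: "even (a::int) \<Longrightarrow> coprime (a + 1) (a - 1)"
proof (rule coprimeI)
  fix c assume "even a" and c: "c dvd a + 1" "c dvd a - 1"
  hence "c dvd 2" using dvd_diff[OF c] by simp
  moreover have "odd c" using c \<open>even a\<close> by (meson dvd_trans even_plus_one_iff)
  ultimately show "is_unit c"
    by (metis coprime_common_divisor coprime_right_2_iff_odd dvd_refl)
qed

text \<open>The norm equation says \<open>(a + 1) * (a - 1) = q * r * s * b\<^sup>2\<close>. For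
  even \<open>a\<close> the factors are coprime with difference 2; for odd \<open>a\<close> both are
  halved, which gives coprime factors with difference 1.\<close>

lemma norm_one_dvd_transfer:
  fixes q r :: nat and a b s :: int
  assumes q: "Factorial_Ring.prime q" "[q = 1] (mod 8)" and r: "Factorial_Ring.prime r" "[r = 1] (mod 8)"
    and nqr: "\<not> QuadRes (int r) (int q)" and nrq: "\<not> QuadRes (int q) (int r)"
    and s: "s = 1 \<or> Factorial_Ring.prime s" "odd s"
    and ab: "a\<^sup>2 - int q * int r * s * b\<^sup>2 = 1"
    and qa: "int q dvd a + 1"
  shows "int r dvd a + 1"
proof (cases "even a")
  case True
  have "coprime (a + 1) (a - 1)" using True by (rule coprime_neighbours)
  moreover have "(a + 1) * (a - 1) = int q * int r * s * b\<^sup>2"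
    using ab by (simp add: algebra_simps power2_eq_square)
  ultimately show ?thesis
    by (rule coprime_pair_dvd_transfer[OF q r nqr nrq s(1), where e = 2, OF _ _ _ _ qa]) simp_all
next
  case False
  then obtain c where c: "a = 2 * c + 1" by (elim oddE)
  have oq: "odd (int q)" "odd (int r)" using q r by (auto simp: unique_euclidean_semiring_class.cong_def) presburger+
  have e: "4 * (c * (c + 1)) = int q * int r * s * b\<^sup>2"
    using ab c by (simp add: algebra_simps power2_eq_square)
  hence "even (int q * int r * s * b\<^sup>2)" by (metis dvd_triv_left even_mult_iff even_numeral)
  hence "even b" using oq s(2) by simp
  then obtain d where d: "b = 2 * d" by (elim evenE)
  have "(c + 1) * c = int q * int r * s * d\<^sup>2"
    using e d by (simp add: algebra_simps power2_eq_square)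
  moreover have "coprime (c + 1) c" by (simp add: coprime_commute)
  moreover have qc: "int q dvd c + 1"
  proof -
    have "int q dvd 2 * (c + 1)" using qa c by (simp add: algebra_simps)
    moreover have "coprime (int q) 2" using oq by simp
    ultimately show ?thesis using coprime_dvd_mult_right_iff by blast
  qed
  ultimately have "int r dvd c + 1"
    by (intro coprime_pair_dvd_transfer[OF q r nqr nrq s(1), where e = 1 and v = c and b = d]) simp_all
  hence "int r dvd 2 * (c + 1)" by (rule dvd_mult)
  thus ?thesis using c by (simp add: algebra_simps)
qed

text \<open>An odd prime divides at most one of \<open>a + 1\<close> and \<open>a - 1\<close>, so
  all of its multiplicity in \<open>D * b\<^sup>2\<close> sits in a single factor.\<close>

lemma multiplicity_norm_one:
  fixes l :: nat and a b D :: int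
  assumes l: "Factorial_Ring.prime l" "odd l" and ab: "a\<^sup>2 - D * b\<^sup>2 = 1" and "D \<noteq> 0" "b \<noteq> 0"
  shows "multiplicity (int l) (2 * (a + 1)) =
    (if int l dvd a + 1 then multiplicity (int l) D + 2 * multiplicity (int l) b else 0)"
proof -
  have pl: "Factorial_Ring.prime (int l)" using l by simp
  have nl2: "\<not> int l dvd 2" using l
    by (metis even_of_nat int_dvd_int_iff of_nat_numeral prime_ge_2_nat nat_dvd_not_less zero_less_numeral le_neq_implies_less even_numeral odd_one)
  have prod: "(a + 1) * (a - 1) = D * b\<^sup>2" using ab by (simp add: algebra_simps power2_eq_square)
  have nz: "a + 1 \<noteq> 0" "a - 1 \<noteq> 0" using prod assms(4,5) by auto
  have "multiplicity (int l) (2 * (a + 1)) = multiplicity (int l) (a + 1)"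
    using pl nl2 nz by (subst prime_elem_multiplicity_mult_distrib) (auto simp: not_dvd_imp_multiplicity_0)
  also have "\<dots> = (if int l dvd a + 1 then multiplicity (int l) D + 2 * multiplicity (int l) b else 0)"
  proof (cases "int l dvd a + 1")
    case True
    have "\<not> int l dvd a - 1"
    proof
      assume "int l dvd a - 1"
      from dvd_diff[OF True this] nl2 show False by simp
    qed
    hence "multiplicity (int l) (a + 1) = multiplicity (int l) ((a + 1) * (a - 1))"
      using pl nz by (subst prime_elem_multiplicity_mult_distrib) (auto simp: not_dvd_imp_multiplicity_0)
    also have "\<dots> = multiplicity (int l) D + 2 * multiplicity (int l) b"
      unfolding prod using pl assms(4,5)
      by (simp add: prime_elem_multiplicity_mult_distrib prime_elem_multiplicity_power_distrib)
    finally show ?thesis using True by simp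
  qed (auto simp: not_dvd_imp_multiplicity_0)
  finally show ?thesis .
qed

lemma multiplicity_eq_0_prime:
  fixes l m :: nat
  assumes "Factorial_Ring.prime l" "Factorial_Ring.prime m" "l \<noteq> m"
  shows "multiplicity (int l) (int m) = 0"
  using assms by (metis not_dvd_imp_multiplicity_0 int_dvd_int_iff primes_dvd_imp_eq)

text \<open>On nonzero integers this is a homomorphism modulo squares
  (\<open>qr_parity_mult\<close>). It is even at \<open>p\<close> and at \<open>q * r\<close> but
  odd at \<open>q\<close>, which separates \<open>q\<close> from the squares of the field.\<close>

definition qr_parity :: "nat \<Rightarrow> nat \<Rightarrow> int \<Rightarrow> bool" where
  "qr_parity q r x \<longleftrightarrow> even (multiplicity (int q) x + multiplicity (int r) x)"

lemma qr_parity_mult: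
  assumes "Factorial_Ring.prime q" "Factorial_Ring.prime r" "x \<noteq> 0" "y \<noteq> 0"
  shows "qr_parity q r (x * y) \<longleftrightarrow> (qr_parity q r x \<longleftrightarrow> qr_parity q r y)"
  using assms unfolding qr_parity_def
  by (simp add: prime_elem_multiplicity_mult_distrib) presburger

text \<open>For \<open>D = p\<close> the multiplicities at \<open>q\<close> and \<open>r\<close> are
  even one by one. For the other two values each of \<open>q\<close>, \<open>r\<close> contributes
  an odd number exactly when it divides \<open>a + 1\<close>, and
  \<open>norm_one_dvd_transfer\<close>, used in both directions, makes this happen for both or for
  neither.\<close>

lemma qr_parity_norm_one:
  fixes p q r :: nat and a b D :: int
  assumes p: "Factorial_Ring.prime p" "odd p" "p \<noteq> q" "p \<noteq> r" and qr: "q \<noteq> r"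
    and q: "Factorial_Ring.prime q" "[q = 1] (mod 8)" and r: "Factorial_Ring.prime r" "[r = 1] (mod 8)"
    and nqr: "\<not> QuadRes (int r) (int q)" and nrq: "\<not> QuadRes (int q) (int r)"
    and D: "D \<in> {int p, int q * int r, int p * (int q * int r)}"
    and ab: "a\<^sup>2 - D * b\<^sup>2 = 1" and a: "a \<noteq> - 1"
  shows "qr_parity q r (2 * (a + 1))"
proof -
  have oq: "odd q" "odd r" using q r by (auto simp: unique_euclidean_semiring_class.cong_def) presburger+
  have pr: "Factorial_Ring.prime (int p)" "Factorial_Ring.prime (int q)" "Factorial_Ring.prime (int r)"
    using p q r by simp_all
  have D0: "D \<noteq> 0" using D pr by auto
  show ?thesis
  \<comment> \<open>The multiplicity formula requires nonzero \<open>b\<close>. If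
    \<open>b = 0\<close> then \<open>a = 1\<close>, and the number is 4.\<close>
  proof (cases "b = 0")
    case True
    hence "a = 1" using ab a by (simp add: power2_eq_1_iff)
    moreover have "\<not> int l dvd 2 ^ 2" if "Factorial_Ring.prime l" "odd l" for l :: nat
    proof
      assume "int l dvd 2 ^ 2"
      hence "int l dvd 2" using that by (meson prime_dvd_power prime_nat_int_transfer)
      hence "l dvd 2" by (metis int_dvd_int_iff of_nat_numeral)
      thus False using that by (metis primes_dvd_imp_eq two_is_prime_nat even_numeral)
    qed
    ultimately show ?thesis using q r oq unfolding qr_parity_def
      by (simp add: not_dvd_imp_multiplicity_0)
  next
    case False
    note m = multiplicity_norm_one[OF _ _ ab D0 False]
    note mq = m[OF q(1) oq(1)] and mr = m[OF r(1) oq(2)]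
    note m0 = multiplicity_eq_0_prime
    show ?thesis
    proof (cases "D = int p")
      case True
      thus ?thesis unfolding qr_parity_def mq mr
        using p q r m0[of q p] m0[of r p] by auto
    next
      case nD: False
      hence "D = int q * int r * 1 \<or> D = int q * int r * int p" using D by (auto simp: mult_ac)
      then obtain s where s: "D = int q * int r * s" "s = 1 \<or> s = int p" by blast
      have sp: "s = 1 \<or> Factorial_Ring.prime s" "odd s" "s \<noteq> 0" using s(2) pr p by auto
      have ms: "multiplicity (int q) s = 0" "multiplicity (int r) s = 0"
        using s(2) m0[of q p] m0[of r p] p q r by auto
      have nz: "int q \<noteq> 0" "int r \<noteq> 0" using pr by auto
      have mD: "multiplicity (int q) D = 1" "multiplicity (int r) D = 1"
        using s(1) sp nz pr ms qr m0[of q r] m0[of r q] q r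
        by (simp_all add: prime_elem_multiplicity_mult_distrib)
      have "int r dvd a + 1" if "int q dvd a + 1"
        using norm_one_dvd_transfer[OF q r nqr nrq sp(1,2), of a b] ab s(1) that by simp
      moreover have "int q dvd a + 1" if "int r dvd a + 1"
        using norm_one_dvd_transfer[OF r q nrq nqr sp(1,2), of a b] ab s(1) that by (simp add: mult_ac)
      ultimately show ?thesis unfolding qr_parity_def mq mr mD by auto
    qed
  qed
qed

lemma sqrt_irrational:
  fixes n l :: nat
  assumes l: "Factorial_Ring.prime l" and "odd (multiplicity l n)"
  shows "sqrt (real n) \<notin> \<rat>"
proof
  assume "sqrt (real n) \<in> \<rat>"
  moreover have "algebraic_int (sqrt (real n))" by (intro algebraic_int_sqrt int_imp_algebraic_int) auto
  ultimately have "sqrt (real n) \<in> \<int>" by (rule rational_algebraic_int_is_int[rotated])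
  then obtain m :: int where "sqrt (real n) = of_int m" by (auto elim: Ints_cases)
  hence "real n = (of_int m)\<^sup>2" by (metis of_nat_0_le_iff real_sqrt_pow2)
  hence "real n = real ((nat \<bar>m\<bar>)\<^sup>2)" by (simp flip: of_int_power)
  hence n: "n = (nat \<bar>m\<bar>)\<^sup>2" by (simp only: of_nat_eq_iff)
  show False
  proof (cases "m = 0")
    case True
    thus False using assms(2) n by simp
  next
    case False
    hence "multiplicity l n = 2 * multiplicity l (nat \<bar>m\<bar>)"
      unfolding n using l by (subst prime_elem_multiplicity_power_distrib) auto
    thus False using assms(2) by simp
  qed
qed

lemma prime_sqrt_irrational:
  assumes "Factorial_Ring.prime (p::nat)"
  shows "sqrt (real p) \<notin> \<rat>"
  using sqrt_irrational[OF assms, of p] assms by (simp add: not_prime_unit)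

subsection \<open>Pell's equation\<close>

text \<open>With \<open>w\<close> the square root of \<open>D\<close> and
  \<open>e = w * k - h\<close>, the product is \<open>w\<^sup>2 * k\<^sup>2 - h\<^sup>2\<close>, the
  negative of the norm of the pair \<open>(h, k)\<close>. A good rational approximation thus has
  small norm.\<close>

lemma abs_conjugate_product_le:
  fixes e w k :: real
  assumes e: "\<bar>e\<bar> < 1 / k" and k: "k \<ge> 1" and "w \<ge> 0"
  shows "\<bar>e * (2 * w * k - e)\<bar> \<le> 2 * w + 1"
proof -
  have ek: "\<bar>e\<bar> * k \<le> 1" using e k by (simp add: field_simps)
  moreover have "\<bar>e\<bar> * 1 \<le> \<bar>e\<bar> * k" using k by (intro mult_left_mono) auto
  ultimately have e1: "\<bar>e\<bar> \<le> 1" by simp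
  have "\<bar>e * (2 * w * k - e)\<bar> = \<bar>2 * w * (e * k) - e * e\<bar>" by (simp add: algebra_simps)
  also have "\<dots> \<le> \<bar>2 * w * (e * k)\<bar> + \<bar>e * e\<bar>" by (rule abs_triangle_ineq4)
  also have "\<dots> = 2 * w * (\<bar>e\<bar> * k) + \<bar>e\<bar> * \<bar>e\<bar>" using k \<open>w \<ge> 0\<close> by (simp add: abs_mult)
  also have "\<dots> \<le> 2 * w * 1 + 1 * 1"
    by (intro add_mono mult_left_mono mult_mono ek e1) (use \<open>w \<ge> 0\<close> in auto)
  finally show ?thesis by simp
qed

text \<open>By Dirichlet an irrational number has infinitely many approximations with error below
  \<open>1 / k\<^sup>2\<close>. Their norms are bounded integers, so by the pigeonhole principle one
  value occurs infinitely often; it is nonzero because the root is irrational.\<close>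

lemma infinitely_many_small_norms:
  fixes D :: nat
  assumes irr: "sqrt (real D) \<notin> \<rat>"
  obtains N :: int where "N \<noteq> 0"
    "infinite {(h, k). k > 0 \<and> coprime h k \<and> h\<^sup>2 - int D * k\<^sup>2 = N}"
proof -
  define S where "S = approx_set (sqrt (real D))"
  define f where "f = (\<lambda>(h, k). h\<^sup>2 - int D * k\<^sup>2)"
  define B where "B = \<lceil>2 * sqrt (real D) + 1\<rceil>"
  have inf: "infinite S" using irr rational_iff_finite_approx_set S_def by blast
  have "f x \<in> {-B..B}" if "x \<in> S" for x
  proof -
    obtain h k where x: "x = (h, k)" "k > 0" and appr: "\<bar>sqrt D - of_int h / of_int k\<bar> < 1 / k\<^sup>2"
      using \<open>x \<in> S\<close> by (auto simp: S_def approx_set_def)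
    define e where "e = sqrt D * k - h"
    have k1: "real_of_int k \<ge> 1" using x by simp
    have "(sqrt D - of_int h / of_int k) * k = e" using k1 by (simp add: e_def left_diff_distrib)
    hence "\<bar>sqrt D - of_int h / of_int k\<bar> * k = \<bar>e\<bar>" using k1 by (metis abs_mult abs_of_nonneg order_trans zero_le_one)
    moreover have "\<bar>sqrt D - of_int h / of_int k\<bar> * k < 1 / k\<^sup>2 * k"
      using appr k1 by (intro mult_strict_right_mono) auto
    ultimately have e: "\<bar>e\<bar> < 1 / k" using k1 by (simp add: power2_eq_square)
    have "real_of_int (f x) = (real_of_int h)\<^sup>2 - (sqrt D)\<^sup>2 * (real_of_int k)\<^sup>2"
      by (simp add: f_def x)
    also have "\<dots> = - (e * (2 * sqrt D * k - e))" by (simp add: e_def algebra_simps power2_eq_square)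
    finally have "\<bar>real_of_int (f x)\<bar> \<le> 2 * sqrt D + 1"
      using abs_conjugate_product_le[OF e k1] by simp
    hence "\<bar>f x\<bar> \<le> B" unfolding B_def by linarith
    thus ?thesis by auto
  qed
  hence "f ` S \<subseteq> {-B..B}" by blast
  hence fin: "finite (f ` S)" using finite_subset by blast
  obtain x0 where x0: "x0 \<in> S" "infinite {a \<in> S. f a = f x0}"
    using pigeonhole_infinite[OF inf fin] by blast
  obtain h k where hk: "x0 = (h, k)" by (cases x0)
  have "k > 0" using x0(1) hk by (auto simp: S_def approx_set_def)
  have "f x0 \<noteq> 0"
  proof
    assume "f x0 = 0"
    hence "h\<^sup>2 = int D * k\<^sup>2" by (simp add: f_def hk)
    hence "(real_of_int h)\<^sup>2 = real D * (real_of_int k)\<^sup>2"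
      by (metis of_int_mult of_int_of_nat_eq of_int_power)
    hence "(real_of_int h / k)\<^sup>2 = D" using \<open>k > 0\<close> by (simp add: power_divide)
    hence "sqrt D = \<bar>real_of_int h / k\<bar>" by (metis real_sqrt_abs)
    thus False using irr by (metis Rats_abs_iff Rats_divide Rats_of_int)
  qed
  moreover have "{a \<in> S. f a = f x0} \<subseteq>
      {(h, k). k > 0 \<and> coprime h k \<and> h\<^sup>2 - int D * k\<^sup>2 = f x0}"
    by (auto simp: S_def approx_set_def f_def)
  hence "infinite {(h, k). k > 0 \<and> coprime h k \<and> h\<^sup>2 - int D * k\<^sup>2 = f x0}"
    using x0(2) finite_subset by blast
  ultimately show ?thesis by (rule that)
qed

text \<open>Two pairs of norm \<open>N\<close> that agree modulo \<open>N\<close> have an integral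
  quotient of norm 1; up to the sign of \<open>b\<close> it is
  \<open>(h' + k' sqrt D) / (h + k sqrt D)\<close>. If \<open>b\<close> vanished, the fractions
  \<open>h / k\<close> and \<open>h' / k'\<close> would be equal, and coprimality with positive
  denominators would identify the pairs.\<close>

lemma pell_solution_exists:
  fixes D :: nat
  assumes irr: "sqrt (real D) \<notin> \<rat>"
  obtains a b :: int where "b \<noteq> 0" "a\<^sup>2 - int D * b\<^sup>2 = 1"
proof -
  obtain N where N: "N \<noteq> 0"
    and inf: "infinite {(h, k). k > 0 \<and> coprime h k \<and> h\<^sup>2 - int D * k\<^sup>2 = N}"
    using infinitely_many_small_norms[OF irr] .
  define S where "S = {(h, k). k > 0 \<and> coprime h k \<and> h\<^sup>2 - int D * k\<^sup>2 = N}"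
  define f where "f = (\<lambda>(h, k). (h mod N, k mod N))"
  have "h mod N \<in> {-\<bar>N\<bar>..\<bar>N\<bar>}" for h
  proof (cases "N > 0")
    case True
    thus ?thesis using pos_mod_bound[OF True, of h] pos_mod_sign[OF True, of h] by simp
  next
    case False
    hence "N < 0" using N by simp
    thus ?thesis using neg_mod_bound[OF \<open>N < 0\<close>, of h] neg_mod_sign[OF \<open>N < 0\<close>, of h]
      by (simp only: atLeastAtMost_iff) linarith
  qed
  hence "f ` S \<subseteq> {-\<bar>N\<bar>..\<bar>N\<bar>} \<times> {-\<bar>N\<bar>..\<bar>N\<bar>}" by (auto simp: f_def)
  hence fin: "finite (f ` S)" using finite_subset by blast
  obtain x0 where x0: "x0 \<in> S" "infinite {a \<in> S. f a = f x0}"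
    using pigeonhole_infinite[OF _ fin] inf S_def by blast
  have "infinite ({a \<in> S. f a = f x0} - {x0})" using x0(2) by simp
  hence "{a \<in> S. f a = f x0} - {x0} \<noteq> {}" by (metis finite.emptyI)
  then obtain x1 where x1: "x1 \<in> S" "f x1 = f x0" "x1 \<noteq> x0" by blast
  obtain h k where hk: "x0 = (h, k)" by (cases x0)
  obtain h' k' where hk': "x1 = (h', k')" by (cases x1)
  have s: "k > 0" "coprime h k" "h\<^sup>2 - int D * k\<^sup>2 = N" "k' > 0" "coprime h' k'"
    "h'\<^sup>2 - int D * k'\<^sup>2 = N" using x0(1) x1(1) by (auto simp: S_def hk hk')
  have m: "[h' = h] (mod N)" "[k' = k] (mod N)"
    using x1(2) by (simp_all add: f_def hk hk' unique_euclidean_semiring_class.cong_def)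
  have "[h' * h - int D * (k' * k) = h * h - int D * (k * k)] (mod N)"
    using m by (intro cong_diff cong_mult) auto
  moreover have "h * h - int D * (k * k) = N" using s(3) by (simp add: power2_eq_square)
  ultimately have "N dvd h' * h - int D * (k' * k)" by (simp add: cong_dvd_iff)
  then obtain a where a: "h' * h - int D * (k' * k) = N * a" by (auto elim: dvdE)
  have "[h' * k - k' * h = h * k - k * h] (mod N)"
    using m by (intro cong_diff cong_mult) auto
  hence "N dvd h' * k - k' * h" by (simp add: mult.commute cong_0_iff)
  then obtain b where b: "h' * k - k' * h = N * b" by (auto elim: dvdE)
  have "N\<^sup>2 * (a\<^sup>2 - int D * b\<^sup>2) = (N * a)\<^sup>2 - int D * (N * b)\<^sup>2" by (simp add: algebra_simps power2_eq_square)
  also have "\<dots> = (h'\<^sup>2 - int D * k'\<^sup>2) * (h\<^sup>2 - int D * k\<^sup>2)"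
    unfolding a[symmetric] b[symmetric] by (simp add: algebra_simps power2_eq_square)
  also have "\<dots> = N\<^sup>2 * 1" using s by (simp add: power2_eq_square)
  finally have "a\<^sup>2 - int D * b\<^sup>2 = 1" using N by simp
  moreover have "b \<noteq> 0"
  proof
    assume "b = 0"
    hence e: "h' * k = k' * h" using b by simp
    have "k dvd k' * h" using e by (metis dvd_triv_right)
    hence "k dvd k'" using s(2) by (metis coprime_commute coprime_dvd_mult_left_iff)
    moreover have "k' dvd h' * k" using e by (metis dvd_triv_left)
    hence "k' dvd k" using s(5) by (metis coprime_commute coprime_dvd_mult_right_iff)
    ultimately have "k = k'" using s(1,4) by (intro zdvd_antisym_nonneg) simp_all
    hence "h' = h" using e s(1) by simp
    thus False using \<open>k = k'\<close> x1(3) hk hk' by simp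
  qed
  ultimately show ?thesis using that by blast
qed

lemma square_mod_8_odd:
  fixes g :: int
  assumes "odd g"
  obtains k where "g\<^sup>2 = 8 * k + 1"
proof -
  obtain m where m: "g = 2 * m + 1" using assms by (elim oddE)
  have "even (m * (m + 1))" by simp
  then obtain k where "m * (m + 1) = 2 * k" by (elim evenE)
  hence "g\<^sup>2 = 8 * k + 1" unfolding m by (simp add: power2_eq_square algebra_simps)
  thus ?thesis by (rule that)
qed

text \<open>Modulo 4 the left-hand side is a sum of two squares, hence never 3. This excludes one
  branch of the Pell descent and later fixes the sign of the norm of a generator of
  \<open>QI\<close>.\<close>

lemma not_norm_minus_one:
  fixes a b D :: int
  assumes "D mod 4 = 3"
  shows "a\<^sup>2 - D * b\<^sup>2 \<noteq> - 1"
proof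
  assume e: "a\<^sup>2 - D * b\<^sup>2 = - 1"
  obtain m where m: "D = 4 * m + 3" using assms by (metis mult_div_mod_eq)
  have sq: "\<exists>k. z\<^sup>2 = 4 * k \<or> z\<^sup>2 = 4 * k + 1" for z :: int
  proof (cases "even z")
    case True
    then obtain w where "z = 2 * w" by (elim evenE)
    hence "z\<^sup>2 = 4 * w\<^sup>2" by (simp add: power2_eq_square)
    thus ?thesis by blast
  next
    case False
    then obtain k where "z\<^sup>2 = 8 * k + 1" using square_mod_8_odd by blast
    hence "z\<^sup>2 = 4 * (2 * k) + 1" by simp
    thus ?thesis by blast
  qed
  obtain k l where "a\<^sup>2 = 4 * k \<or> a\<^sup>2 = 4 * k + 1" "b\<^sup>2 = 4 * l \<or> b\<^sup>2 = 4 * l + 1"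
    using sq by metis
  moreover have "a\<^sup>2 - 4 * (m * b\<^sup>2) - 3 * b\<^sup>2 = - 1" using e m by (simp add: algebra_simps)
  ultimately show False by presburger
qed

text \<open>For even \<open>a\<close>, the coprime numbers \<open>a + 1\<close> and
  \<open>a - 1\<close> are a square and \<open>p\<close> times a square, and their difference 2
  gives the claim. For odd \<open>a\<close> their halves behave in the same way with difference 1;
  one order gives norm -1, which is impossible, and the other a Pell solution whose second entry is
  nonzero and smaller than \<open>b\<close> in absolute value.\<close>

lemma norm_two_of_pell:
  fixes p :: nat and a b :: int
  assumes p: "Factorial_Ring.prime p" "[p = 3] (mod 4)"
    and "b \<noteq> 0" "a > 0" "a\<^sup>2 - int p * b\<^sup>2 = 1"
  shows "\<exists>x y :: int. x\<^sup>2 - int p * y\<^sup>2 = 2 \<or> x\<^sup>2 - int p * y\<^sup>2 = - 2"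
  using assms(3-5)
proof (induction "nat \<bar>b\<bar>" arbitrary: a b rule: less_induct)
  case less
  have pp: "Factorial_Ring.prime (int p)" using p by simp
  have p4: "int p mod 4 = 3" using p(2)
    by (simp add: unique_euclidean_semiring_class.cong_def) presburger
  have ge2: "a \<ge> 2"
  proof (rule ccontr)
    assume "\<not> a \<ge> 2"
    hence "a = 1" using less.prems by simp
    thus False using less.prems pp by simp
  qed
  show ?case
  proof (cases "even a")
    case True
    have "(a + 1) * (a - 1) = int p * b\<^sup>2"
      using less.prems by (simp add: algebra_simps power2_eq_square)
    then obtain x y where "a + 1 = int p * x\<^sup>2 \<and> a - 1 = y\<^sup>2 \<or> a + 1 = x\<^sup>2 \<and> a - 1 = int p * y\<^sup>2"
      using coprime_mult_prime_square[OF pp coprime_neighbours[OF True]] less.prems(1) ge2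
      by (smt (verit))
    hence "y\<^sup>2 - int p * x\<^sup>2 = - 2 \<or> x\<^sup>2 - int p * y\<^sup>2 = 2" by linarith
    thus ?thesis by blast
  next
    case False
    then obtain c where c: "a = 2 * c + 1" by (elim oddE)
    have c1: "c \<ge> 1" using c ge2 by linarith
    have e: "4 * (c * (c + 1)) = int p * b\<^sup>2"
      using less.prems c by (simp add: algebra_simps power2_eq_square)
    hence "even (int p * b\<^sup>2)" by (metis dvd_triv_left even_mult_iff even_numeral)
    hence "even b" using p4 by (auto simp: even_mult_iff) presburger
    then obtain d where d: "b = 2 * d" by (elim evenE)
    have d0: "d \<noteq> 0" using d less.prems by simp
    have prod: "(c + 1) * c = int p * d\<^sup>2"
      using e d by (simp add: algebra_simps power2_eq_square)
    have cop: "coprime (c + 1) c" by (simp add: coprime_commute)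
    have pos: "c + 1 > 0" "c > 0" using c1 by simp_all
    obtain x y where xy: "c + 1 = int p * x\<^sup>2 \<and> c = y\<^sup>2 \<or> c + 1 = x\<^sup>2 \<and> c = int p * y\<^sup>2" "x\<^sup>2 * y\<^sup>2 = d\<^sup>2"
      using coprime_mult_prime_square[OF pp cop prod d0 pos] .
    have "y\<^sup>2 - int p * x\<^sup>2 = - 1 \<or> \<bar>x\<bar>\<^sup>2 - int p * \<bar>y\<bar>\<^sup>2 = 1" unfolding power2_abs using xy(1) by linarith
    hence eq: "\<bar>x\<bar>\<^sup>2 - int p * \<bar>y\<bar>\<^sup>2 = 1" using not_norm_minus_one[OF p4] by blast
    have nz: "\<bar>y\<bar> \<noteq> 0" "\<bar>x\<bar> > 0" using xy(2) d0 by auto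
    hence "1 * y\<^sup>2 \<le> x\<^sup>2 * y\<^sup>2" by (intro mult_right_mono) (auto simp: int_one_le_iff_zero_less)
    hence "\<bar>y\<bar> \<le> \<bar>d\<bar>" unfolding xy(2) by (simp add: abs_le_square_iff)
    also have "\<bar>d\<bar> < \<bar>b\<bar>" using d d0 by simp
    finally have "nat \<bar>\<bar>y\<bar>\<bar> < nat \<bar>b\<bar>" by simp
    from less.hyps[OF this nz eq] show ?thesis .
  qed
qed

text \<open>Here \<open>x + y * s\<close> generates the prime above 2 in Q(s). The coordinates have
  equal parity, and if both were even the norm would be divisible by 4. Their oddness puts half of
  the generator into the lattice spanned by 1 and \<open>(1 + s) / 2\<close>.\<close>

lemma norm_two_exists:
  fixes p :: nat
  assumes p: "Factorial_Ring.prime p" "[p = 3] (mod 4)"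
  obtains x y :: int where "x\<^sup>2 - int p * y\<^sup>2 = 2 \<or> x\<^sup>2 - int p * y\<^sup>2 = - 2" "odd x" "odd y"
proof -
  obtain a b :: int where ab: "b \<noteq> 0" "a\<^sup>2 - int p * b\<^sup>2 = 1"
    using pell_solution_exists[OF prime_sqrt_irrational[OF p(1)]] .
  have "a \<noteq> 0"
  proof
    assume "a = 0"
    hence "int p * b\<^sup>2 = - 1" using ab by simp
    moreover have "int p * b\<^sup>2 \<ge> 0" by simp
    ultimately show False by linarith
  qed
  then obtain x y where xy: "x\<^sup>2 - int p * y\<^sup>2 = 2 \<or> x\<^sup>2 - int p * y\<^sup>2 = - 2"
    using norm_two_of_pell[OF p ab(1), of "\<bar>a\<bar>"] ab(2) by auto
  have "odd (int p)" using p(2) by (auto simp: unique_euclidean_semiring_class.cong_def) presburger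
  moreover have "even (x\<^sup>2 - int p * y\<^sup>2)" using xy by (metis even_numeral even_minus)
  ultimately have par: "even x \<longleftrightarrow> even y" by simp
  have "odd x"
  proof
    assume "even x"
    then obtain u v where "x = 2 * u" "y = 2 * v" using par by (auto elim!: evenE)
    hence "x\<^sup>2 - int p * y\<^sup>2 = 4 * (u\<^sup>2 - int p * v\<^sup>2)" by (simp add: power2_eq_square algebra_simps)
    thus False using xy by presburger
  qed
  thus ?thesis using that xy par by blast
qed

subsection \<open>Integrality in quadratic fields\<close>

lemma squarefree_mult_square_int:
  fixes D :: int and h :: rat
  assumes "squarefree D" "of_int D * h\<^sup>2 \<in> \<int>"
  shows "h \<in> \<int>"
proof -
  obtain u v where uv: "quotient_of h = (u, v)" by (cases "quotient_of h")
  have h: "h = of_int u / of_int v" using quotient_of_div[OF uv] .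
  have v: "v > 0" using quotient_of_denom_pos[OF uv] .
  have cop: "coprime u v" using quotient_of_coprime[OF uv] .
  obtain N where N: "of_int D * h\<^sup>2 = of_int N" using assms(2) by (auto elim: Ints_cases)
  have "of_int (D * u\<^sup>2) = (of_int (N * v\<^sup>2) :: rat)"
    using N v by (simp add: h field_simps power2_eq_square)
  hence "D * u\<^sup>2 = N * v\<^sup>2" by (simp only: of_int_eq_iff)
  hence "v\<^sup>2 dvd D * u\<^sup>2" by simp
  moreover have "coprime (v\<^sup>2) (u\<^sup>2)" using cop by (simp add: coprime_commute)
  ultimately have "v\<^sup>2 dvd D" by (simp add: coprime_dvd_mult_left_iff)
  hence "v dvd 1" using assms(1) by (auto simp: squarefree_def)
  hence "v = 1" using v by simp
  thus ?thesis using h by simp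
qed

lemma quadratic_integer_half:
  fixes D :: int and a b :: rat
  assumes D: "squarefree D" and "2 * a \<in> \<int>" "a\<^sup>2 - of_int D * b\<^sup>2 \<in> \<int>"
  obtains g h N :: int where "2 * a = of_int g" "2 * b = of_int h" "g\<^sup>2 - D * h\<^sup>2 = 4 * N"
    "a\<^sup>2 - of_int D * b\<^sup>2 = of_int N"
proof -
  obtain g where g: "2 * a = of_int g" using assms(2) by (auto elim: Ints_cases)
  obtain N where N: "a\<^sup>2 - of_int D * b\<^sup>2 = of_int N" using assms(3) by (auto elim: Ints_cases)
  have e: "of_int D * (2 * b)\<^sup>2 = (2 * a)\<^sup>2 - 4 * (a\<^sup>2 - of_int D * b\<^sup>2)"
    by (simp add: power2_eq_square algebra_simps)
  hence "of_int D * (2 * b)\<^sup>2 \<in> \<int>" unfolding g N by simp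
  hence "2 * b \<in> \<int>" by (rule squarefree_mult_square_int[OF D])
  then obtain h where h: "2 * b = of_int h" by (auto elim: Ints_cases)
  have "of_int (g\<^sup>2 - D * h\<^sup>2) = (of_int (4 * N) :: rat)"
    using e unfolding g h N by simp
  hence "g\<^sup>2 - D * h\<^sup>2 = 4 * N" by (simp only: of_int_eq_iff)
  thus ?thesis using that g h N by blast
qed

lemma half_int_of_even:
  fixes a :: rat
  assumes "2 * a = of_int g" "even g"
  shows "a \<in> \<int>"
proof -
  obtain k where "g = 2 * k" using assms(2) by (elim evenE)
  hence "a = of_int k" using assms(1) by simp
  thus ?thesis by simp
qed

text \<open>If the numerators over 2 were odd, \<open>g\<^sup>2 - D * h\<^sup>2\<close> would be 2
  modulo 4 instead of a multiple of 4.\<close>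

lemma quadratic_integer_3_mod_4:
  fixes D :: int and a b :: rat
  assumes D: "squarefree D" "D mod 4 = 3" and ab: "2 * a \<in> \<int>" "a\<^sup>2 - of_int D * b\<^sup>2 \<in> \<int>"
  shows "a \<in> \<int>" "b \<in> \<int>"
proof -
  obtain g h N :: int where gh: "2 * a = of_int g" "2 * b = of_int h" "g\<^sup>2 - D * h\<^sup>2 = 4 * N"
    using quadratic_integer_half[OF D(1) ab] by metis
  have oD: "odd D" using D(2) by presburger
  have "even (g\<^sup>2 - D * h\<^sup>2)" using gh by simp
  hence par: "even g \<longleftrightarrow> even h" using oD by simp
  have "even g"
  proof (rule ccontr)
    assume "odd g"
    obtain k where k: "g\<^sup>2 = 8 * k + 1" using square_mod_8_odd[OF \<open>odd g\<close>] .
    obtain l where l: "h\<^sup>2 = 8 * l + 1" using square_mod_8_odd[of h] \<open>odd g\<close> par by blast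
    obtain m where m: "D = 4 * m + 3" using D(2) by (metis mult_div_mod_eq)
    have "8 * k + 1 - (4 * m + 3) * (8 * l + 1) = 4 * N" using gh(3) k l m by simp
    hence "4 * (2 * k - 8 * (m * l) - m - 6 * l - N) = 2" by (simp add: algebra_simps)
    thus False by presburger
  qed
  thus "a \<in> \<int>" "b \<in> \<int>" using half_int_of_even gh par by auto
qed

text \<open>Half-integral coordinates do occur for integers when \<open>D = 1\<close> modulo 8, but
  not in norm 1: odd numerators make \<open>g\<^sup>2 - D * h\<^sup>2\<close> divisible by 8,
  whereas it would have to be 4.\<close>

lemma quadratic_unit_1_mod_8:
  fixes D :: int and a b :: rat
  assumes D: "squarefree D" "D mod 8 = 1" and a: "2 * a \<in> \<int>" and ab: "a\<^sup>2 - of_int D * b\<^sup>2 = 1"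
  shows "a \<in> \<int>" "b \<in> \<int>"
proof -
  have "a\<^sup>2 - of_int D * b\<^sup>2 \<in> \<int>" using ab by simp
  then obtain g h N :: int where gh: "2 * a = of_int g" "2 * b = of_int h" "g\<^sup>2 - D * h\<^sup>2 = 4 * N"
    "a\<^sup>2 - of_int D * b\<^sup>2 = of_int N"
    using quadratic_integer_half[OF D(1) a] by metis
  have "N = 1" using gh(4) ab by (metis of_int_eq_1_iff)
  have oD: "odd D" using D(2) by presburger
  have "even (g\<^sup>2 - D * h\<^sup>2)" using gh by simp
  hence par: "even g \<longleftrightarrow> even h" using oD by simp
  have "even g"
  proof (rule ccontr)
    assume "odd g"
    obtain k where k: "g\<^sup>2 = 8 * k + 1" using square_mod_8_odd[OF \<open>odd g\<close>] .
    obtain l where l: "h\<^sup>2 = 8 * l + 1" using square_mod_8_odd[of h] \<open>odd g\<close> par by blast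
    obtain m where m: "D = 8 * m + 1" using D(2) by (metis mult_div_mod_eq)
    have "8 * k + 1 - (8 * m + 1) * (8 * l + 1) = 4" using gh(3) k l m \<open>N = 1\<close> by simp
    hence "8 * (k - 8 * (m * l) - m - l) = 4" by (simp add: algebra_simps)
    thus False by presburger
  qed
  thus "a \<in> \<int>" "b \<in> \<int>" using half_int_of_even gh par by auto
qed

lemma rational_combination_eq_0:
  fixes a b S :: real
  assumes "S \<notin> \<rat>" "a \<in> \<rat>" "b \<in> \<rat>" "a + b * S = 0"
  shows "a = 0" "b = 0"
proof -
  show "b = 0"
  proof (rule ccontr)
    assume "b \<noteq> 0"
    hence "S = - a / b" using assms(4) by (simp add: field_simps)
    thus False using assms by (metis Rats_divide Rats_minus_iff)
  qed
  thus "a = 0" using assms(4) by simp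
qed

text \<open>If \<open>c + d * S\<close> is nonzero, dividing by it gives
  \<open>T = u + v * S\<close> with rational \<open>u\<close> and \<open>v\<close>. Squaring forces
  \<open>u * v = 0\<close>, so \<open>T\<close> or \<open>S * T\<close> would be rational.\<close>

lemma biquadratic_linear_independence:
  fixes a b c d S T :: real
  assumes irr: "S \<notin> \<rat>" "T \<notin> \<rat>" "S * T \<notin> \<rat>" and sq: "S\<^sup>2 \<in> \<rat>" "T\<^sup>2 \<in> \<rat>"
    and rat: "a \<in> \<rat>" "b \<in> \<rat>" "c \<in> \<rat>" "d \<in> \<rat>" and eq: "a + b * S + c * T + d * (S * T) = 0"
  shows "a = 0 \<and> b = 0 \<and> c = 0 \<and> d = 0"
proof (cases "c + d * S = 0")
  case True
  hence "c = 0" "d = 0" using rational_combination_eq_0[OF irr(1) rat(3,4)] by auto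
  moreover from this eq have "a + b * S = 0" by simp
  hence "a = 0" "b = 0" using rational_combination_eq_0[OF irr(1) rat(1,2)] by auto
  ultimately show ?thesis by simp
next
  case False
  define m where "m = c\<^sup>2 - d\<^sup>2 * S\<^sup>2"
  have m: "m = (c + d * S) * (c + (- d) * S)" by (simp add: m_def power2_eq_square algebra_simps)
  have "c + (- d) * S \<noteq> 0"
  proof
    assume "c + (- d) * S = 0"
    hence "c = 0" "- d = 0" using rational_combination_eq_0[OF irr(1) rat(3), of "- d"] rat by auto
    thus False using False by simp
  qed
  hence m0: "m \<noteq> 0" using m False by simp
  have mr: "m \<in> \<rat>" using rat sq by (simp add: m_def)
  define u where "u = (- a * c + b * d * S\<^sup>2) / m"
  define v where "v = (a * d - b * c) / m"
  have uv: "u \<in> \<rat>" "v \<in> \<rat>" using rat sq mr by (simp_all add: u_def v_def)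
  have "(c + d * S) * T = - (a + b * S)" using eq by (simp add: algebra_simps)
  hence "(c + d * S) * (c + (- d) * S) * T = - (a + b * S) * (c + (- d) * S)" by (metis mult.assoc mult.commute)
  hence "m * T = (- a * c + b * d * S\<^sup>2) + (a * d - b * c) * S"
    unfolding m[symmetric] by (simp add: algebra_simps power2_eq_square)
  hence T: "T = u + v * S" using m0 by (simp add: u_def v_def field_simps)
  have "(u\<^sup>2 + v\<^sup>2 * S\<^sup>2 - T\<^sup>2) + (2 * u * v) * S = 0" by (simp add: T power2_eq_square algebra_simps)
  hence "2 * u * v = 0" using rational_combination_eq_0(2)[OF irr(1), of "u\<^sup>2 + v\<^sup>2 * S\<^sup>2 - T\<^sup>2" "2 * u * v"] uv sq
    by simp
  hence "u = 0 \<or> v = 0" by simp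
  thus ?thesis
  proof
    assume "v = 0"
    hence "T \<in> \<rat>" using T uv by simp
    thus ?thesis using irr by simp
  next
    assume "u = 0"
    hence "S * T = v * S\<^sup>2" using T by (simp add: power2_eq_square)
    hence "S * T \<in> \<rat>" using uv sq by simp
    thus ?thesis using irr by simp
  qed
qed

subsection \<open>The field and its conjugations\<close>

lemma complex_of_real_of_rat: "complex_of_real (of_rat x) = of_rat x"
  by (cases x) (simp add: of_rat_rat)

lemma a_inv_complex_field: "a_inv complex_field x = - x"
  unfolding a_inv_def m_inv_def
proof (rule the_equality)
  show "- x \<in> carrier (add_monoid complex_field) \<and>
      x \<otimes>\<^bsub>add_monoid complex_field\<^esub> - x = \<one>\<^bsub>add_monoid complex_field\<^esub> \<and>
      - x \<otimes>\<^bsub>add_monoid complex_field\<^esub> x = \<one>\<^bsub>add_monoid complex_field\<^esub>"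
    by (simp add: ring_of_type_algebra_def)
next
  fix y assume "y \<in> carrier (add_monoid complex_field) \<and>
      x \<otimes>\<^bsub>add_monoid complex_field\<^esub> y = \<one>\<^bsub>add_monoid complex_field\<^esub> \<and>
      y \<otimes>\<^bsub>add_monoid complex_field\<^esub> x = \<one>\<^bsub>add_monoid complex_field\<^esub>"
  hence "x + y = 0" by (simp add: ring_of_type_algebra_def)
  thus "y = - x" by (simp add: eq_neg_iff_add_eq_0 add.commute)
qed

lemma m_inv_complex_field: "x \<noteq> 0 \<Longrightarrow> m_inv complex_field x = inverse x"
  unfolding m_inv_def
proof (rule the_equality)
  assume "x \<noteq> 0"
  thus "inverse x \<in> carrier complex_field \<and> x \<otimes>\<^bsub>complex_field\<^esub> inverse x = \<one>\<^bsub>complex_field\<^esub> \<and>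
      inverse x \<otimes>\<^bsub>complex_field\<^esub> x = \<one>\<^bsub>complex_field\<^esub>"
    by (simp add: ring_of_type_algebra_def)
next
  fix y assume "y \<in> carrier complex_field \<and> x \<otimes>\<^bsub>complex_field\<^esub> y = \<one>\<^bsub>complex_field\<^esub> \<and>
      y \<otimes>\<^bsub>complex_field\<^esub> x = \<one>\<^bsub>complex_field\<^esub>"
  hence "x * y = 1" by (simp add: ring_of_type_algebra_def)
  thus "y = inverse x" using inverse_unique by metis
qed

text \<open>The two non-residue conditions are both assumed, although reciprocity links them, so
  that the locale is symmetric in \<open>q\<close> and \<open>r\<close>
  (\<open>biquadratic_swap\<close>).\<close>

locale biquadratic =
  fixes p q r :: nat
  assumes p: "Factorial_Ring.prime p" "[p = 3] (mod 4)"
    and q: "Factorial_Ring.prime q" "[q = 1] (mod 8)"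
    and r: "Factorial_Ring.prime r" "[r = 1] (mod 8)"
    and pq: "p \<noteq> q" and pr: "p \<noteq> r" and qr: "q \<noteq> r"
    and nqr: "\<not> QuadRes (int r) (int q)" and nrq: "\<not> QuadRes (int q) (int r)"
begin

abbreviation K where "K \<equiv> biquadratic_field p (q * r)"
abbreviation OK where "OK \<equiv> ring_of_integers K"

definition s :: complex where "s = of_real (sqrt (real p))"
definition t :: complex where "t = of_real (sqrt (real (q * r)))"

definition el :: "rat \<Rightarrow> rat \<Rightarrow> rat \<Rightarrow> rat \<Rightarrow> complex" where
  "el a b c d = of_rat a + of_rat b * s + of_rat c * t + of_rat d * (s * t)"

lemma p_odd: "odd p" and q_odd: "odd q" and r_odd: "odd r"
  using p q r by (auto simp: unique_euclidean_semiring_class.cong_def) presburger+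

lemma pos: "p > 0" "q > 0" "r > 0"
  using p q r by (auto simp: prime_gt_0_nat)

lemma s_sq: "s * s = of_nat p" and t_sq: "t * t = of_nat q * of_nat r"
  by (simp_all add: s_def t_def del: of_nat_mult flip: of_real_mult) simp

lemma t_nz: "t \<noteq> 0"
  using pos by (simp add: t_def)

lemma irrational: "sqrt (real p) \<notin> \<rat>" "sqrt (real (q * r)) \<notin> \<rat>" "sqrt (real (p * (q * r))) \<notin> \<rat>"
proof -
  have mq: "multiplicity q q = 1" "multiplicity q r = 0" "multiplicity q p = 0"
    using q r p pq qr primes_dvd_imp_eq[of q r] primes_dvd_imp_eq[of q p]
    by (auto intro!: not_dvd_imp_multiplicity_0 multiplicity_self)
  show "sqrt (real p) \<notin> \<rat>" using prime_sqrt_irrational[OF p(1)] .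
  show "sqrt (real (q * r)) \<notin> \<rat>"
    using q pos mq by (intro sqrt_irrational[OF q(1)])
      (simp_all add: prime_elem_multiplicity_mult_distrib)
  show "sqrt (real (p * (q * r))) \<notin> \<rat>"
    using q pos mq by (intro sqrt_irrational[OF q(1)])
      (simp_all add: prime_elem_multiplicity_mult_distrib)
qed

lemma el_eq_0D:
  assumes "el a b c d = 0"
  shows "a = 0 \<and> b = 0 \<and> c = 0 \<and> d = 0"
proof -
  define S where "S = sqrt (real p)"
  define T where "T = sqrt (real (q * r))"
  have "complex_of_real (of_rat a + of_rat b * S + of_rat c * T + of_rat d * (S * T)) = el a b c d"
    by (simp add: el_def s_def t_def S_def T_def complex_of_real_of_rat del: of_nat_mult)
  hence "of_rat a + of_rat b * S + of_rat c * T + of_rat d * (S * T) = 0"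
    using assms by (metis of_real_eq_0_iff)
  moreover have "S * T \<notin> \<rat>" using irrational(3) by (simp add: S_def T_def real_sqrt_mult)
  ultimately have "real_of_rat a = 0 \<and> real_of_rat b = 0 \<and> real_of_rat c = 0 \<and> real_of_rat d = 0"
    using irrational by (intro biquadratic_linear_independence[of S T]) (auto simp: S_def T_def)
  thus ?thesis by simp
qed

lemma el_add: "el a b c d + el a' b' c' d' = el (a + a') (b + b') (c + c') (d + d')"
  by (simp add: el_def of_rat_add algebra_simps)

lemma el_minus: "- el a b c d = el (- a) (- b) (- c) (- d)"
  by (simp add: el_def of_rat_minus algebra_simps)

lemma el_diff: "el a b c d - el a' b' c' d' = el (a - a') (b - b') (c - c') (d - d')"
  by (simp add: el_def of_rat_diff algebra_simps)

lemma el_mult: "el a b c d * el a' b' c' d' =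
  el (a * a' + of_nat p * (b * b') + of_nat (q * r) * (c * c') + of_nat (p * (q * r)) * (d * d'))
     (a * b' + b * a' + of_nat (q * r) * (c * d' + d * c'))
     (a * c' + c * a' + of_nat p * (b * d' + d * b'))
     (a * d' + d * a' + b * c' + c * b')"
proof -
  have *: "(A + B * u + C * v + E * (u * v)) * (A' + B' * u + C' * v + E' * (u * v)) =
     (A * A' + (u * u) * (B * B') + (v * v) * (C * C') + (u * u) * (v * v) * (E * E'))
    + (A * B' + B * A' + (v * v) * (C * E' + E * C')) * u
    + (A * C' + C * A' + (u * u) * (B * E' + E * B')) * v
    + (A * E' + E * A' + B * C' + C * B') * (u * v)"
    for A B C E A' B' C' E' u v :: complex by (simp add: algebra_simps)
  show ?thesis
    unfolding el_def * s_sq t_sq by (simp add: of_rat_add of_rat_mult)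
qed

lemma el_eq_iff: "el a b c d = el a' b' c' d' \<longleftrightarrow> a = a' \<and> b = b' \<and> c = c' \<and> d = d'"
  using el_eq_0D[of "a - a'" "b - b'" "c - c'" "d - d'"] el_diff[of a b c d a' b' c' d'] by auto

lemma el_basic: "s = el 0 1 0 0" "t = el 0 0 1 0" "of_rat x = el x 0 0 0"
  "of_int i = el (of_int i) 0 0 0" "of_nat n = el (of_nat n) 0 0 0" "1 = el 1 0 0 0" "0 = el 0 0 0 0"
  by (simp_all add: el_def)

definition KE :: "complex set" where "KE = {el a b c d | a b c d. True}"

lemma KE_el [simp]: "el a b c d \<in> KE" by (auto simp: KE_def)

lemma KE_cases:
  assumes "x \<in> KE" obtains a b c d where "x = el a b c d"
  using assms by (auto simp: KE_def)

lemma KE_basic [simp]: "s \<in> KE" "t \<in> KE" "of_rat x \<in> KE" "of_int i \<in> KE" "of_nat n \<in> KE"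
  "1 \<in> KE" "0 \<in> KE"
  using el_basic KE_el by metis+

lemma KE_closed: "x \<in> KE \<Longrightarrow> y \<in> KE \<Longrightarrow> x + y \<in> KE" "x \<in> KE \<Longrightarrow> - x \<in> KE"
  "x \<in> KE \<Longrightarrow> y \<in> KE \<Longrightarrow> x - y \<in> KE" "x \<in> KE \<Longrightarrow> y \<in> KE \<Longrightarrow> x * y \<in> KE"
  by (auto elim!: KE_cases simp: el_add el_minus el_diff el_mult)

text \<open>On \<open>KE\<close> the choice is unique by \<open>el_eq_iff\<close>; elsewhere the
  value is arbitrary.\<close>

definition coords :: "complex \<Rightarrow> rat \<times> rat \<times> rat \<times> rat" where
  "coords x = (SOME v. case v of (a, b, c, d) \<Rightarrow> x = el a b c d)"

lemma coords_el: "coords (el a b c d) = (a, b, c, d)"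
proof -
  have "case coords (el a b c d) of (a', b', c', d') \<Rightarrow> el a b c d = el a' b' c' d'"
    unfolding coords_def by (rule someI[of _ "(a, b, c, d)"]) simp
  thus ?thesis by (auto simp: el_eq_iff split: prod.splits)
qed

text \<open>For \<open>signs e f\<close> these are the four automorphisms of the field, with
  \<open>s\<close> sent to \<open>e * s\<close> and \<open>t\<close> to
  \<open>f * t\<close>.\<close>

definition conj :: "rat \<Rightarrow> rat \<Rightarrow> complex \<Rightarrow> complex" where
  "conj e f x = (case coords x of (a, b, c, d) \<Rightarrow> el a (e * b) (f * c) (e * f * d))"

lemma conj_el: "conj e f (el a b c d) = el a (e * b) (f * c) (e * f * d)"
  by (simp add: conj_def coords_el)

abbreviation "signs e f \<equiv> e \<in> {1, -1} \<and> f \<in> {1, -1 :: rat}"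

lemma conj_hom:
  assumes "signs e f" "x \<in> KE" "y \<in> KE"
  shows "conj e f (x + y) = conj e f x + conj e f y" "conj e f (x - y) = conj e f x - conj e f y"
    "conj e f (x * y) = conj e f x * conj e f y"
  using assms(2,3)
  by (auto elim!: KE_cases simp: el_add el_diff el_mult conj_el el_eq_iff algebra_simps)
    (use assms(1) in \<open>auto\<close>)

lemma conj_in_KE [simp]: "conj e f x \<in> KE"
  by (auto simp: conj_def split: prod.splits)

lemma conj_conj: "signs e f \<Longrightarrow> x \<in> KE \<Longrightarrow> conj e f (conj e f x) = x"
  by (auto elim!: KE_cases simp: conj_el)

lemma conj_conj': "x \<in> KE \<Longrightarrow> conj e f (conj e' f' x) = conj (e * e') (f * f') x"
  by (auto elim!: KE_cases simp: conj_el mult_ac)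

lemma conj_basic: "conj e f s = of_rat e * s" "conj e f t = of_rat f * t"
  "conj e f (of_rat x) = of_rat x" "conj e f (of_int i) = of_int i" "conj e f (of_nat n) = of_nat n"
  "conj e f 1 = 1" "conj e f 0 = 0"
  by (simp_all add: el_basic conj_el) (simp_all add: el_basic[symmetric] el_mult el_def)

lemma conj_eq_0_iff: "signs e f \<Longrightarrow> x \<in> KE \<Longrightarrow> conj e f x = 0 \<longleftrightarrow> x = 0"
  by (metis conj_basic(7) conj_conj)

definition nm :: "complex \<Rightarrow> complex" where
  "nm x = x * conj 1 (-1) x * conj (-1) 1 x * conj (-1) (-1) x"

lemma fixed_sg: "x \<in> KE \<Longrightarrow> conj 1 (-1) x = x \<Longrightarrow> \<exists>a b. x = el a b 0 0"
  by (auto elim!: KE_cases simp: conj_el el_eq_iff)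

lemma fixed_tu: "x \<in> KE \<Longrightarrow> conj (-1) 1 x = x \<Longrightarrow> \<exists>a c. x = el a 0 c 0"
  by (auto elim!: KE_cases simp: conj_el el_eq_iff)

lemma fixed_st: "x \<in> KE \<Longrightarrow> conj (-1) (-1) x = x \<Longrightarrow> \<exists>a d. x = el a 0 0 d"
  by (auto elim!: KE_cases simp: conj_el el_eq_iff)

lemma nm_rat: 
  assumes "x \<in> KE" shows "\<exists>n. nm x = of_rat n"
proof -
  have nK: "nm x \<in> KE" using assms by (simp add: nm_def KE_closed)
  have "conj 1 (-1) (nm x) = nm x"
    using assms by (simp add: nm_def conj_hom KE_closed conj_conj' mult_ac)
       (auto elim!: KE_cases simp: conj_el)
  moreover have "conj (-1) 1 (nm x) = nm x"
    using assms by (simp add: nm_def conj_hom KE_closed conj_conj' mult_ac)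
       (auto elim!: KE_cases simp: conj_el)
  moreover obtain a b c d where "nm x = el a b c d" using nK by (rule KE_cases)
  ultimately have "nm x = el a 0 0 0" by (simp add: conj_el el_eq_iff)
  thus ?thesis using el_basic(3) by metis
qed

lemma nm_mult: "x \<in> KE \<Longrightarrow> y \<in> KE \<Longrightarrow> nm (x * y) = nm x * nm y"
  by (simp add: nm_def conj_hom mult_ac)

lemma nm_eq_0_iff: "x \<in> KE \<Longrightarrow> nm x = 0 \<longleftrightarrow> x = 0"
  by (auto simp: nm_def conj_eq_0_iff)

text \<open>The inverse is the product of the three other conjugates divided by the norm, which is
  rational.\<close>

lemma KE_inverse:
  assumes "x \<in> KE" shows "inverse x \<in> KE"
proof (cases "x = 0")
  case False
  obtain n where n: "nm x = of_rat n" using nm_rat[OF assms] by blast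
  have "n \<noteq> 0" using nm_eq_0_iff[OF assms] False n by auto
  hence "x * (conj 1 (-1) x * conj (-1) 1 x * conj (-1) (-1) x * of_rat (1 / n)) = 1"
    using n by (simp add: nm_def of_rat_divide mult_ac)
  hence "inverse x = conj 1 (-1) x * conj (-1) 1 x * conj (-1) (-1) x * of_rat (1 / n)"
    by (rule inverse_unique)
  thus ?thesis using assms by (simp add: KE_closed)
qed simp

lemma K_eq: "K = KE"
proof
  show "K \<subseteq> KE"
  proof
    fix x assume "x \<in> K"
    thus "x \<in> KE" unfolding biquadratic_field_def
    proof (induction rule: generate_field.induct)
      case one
      thus ?case by (simp add: ring_of_type_algebra_def el_basic)
    next
      case (incl h)
      hence "h = s \<or> h = t" by (auto simp: s_def t_def)
      thus ?case by auto
    next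
      case (a_inv h)
      thus ?case by (simp add: a_inv_complex_field KE_closed)
    next
      case (m_inv h)
      hence "h \<noteq> 0" by (simp add: ring_of_type_algebra_def)
      thus ?case using m_inv by (simp add: m_inv_complex_field KE_inverse)
    qed (simp_all add: ring_of_type_algebra_def KE_closed)
  qed
  note gf = generate_field.intros[where R = complex_field and
      H = "{complex_of_real (sqrt (real p)), complex_of_real (sqrt (real (q * r)))}"]
  note ops = ring_of_type_algebra_def
  have st: "s \<in> K" "t \<in> K" unfolding biquadratic_field_def s_def t_def by (rule gf(2), simp)+
  have one: "1 \<in> K" unfolding biquadratic_field_def using gf(1) by (simp add: ops)
  have add: "x + y \<in> K" if "x \<in> K" "y \<in> K" for x y
    using gf(5)[of x y] that unfolding biquadratic_field_def by (simp add: ops)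
  have mult: "x * y \<in> K" if "x \<in> K" "y \<in> K" for x y
    using gf(6)[of x y] that unfolding biquadratic_field_def by (simp add: ops)
  have minus: "- x \<in> K" if "x \<in> K" for x
    using gf(3)[of x] that unfolding biquadratic_field_def by (simp add: a_inv_complex_field)
  have zero: "0 \<in> K" using add[OF one minus[OF one]] by simp
  have inv: "inverse x \<in> K" if "x \<in> K" for x
    using gf(4)[of x] that zero unfolding biquadratic_field_def
    by (cases "x = 0") (simp_all add: m_inv_complex_field, simp_all add: ops)
  have nat: "of_nat n \<in> K" for n by (induction n) (auto intro: zero add one)
  have int: "of_int i \<in> K" for i by (cases i) (auto intro: minus nat simp del: of_nat_Suc)
  have rat: "of_rat x \<in> K" for x
    by (cases x) (auto simp: of_rat_rat divide_inverse intro!: mult int inv)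
  show "KE \<subseteq> K"
    by (auto elim!: KE_cases simp: el_def intro!: add mult rat st)
qed

lemma OK_iff: "x \<in> OK \<longleftrightarrow> x \<in> KE \<and> algebraic_int x"
  by (simp add: ring_of_integers_def K_eq)

lemma OK_KE: "x \<in> OK \<Longrightarrow> x \<in> KE"
  by (simp add: OK_iff)

lemma OK_closed: "x \<in> OK \<Longrightarrow> y \<in> OK \<Longrightarrow> x + y \<in> OK" "x \<in> OK \<Longrightarrow> - x \<in> OK"
  "x \<in> OK \<Longrightarrow> y \<in> OK \<Longrightarrow> x - y \<in> OK" "x \<in> OK \<Longrightarrow> y \<in> OK \<Longrightarrow> x * y \<in> OK"
  by (auto simp: OK_iff KE_closed algebraic_int_add algebraic_int_mult algebraic_int_diff)

lemma OK_basic [simp]: "s \<in> OK" "t \<in> OK" "of_int i \<in> OK" "of_nat n \<in> OK" "1 \<in> OK" "0 \<in> OK"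
  "numeral w \<in> OK"
proof -
  have "algebraic_int s" "algebraic_int t" unfolding s_def t_def
    by (intro algebraic_int_of_real algebraic_int_sqrt int_imp_algebraic_int; simp)+
  thus "s \<in> OK" "t \<in> OK" by (simp_all add: OK_iff)
  show "of_int i \<in> OK" for i by (simp add: OK_iff int_imp_algebraic_int)
  from this[of "int n"] this[of 1] this[of 0] this[of "numeral w"]
  show "of_nat n \<in> OK" "1 \<in> OK" "0 \<in> OK" "numeral w \<in> OK" by simp_all
qed

text \<open>With \<open>q * r = 8 * m + 1\<close> it is a root of the monic integral polynomial
  \<open>X\<^sup>2 - X - 2 * m\<close>. It supplies the odd discriminant \<open>q * r\<close> of
  Q(t), which is what makes a comparison with 2p possible.\<close>

definition \<omega> :: complex where "\<omega> = (1 + t) / 2"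

lemma omega_el: "\<omega> = el (1/2) 0 (1/2) 0"
  by (simp add: \<omega>_def el_def of_rat_divide add_divide_distrib)

lemma omega_OK [simp]: "\<omega> \<in> OK"
proof -
  have "(q * r) mod 8 = 1" using q(2) r(2)
    by (simp add: unique_euclidean_semiring_class.cong_def mod_mult_eq[of q 8 r, symmetric])
  then obtain m where m: "q * r = 8 * m + 1" by (metis mult_div_mod_eq)
  have "(2 * \<omega> - 1)\<^sup>2 = of_nat (q * r)" by (simp add: \<omega>_def power2_eq_square t_sq)
  hence "4 * (\<omega>\<^sup>2 - \<omega>) = 4 * (of_nat (2 * m))" unfolding m by (simp add: power2_eq_square algebra_simps)
  hence "\<omega>\<^sup>2 - \<omega> = of_nat (2 * m)" by (metis mult_cancel_left zero_neq_numeral)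
  hence "poly [: - of_nat (2 * m), - 1, 1 :] \<omega> = 0"
    by (simp add: power2_eq_square algebra_simps)
  moreover have "\<forall>i. Polynomial.coeff [: - of_nat (2 * m), - 1, 1 :: complex :] i \<in> \<int>"
    by (auto simp: coeff_pCons split: nat.splits)
  ultimately have "algebraic_int \<omega>"
    by (intro algebraic_int.intros[of "[: - of_nat (2 * m), - 1, 1 :]"]) auto
  thus ?thesis by (simp add: OK_iff omega_el)
qed

lemma conj_poly:
  assumes "signs e f" "x \<in> KE"
  shows "poly (map_poly of_int P) x \<in> KE \<and>
    conj e f (poly (map_poly of_int P) x) = poly (map_poly of_int P) (conj e f x)"
proof (induction P)
  case (pCons a P)
  thus ?case using assms by (simp add: map_poly_pCons KE_closed conj_hom conj_basic)
qed (simp add: conj_basic)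

lemma conj_OK:
  assumes "signs e f" "x \<in> OK"
  shows "conj e f x \<in> OK"
proof -
  obtain P :: "int poly" where P: "poly (map_poly of_int P) x = 0" "lead_coeff P = 1"
    using assms(2) algebraic_int_altdef_ipoly by (auto simp: OK_iff)
  have "poly (map_poly of_int P) (conj e f x) = 0"
    using conj_poly[OF assms(1), of x P] assms(2) P(1) by (simp add: OK_iff conj_basic)
  thus ?thesis using P(2) algebraic_int_altdef_ipoly by (auto simp: OK_iff)
qed

lemma OK_rational: "of_rat x \<in> OK \<Longrightarrow> x \<in> \<int>"
proof -
  assume "of_rat x \<in> OK"
  hence "complex_of_rat x \<in> \<int>" by (intro rational_algebraic_int_is_int) (auto simp: OK_iff)
  then obtain i where "complex_of_rat x = of_int i" by (auto elim: Ints_cases)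
  hence "complex_of_rat x = of_rat (of_int i)" by simp
  thus "x \<in> \<int>" by (simp only: of_rat_eq_iff) simp
qed

lemma nm_OK:
  assumes "x \<in> OK" obtains n :: int where "nm x = of_int n"
proof -
  obtain y where y: "nm x = of_rat y" using nm_rat assms OK_KE by blast
  have "nm x \<in> OK" unfolding nm_def using assms by (intro OK_closed conj_OK) auto
  hence "y \<in> \<int>" using y OK_rational by metis
  thus ?thesis using that y by (auto elim!: Ints_cases)
qed

lemma squarefree_radicands: "squarefree (int p)" "squarefree (int q * int r)" "squarefree (int p * (int q * int r))"
proof -
  have pi: "Factorial_Ring.prime (int p)" "Factorial_Ring.prime (int q)" "Factorial_Ring.prime (int r)"
    using p q r by simp_all
  have cop: "coprime (int q) (int r)" "coprime (int p) (int q)" "coprime (int p) (int r)"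
    using pi pq pr qr by (simp_all add: primes_coprime)
  show 1: "squarefree (int p)" using pi squarefree_prime by blast
  show 2: "squarefree (int q * int r)" 
    by (rule squarefree_mult_coprime[OF cop(1) squarefree_prime[OF pi(2)] squarefree_prime[OF pi(3)]])
  show "squarefree (int p * (int q * int r))" using cop(2,3)
    by (intro squarefree_mult_coprime[OF _ 1 2]) simp
qed

lemma radicands_mod: "int p mod 4 = 3" "(int q * int r) mod 8 = 1" "(int p * (int q * int r)) mod 4 = 3"
proof -
  show 1: "int p mod 4 = 3" using p(2) by (simp add: unique_euclidean_semiring_class.cong_def) presburger
  have "int q mod 8 = 1" "int r mod 8 = 1" using q(2) r(2)
    by (simp_all add: unique_euclidean_semiring_class.cong_def) presburger+
  thus 2: "(int q * int r) mod 8 = 1" using mod_mult_eq[of "int q" 8 "int r"] by simp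
  hence "(int q * int r) mod 4 = 1" by presburger
  thus "(int p * (int q * int r)) mod 4 = 3" using 1 mod_mult_eq[of "int p" 4 "int q * int r"] by simp
qed

text \<open>The suffixes k1, k2, k3 stand for the quadratic subfields Q(s), Q(t), Q(st). In each of
  them the trace and the norm are rational algebraic integers, hence integers; Q(t) is the one in
  which coordinates can be half-integral.\<close>

lemma OK_k1:
  assumes "el a b 0 0 \<in> OK" shows "a \<in> \<int>" "b \<in> \<int>"
proof -
  have c: "conj (-1) 1 (el a b 0 0) \<in> OK" using assms by (intro conj_OK) auto
  have "of_rat (2 * a) = el a b 0 0 + conj (-1) 1 (el a b 0 0)"
    by (simp add: conj_el el_add el_basic)
  hence 1: "2 * a \<in> \<int>" using OK_rational OK_closed(1)[OF assms c] by metis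
  have "of_rat (a\<^sup>2 - of_int (int p) * b\<^sup>2) = el a b 0 0 * conj (-1) 1 (el a b 0 0)"
    by (simp add: conj_el el_mult el_basic power2_eq_square)
  hence 2: "a\<^sup>2 - of_int (int p) * b\<^sup>2 \<in> \<int>" using OK_rational OK_closed(4)[OF assms c] by metis
  show "a \<in> \<int>" "b \<in> \<int>"
    using quadratic_integer_3_mod_4[OF squarefree_radicands(1) radicands_mod(1) 1 2] by auto
qed

lemma OK_k2:
  assumes "el a 0 c 0 \<in> OK"
  shows "2 * a \<in> \<int>" "2 * c \<in> \<int>" "a\<^sup>2 - of_int (int q * int r) * c\<^sup>2 = 1 \<Longrightarrow> a \<in> \<int> \<and> c \<in> \<int>"
proof -
  have c: "conj 1 (-1) (el a 0 c 0) \<in> OK" using assms by (intro conj_OK) auto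
  have "of_rat (2 * a) = el a 0 c 0 + conj 1 (-1) (el a 0 c 0)"
    by (simp add: conj_el el_add el_basic)
  thus 1: "2 * a \<in> \<int>" using OK_rational OK_closed(1)[OF assms c] by metis
  have "of_rat (a\<^sup>2 - of_int (int q * int r) * c\<^sup>2) = el a 0 c 0 * conj 1 (-1) (el a 0 c 0)"
    by (simp add: conj_el el_mult el_basic power2_eq_square)
  hence 2: "a\<^sup>2 - of_int (int q * int r) * c\<^sup>2 \<in> \<int>" using OK_rational OK_closed(4)[OF assms c] by metis
  show "2 * c \<in> \<int>"
    using quadratic_integer_half[OF squarefree_radicands(2) 1 2] by (metis Ints_of_int)
  show "a \<in> \<int> \<and> c \<in> \<int>" if "a\<^sup>2 - of_int (int q * int r) * c\<^sup>2 = 1"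
    using quadratic_unit_1_mod_8[OF squarefree_radicands(2) radicands_mod(2) 1 that] by auto
qed

lemma OK_k3:
  assumes "el a 0 0 d \<in> OK" shows "a \<in> \<int>" "d \<in> \<int>"
proof -
  have c: "conj (-1) 1 (el a 0 0 d) \<in> OK" using assms by (intro conj_OK) auto
  have "of_rat (2 * a) = el a 0 0 d + conj (-1) 1 (el a 0 0 d)"
    by (simp add: conj_el el_add el_basic)
  hence 1: "2 * a \<in> \<int>" using OK_rational OK_closed(1)[OF assms c] by metis
  have "of_rat (a\<^sup>2 - of_int (int p * (int q * int r)) * d\<^sup>2) = el a 0 0 d * conj (-1) 1 (el a 0 0 d)"
    by (simp add: conj_el el_mult el_basic power2_eq_square)
  hence 2: "a\<^sup>2 - of_int (int p * (int q * int r)) * d\<^sup>2 \<in> \<int>" using OK_rational OK_closed(4)[OF assms c] by metis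
  show "a \<in> \<int>" "d \<in> \<int>"
    using quadratic_integer_3_mod_4[OF squarefree_radicands(3) radicands_mod(3) 1 2] by auto
qed

end

section \<open>The ideal generated by q and t is not principal\<close>

lemma qr_parity_unit: "qr_parity q r 1" "qr_parity q r (- 1)"
  by (simp_all add: qr_parity_def multiplicity_unit_right)

context biquadratic
begin

definition QI :: "complex set" where
  "QI = {of_nat q * x + t * y | x y. x \<in> OK \<and> y \<in> OK}"

lemma QI_I: "x \<in> OK \<Longrightarrow> y \<in> OK \<Longrightarrow> of_nat q * x + t * y \<in> QI"
  by (auto simp: QI_def)

lemma QI_subset_OK: "x \<in> QI \<Longrightarrow> x \<in> OK"
  by (auto simp: QI_def intro!: OK_closed)

lemma QI_closed: "x \<in> QI \<Longrightarrow> y \<in> QI \<Longrightarrow> x + y \<in> QI" "a \<in> OK \<Longrightarrow> x \<in> QI \<Longrightarrow> a * x \<in> QI"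
proof -
  show "x + y \<in> QI" if xy: "x \<in> QI" "y \<in> QI"
  proof -
    obtain a b c d where o: "a \<in> OK" "b \<in> OK" "c \<in> OK" "d \<in> OK"
      "x = of_nat q * a + t * b" "y = of_nat q * c + t * d"
      using xy by (auto simp: QI_def)
    hence "x + y = of_nat q * (a + c) + t * (b + d)" by (simp add: algebra_simps)
    thus ?thesis using o by (simp add: QI_I OK_closed)
  qed
  show "a * x \<in> QI" if ax: "a \<in> OK" "x \<in> QI"
  proof -
    obtain b c where o: "b \<in> OK" "c \<in> OK" "x = of_nat q * b + t * c"
      using ax by (auto simp: QI_def)
    hence "a * x = of_nat q * (a * b) + t * (a * c)" by (simp add: algebra_simps)
    thus ?thesis using o ax by (simp add: QI_I OK_closed)
  qed
qed

lemma q_in_QI: "of_nat q \<in> QI" and t_in_QI: "t \<in> QI"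
  using QI_I[of 1 0] QI_I[of 0 1] by simp_all

lemma conj_QI:
  assumes "signs e f" "x \<in> QI" shows "conj e f x \<in> QI"
proof -
  obtain a b where o: "a \<in> OK" "b \<in> OK" "x = of_nat q * a + t * b"
    using assms by (auto simp: QI_def)
  have "conj e f x = of_nat q * conj e f a + t * (of_rat f * conj e f b)"
    unfolding o(3) using assms(1) o OK_KE
    by (simp add: conj_hom KE_closed conj_basic mult_ac)
  moreover have "of_rat f \<in> OK" using assms(1) OK_basic(3)[of 1] OK_basic(3)[of "-1"] by auto
  ultimately show ?thesis using o assms(1) by (simp add: QI_I conj_OK OK_closed)
qed

lemma QI_mult:
  assumes "x \<in> QI" "y \<in> QI"
  obtains c where "c \<in> OK" "x * y = of_nat q * c"
proof -
  obtain a b c d where o: "a \<in> OK" "b \<in> OK" "c \<in> OK" "d \<in> OK"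
    "x = of_nat q * a + t * b" "y = of_nat q * c + t * d"
    using assms by (auto simp: QI_def)
  have "x * y = of_nat q * (of_nat q * (a * c) + t * (a * d + b * c)) + (t * t) * (b * d)"
    unfolding o by (simp add: algebra_simps)
  also have "\<dots> = of_nat q * (of_nat q * (a * c) + t * (a * d + b * c) + of_nat r * (b * d))"
    unfolding t_sq by (simp add: algebra_simps)
  finally have "x * y = of_nat q * (of_nat q * (a * c) + t * (a * d + b * c) + of_nat r * (b * d))" .
  moreover have "of_nat q * (a * c) + t * (a * d + b * c) + of_nat r * (b * d) \<in> OK"
    using o by (intro OK_closed) auto
  ultimately show ?thesis using that by blast
qed

lemma coprime_bezout: obtains A B :: int where "int q * A + int r * B = 1"
proof -
  have "coprime (int q) (int r)" using q r qr by (simp add: primes_coprime)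
  thus ?thesis using that bezout_int[of "int q" "int r"] by (metis coprime_iff_gcd_eq_1 mult.commute)
qed

lemma square_scaled_unit:
  assumes "v \<in> KE" "v' \<in> KE" "v + v' = of_int (2 * A)" "v * v' = 1"
    and D: "D \<in> {int p, int q * int r, int p * (int q * int r)}" "A\<^sup>2 - D * B\<^sup>2 = 1"
  shows "\<exists>d \<beta>. d \<noteq> 0 \<and> qr_parity q r d \<and> \<beta> \<in> KE \<and> of_int d * v = \<beta>\<^sup>2"
proof -
  have e: "of_int (2 * (A + 1)) * v = (1 + v)\<^sup>2"
  proof -
    have "(1 + v)\<^sup>2 = 2 * v + v * v' + v * v" using assms(4) by (simp add: power2_eq_square algebra_simps)
    also have "\<dots> = v * (2 + (v + v'))" by (simp add: algebra_simps)
    finally show ?thesis unfolding assms(3) by (simp add: algebra_simps)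
  qed
  show ?thesis
  \<comment> \<open>The multiplier \<open>2 * (A + 1)\<close> vanishes for \<open>A = - 1\<close>;
    then \<open>v = - 1\<close>, and the multiplier -1 turns it into a square.\<close>
  proof (cases "A = - 1")
    case True
    hence "v = - 1" using e by (simp add: add_eq_0_iff)
    hence "of_int (- 1) * v = 1\<^sup>2" by simp
    thus ?thesis using qr_parity_unit KE_basic(6) by (metis zero_neq_neg_one)
  next
    case False
    have "qr_parity q r (2 * (A + 1))"
      by (rule qr_parity_norm_one[OF p(1) p_odd pq pr qr q r nqr nrq D False])
    moreover have "2 * (A + 1) \<noteq> 0" using False by simp
    moreover have "1 + v \<in> KE" using assms(1) by (simp add: KE_closed)
    ultimately show ?thesis using e by blast
  qed
qed

text \<open>Each automorphism sends \<open>z\<close> to \<open>z\<close> or \<open>- z\<close>,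
  since it fixes the square. Comparing coordinates leaves a single nonzero one at most, so
  \<open>z\<close> is a rational multiple of 1, \<open>s\<close>, \<open>t\<close> or
  \<open>s * t\<close>.\<close>

lemma rational_square_cases:
  assumes "z \<in> KE" "z\<^sup>2 = of_rat y"
  shows "\<exists>E h. E \<in> {1, int p, int q * int r, int p * (int q * int r)} \<and> y = of_int E * h\<^sup>2"
proof -
  have sgn: "conj e f z = z \<or> conj e f z = - z" if "signs e f" for e f
  proof -
    have "(conj e f z)\<^sup>2 = conj e f (z\<^sup>2)"
      unfolding power2_eq_square using conj_hom(3)[OF that assms(1) assms(1)] by simp
    also have "\<dots> = z\<^sup>2" by (simp add: assms(2) conj_basic)
    finally show ?thesis by (simp add: power2_eq_iff)
  qed
  obtain a b c d where z: "z = el a b c d" using assms(1) by (rule KE_cases)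
  have 1: "(c = 0 \<and> d = 0) \<or> (a = 0 \<and> b = 0)"
    using sgn[of 1 "-1"] by (auto simp: z conj_el el_minus el_eq_iff)
  have 2: "(b = 0 \<and> d = 0) \<or> (a = 0 \<and> c = 0)"
    using sgn[of "-1" 1] by (auto simp: z conj_el el_minus el_eq_iff)
  have "of_rat y = z * z" using assms(2) by (simp add: power2_eq_square)
  hence y: "y = a * a + of_nat p * (b * b) + of_nat (q * r) * (c * c) + of_nat (p * (q * r)) * (d * d)"
    unfolding z el_mult by (simp add: el_basic el_eq_iff del: of_nat_mult)
  from 1 2 consider "b = 0" "c = 0" "d = 0" | "a = 0" "c = 0" "d = 0" | "a = 0" "b = 0" "d = 0"
    | "a = 0" "b = 0" "c = 0" by blast
  thus ?thesis
  proof cases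
    case 1
    hence "y = of_int 1 * a\<^sup>2" using y by (simp add: power2_eq_square)
    thus ?thesis by blast
  next
    case 2
    hence "y = of_int (int p) * b\<^sup>2" using y by (simp add: power2_eq_square)
    thus ?thesis by blast
  next
    case 3
    hence "y = of_int (int q * int r) * c\<^sup>2" using y by (simp add: power2_eq_square)
    thus ?thesis by blast
  next
    case 4
    hence "y = of_int (int p * (int q * int r)) * d\<^sup>2" using y by (simp add: power2_eq_square)
    thus ?thesis by blast
  qed
qed

text \<open>Every possible \<open>E\<close> is even for \<open>qr_parity\<close>, while
  \<open>q * d\<close> is odd; squares do not change either parity.\<close>

lemma not_square_q_parity:
  assumes "z \<in> KE" "z\<^sup>2 = of_int (int q * d)" "d \<noteq> 0" "qr_parity q r d"
  shows False
proof -
  have "z\<^sup>2 = of_rat (of_int (int q * d))" using assms(2) by (simp only: of_rat_of_int_eq)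
  from rational_square_cases[OF assms(1) this] obtain E h where
    E: "E \<in> {1, int p, int q * int r, int p * (int q * int r)}" and h: "of_int (int q * d) = of_int E * (h::rat)\<^sup>2"
    by blast
  obtain u v where uv: "quotient_of h = (u, v)" by (cases "quotient_of h")
  have hv: "h = of_int u / of_int v" "v > 0"
    using quotient_of_div[OF uv] quotient_of_denom_pos[OF uv] by auto
  have "of_int (int q * d * (v * v)) = (of_int (E * (u * u)) :: rat)"
    using h hv by (simp add: field_simps power2_eq_square)
  hence e: "int q * d * (v * v) = E * (u * u)" by (simp only: of_int_eq_iff)
  have nz: "int q \<noteq> 0" "int p \<noteq> 0" "int r \<noteq> 0" "v \<noteq> 0" using pos hv by auto
  have E0: "E \<noteq> 0" using E nz by auto
  have u0: "u \<noteq> 0" using e nz assms(3) E0 by auto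
  have pi: "Factorial_Ring.prime (int p)" "Factorial_Ring.prime (int q)" "Factorial_Ring.prime (int r)"
    using p q r by simp_all
  note m0 = multiplicity_eq_0_prime
  note M = qr_parity_mult[OF q(1) r(1)]
  have "multiplicity (int q) (int q) = 1" "multiplicity (int r) (int r) = 1"
    using pi by (auto intro!: multiplicity_self)
  hence parq: "\<not> qr_parity q r (int q)" "\<not> qr_parity q r (int r)"
    using m0[of r q] m0[of q r] q r qr by (auto simp: qr_parity_def)
  have parp: "qr_parity q r (int p)"
    using m0[of r p] m0[of q p] q r p pq pr by (auto simp: qr_parity_def)
  have parqr: "qr_parity q r (int q * int r)" using M[of "int q" "int r"] parq nz by simp
  have "qr_parity q r E"
    using E parp parqr qr_parity_unit(1) M[of "int p" "int q * int r"] nz by auto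
  hence "qr_parity q r (E * (u * u))" using M[of E "u * u"] M[of u u] E0 u0 by simp
  moreover have "\<not> qr_parity q r (int q * d * (v * v))"
    using M[of "int q * d" "v * v"] M[of "int q" d] M[of v v] nz assms(3,4) parq by simp
  ultimately show False using e by simp
qed

lemma QI_not_principal:
  assumes "\<gamma> \<in> KE" "QI = (\<lambda>x. \<gamma> * x) ` OK"
  shows False
proof -
  have "\<gamma> * 1 \<in> QI" unfolding assms(2) by (rule imageI) simp
  hence gQ: "\<gamma> \<in> QI" by simp
  hence gO: "\<gamma> \<in> OK" by (rule QI_subset_OK)
  have q0: "of_nat q \<noteq> (0::complex)" using pos by simp
  obtain u where u: "u \<in> OK" "\<gamma> * \<gamma> = of_nat q * u" using QI_mult[OF gQ gQ] .
  obtain a where a: "a \<in> OK" "of_nat q = \<gamma> * a" using q_in_QI assms(2) by auto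
  obtain b where b: "b \<in> OK" "t = \<gamma> * b" using t_in_QI assms(2) by auto
  obtain A B where AB: "int q * A + int r * B = 1" using coprime_bezout .
  \<comment> \<open>The Bezout relation gives \<open>q = q * q * A + t * t * B\<close>. Both terms
    are multiples of the square of the generator, so this \<open>e\<close> is an inverse of
    \<open>u\<close>.\<close>
  define e where "e = a * a * of_int A + b * b * of_int B"
  have e: "e \<in> OK" unfolding e_def using a b by (intro OK_closed) auto
  have "of_nat q = of_nat q * of_int (int q * A + int r * B)" unfolding AB by simp
  also have "\<dots> = (of_nat q * of_nat q) * of_int A + (t * t) * of_int B"
    unfolding t_sq by (simp add: algebra_simps)
  also have "\<dots> = (\<gamma> * a) * (\<gamma> * a) * of_int A + (\<gamma> * b) * (\<gamma> * b) * of_int B" using a(2) b(2) by simp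
  also have "\<dots> = (\<gamma> * \<gamma>) * e" by (simp add: e_def algebra_simps)
  also have "\<dots> = of_nat q * (u * e)" unfolding u(2) by simp
  finally have ue: "u * e = 1" using q0 by (metis mult_cancel_left mult.right_neutral)
  have g0: "\<gamma> \<noteq> 0" using a(2) q0 by auto
  obtain n where n: "nm \<gamma> = of_int n" using nm_OK[OF gO] .
  obtain m where m: "nm u = of_int m" using nm_OK[OF u(1)] .
  obtain l where l: "nm e = of_int l" using nm_OK[OF e] .
  have "nm (u * e) = 1" unfolding ue by (simp add: nm_def conj_basic)
  hence "of_int (m * l) = (1::complex)" using nm_mult[OF OK_KE[OF u(1)] OK_KE[OF e]] m l by simp
  hence "m * l = 1" by (metis of_int_eq_1_iff)
  hence ml: "m = 1 \<or> m = - 1" by (metis zmult_eq_1_iff)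
  have "nm (\<gamma> * \<gamma>) = of_nat q ^ 4 * nm u"
    unfolding u(2) using nm_mult[of "of_nat q" u] u(1) OK_KE
    by (simp add: nm_def conj_basic power_numeral_reduce)
  hence "of_int (n * n) = (of_int ((int q)^4 * m) :: complex)"
    using nm_mult[OF OK_KE[OF gO] OK_KE[OF gO]] n m by simp
  hence nn: "n * n = (int q)^4 * m" by (simp only: of_int_eq_iff)
  have "(int q)^4 > 0" using pos by simp
  hence "m = 1" using ml nn zero_le_square[of n] by auto
  hence "n\<^sup>2 = ((int q)\<^sup>2)\<^sup>2" using nn by (simp add: power2_eq_square power4_eq_xxxx)
  hence n2: "n = (int q)\<^sup>2 \<or> n = - ((int q)\<^sup>2)" by (simp only: power2_eq_iff)
  \<comment> \<open>\<open>w e f\<close> is the relative norm of \<open>\<gamma>\<close> to a quadratic subfield, divided by \<open>q\<close>\<close>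
  define w where "w = (\<lambda>e f. \<gamma> * conj e f \<gamma> / of_nat q)"
  have gK: "\<gamma> \<in> KE" by fact
  have wO: "w e f \<in> OK" if ef: "signs e f" for e f
  proof -
    obtain c where "c \<in> OK" "\<gamma> * conj e f \<gamma> = of_nat q * c" using QI_mult[OF gQ conj_QI[OF ef gQ]] .
    thus ?thesis using q0 by (simp add: w_def)
  qed
  have qc: "conj e f (x / of_nat q) = conj e f x / of_nat q" if "signs e f" "x \<in> KE" for e f x
  proof -
    have "conj e f (x * of_rat (1 / of_nat q)) = conj e f x * of_rat (1 / of_nat q)"
      using that by (simp only: conj_hom KE_basic conj_basic)
    thus ?thesis by (simp add: of_rat_divide)
  qed
  have wc: "conj e' f' (w e f) = conj e' f' \<gamma> * conj (e' * e) (f' * f) \<gamma> / of_nat q"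
    if "signs e' f'" for e f e' f'
    using that gK by (simp add: w_def qc KE_closed conj_hom conj_conj')
  have w1: "conj 1 (-1) (w 1 (-1)) = w 1 (-1)" "conj (-1) 1 (w (-1) 1) = w (-1) 1"
    "conj (-1) (-1) (w (-1) (-1)) = w (-1) (-1)"
    using gK by (simp_all add: wc) (auto simp: w_def mult_ac elim!: KE_cases simp: conj_el)
  \<comment> \<open>The norm of each \<open>w e f\<close> down to Q is the full norm
    \<open>n\<close> of the generator divided by \<open>q\<^sup>2\<close>, the same number for all
    three; it is 1 or -1 by \<open>n2\<close>.\<close>
  have w2: "w 1 (-1) * conj (-1) 1 (w 1 (-1)) = of_int n / (of_nat q)\<^sup>2"
    "w (-1) 1 * conj 1 (-1) (w (-1) 1) = of_int n / (of_nat q)\<^sup>2"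
    "w (-1) (-1) * conj (-1) 1 (w (-1) (-1)) = of_int n / (of_nat q)\<^sup>2"
    by (simp_all add: wc) (simp_all add: w_def nm_def mult_ac power2_eq_square flip: n)
  have wK: "w e f \<in> KE" if "signs e f" for e f using OK_KE wO[OF that] .
  have k1: "\<exists>A B. w 1 (-1) = el (of_int A) (of_int B) 0 0"
  proof -
    obtain a b where ab: "w 1 (-1) = el a b 0 0" using fixed_sg[OF wK w1(1)] by auto
    hence "a \<in> \<int>" "b \<in> \<int>" using OK_k1 wO[of 1 "-1"] by auto
    thus ?thesis using ab by (auto elim!: Ints_cases)
  qed
  then obtain A1 B1 where v1: "w 1 (-1) = el (of_int A1) (of_int B1) 0 0" by blast
  have "w 1 (-1) * conj (-1) 1 (w 1 (-1)) = of_int (A1\<^sup>2 - int p * B1\<^sup>2)"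
    unfolding v1 by (simp add: conj_el el_mult power2_eq_square el_basic)
  hence N1: "of_int (A1\<^sup>2 - int p * B1\<^sup>2) = (of_int n / (of_nat q)\<^sup>2 :: complex)" using w2(1) by simp
  have "n \<noteq> - ((int q)\<^sup>2)"
  proof
    assume "n = - ((int q)\<^sup>2)"
    hence "of_int (A1\<^sup>2 - int p * B1\<^sup>2) = (of_int (- 1) :: complex)" unfolding N1 using q0 by simp
    hence "A1\<^sup>2 - int p * B1\<^sup>2 = - 1" by (simp only: of_int_eq_iff)
    thus False using not_norm_minus_one[OF radicands_mod(1)] by blast
  qed
  hence nq: "n = (int q)\<^sup>2" using n2 by blast
  hence n1: "of_int n / (of_nat q)\<^sup>2 = (1::complex)" using q0 by simp
  have "of_int (A1\<^sup>2 - int p * B1\<^sup>2) = (of_int 1 :: complex)" using N1 n1 by simp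
  hence N1: "A1\<^sup>2 - int p * B1\<^sup>2 = 1" by (simp only: of_int_eq_iff)
  obtain d1 \<beta>1 where 1: "d1 \<noteq> 0" "qr_parity q r d1" "\<beta>1 \<in> KE" "of_int d1 * w 1 (-1) = \<beta>1\<^sup>2"
    using square_scaled_unit[of "w 1 (-1)" "conj (-1) 1 (w 1 (-1))" A1 "int p" B1] wK[of 1 "-1"] w2(1) n1 N1
    by (auto simp: v1 conj_el el_add el_basic)
  obtain a c where ac: "w (-1) 1 = el a 0 c 0" using fixed_tu[OF wK w1(2)] by auto
  have "w (-1) 1 * conj 1 (-1) (w (-1) 1) = of_rat (a\<^sup>2 - of_int (int q * int r) * c\<^sup>2)"
    unfolding ac by (simp add: conj_el el_mult power2_eq_square el_basic)
  hence "of_rat (a\<^sup>2 - of_int (int q * int r) * c\<^sup>2) = (of_rat 1 :: complex)" using w2(2) n1 by simp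
  hence "a\<^sup>2 - of_int (int q * int r) * c\<^sup>2 = 1" by (simp only: of_rat_eq_iff)
  moreover from this have "a \<in> \<int>" "c \<in> \<int>" using OK_k2(3) wO[of "-1" 1] ac by auto
  ultimately obtain A2 B2 where v2: "w (-1) 1 = el (of_int A2) 0 (of_int B2) 0"
    and "of_int (A2\<^sup>2 - (int q * int r) * B2\<^sup>2) = (of_int 1 :: rat)" using ac by (auto elim!: Ints_cases)
  hence N2: "A2\<^sup>2 - (int q * int r) * B2\<^sup>2 = 1" by (simp only: of_int_eq_iff)
  obtain d2 \<beta>2 where 2: "d2 \<noteq> 0" "qr_parity q r d2" "\<beta>2 \<in> KE" "of_int d2 * w (-1) 1 = \<beta>2\<^sup>2"
    using square_scaled_unit[of "w (-1) 1" "conj 1 (-1) (w (-1) 1)" A2 "int q * int r" B2] wK[of "-1" 1] w2(2) n1 N2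
    by (auto simp: v2 conj_el el_add el_basic)
  obtain a d where ad: "w (-1) (-1) = el a 0 0 d" using fixed_st[OF wK w1(3)] by auto
  hence "a \<in> \<int>" "d \<in> \<int>" using OK_k3 wO[of "-1" "-1"] by auto
  then obtain A3 B3 where v3: "w (-1) (-1) = el (of_int A3) 0 0 (of_int B3)" using ad by (auto elim!: Ints_cases)
  have "w (-1) (-1) * conj (-1) 1 (w (-1) (-1)) = of_int (A3\<^sup>2 - (int p * (int q * int r)) * B3\<^sup>2)"
    unfolding v3 by (simp add: conj_el el_mult power2_eq_square el_basic)
  hence "of_int (A3\<^sup>2 - (int p * (int q * int r)) * B3\<^sup>2) = (of_int 1 :: complex)" using w2(3) n1 by simp
  hence N3: "A3\<^sup>2 - (int p * (int q * int r)) * B3\<^sup>2 = 1" by (simp only: of_int_eq_iff)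
  obtain d3 \<beta>3 where 3: "d3 \<noteq> 0" "qr_parity q r d3" "\<beta>3 \<in> KE" "of_int d3 * w (-1) (-1) = \<beta>3\<^sup>2"
    using square_scaled_unit[of "w (-1) (-1)" "conj (-1) 1 (w (-1) (-1))" A3 "int p * (int q * int r)" B3] wK[of "-1" "-1"] w2(3) n1 N3
    by (auto simp: v3 conj_el el_add el_basic)
  \<comment> \<open>In the product of the three relative norms \<open>\<gamma>\<close> occurs three
    times and every other conjugate once, so the product is
    \<open>\<gamma>\<^sup>2 * nm \<gamma>\<close>. With \<open>nm \<gamma> = q\<^sup>2\<close> this
    expresses \<open>\<gamma>\<^sup>2\<close> as \<open>q\<close> times three norm-one units, and
    the factor \<open>d\<close> turns the units into squares.\<close>
  define d where "d = d1 * d2 * d3"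
  define \<beta> where "\<beta> = \<beta>1 * \<beta>2 * \<beta>3"
  have "\<gamma>\<^sup>2 * nm \<gamma> = (of_nat q)^3 * (w 1 (-1) * w (-1) 1 * w (-1) (-1))"
    using q0 by (simp add: nm_def w_def power2_eq_square power3_eq_cube field_simps)
  moreover have "nm \<gamma> = (of_nat q)\<^sup>2" using n nq by simp
  ultimately have "(of_nat q)\<^sup>2 * \<gamma>\<^sup>2 = (of_nat q)\<^sup>2 * (of_nat q * (w 1 (-1) * w (-1) 1 * w (-1) (-1)))"
    by (simp add: power2_eq_square power3_eq_cube mult_ac)
  hence g2: "\<gamma>\<^sup>2 = of_nat q * (w 1 (-1) * w (-1) 1 * w (-1) (-1))" using q0 by simp
  have "of_int d * \<gamma>\<^sup>2 = of_nat q * ((of_int d1 * w 1 (-1)) * (of_int d2 * w (-1) 1) * (of_int d3 * w (-1) (-1)))"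
    unfolding g2 d_def by (simp add: mult_ac)
  also have "\<dots> = of_nat q * \<beta>\<^sup>2" unfolding 1 2 3 \<beta>_def by (simp add: power_mult_distrib)
  finally have dg: "of_int d * \<gamma>\<^sup>2 = of_nat q * \<beta>\<^sup>2" .
  have d0: "d \<noteq> 0" using 1 2 3 by (simp add: d_def)
  hence b0: "\<beta> \<noteq> 0" using dg g0 by auto
  \<comment> \<open>From \<open>d * \<gamma>\<^sup>2 = q * \<beta>\<^sup>2\<close> this quotient is
    a square root of \<open>q * d\<close> in the field.\<close>
  define z where "z = of_int d * \<gamma> * inverse \<beta>"
  have "z \<in> KE" unfolding z_def \<beta>_def using 1 2 3 gK by (intro KE_closed KE_inverse) auto
  moreover have "z\<^sup>2 = of_int (int q * d)"
  proof -
    have "z\<^sup>2 = of_int d * (of_int d * \<gamma>\<^sup>2) / \<beta>\<^sup>2" by (simp add: z_def power2_eq_square field_simps)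
    also have "\<dots> = of_int d * of_nat q" unfolding dg using b0 by simp
    finally show ?thesis by (simp add: mult.commute)
  qed
  moreover have "qr_parity q r d" unfolding d_def using 1 2 3 qr_parity_mult[OF q(1) r(1)] by simp
  ultimately show False using not_square_q_parity d0 by blast
qed

end

section \<open>Subgroups of the integers and modules over the ring of integers\<close>

lemma int_subgroup_cyclic:
  fixes S :: "int set"
  assumes "\<And>x y. x \<in> S \<Longrightarrow> y \<in> S \<Longrightarrow> x - y \<in> S" and "x0 \<in> S" "x0 \<noteq> 0"
  obtains g where "g > 0" "g \<in> S" "\<And>x. x \<in> S \<longleftrightarrow> g dvd x"
proof -
  have zero: "0 \<in> S" using assms(1)[OF assms(2,2)] by simp
  have neg: "- x \<in> S" if "x \<in> S" for x using assms(1)[OF zero that] by simp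
  have add: "x + y \<in> S" if "x \<in> S" "y \<in> S" for x y using assms(1)[OF that(1) neg[OF that(2)]] by simp
  define P where "P n \<longleftrightarrow> n > 0 \<and> int n \<in> S" for n :: nat
  have "\<exists>n. P n"
  proof (cases "x0 > 0")
    case True
    thus ?thesis using assms(2) by (intro exI[of _ "nat x0"]) (auto simp: P_def)
  next
    case False
    thus ?thesis using assms(3) neg[OF assms(2)] by (intro exI[of _ "nat (- x0)"]) (auto simp: P_def)
  qed
  define n where "n = (LEAST n. P n)"
  have n: "n > 0" "int n \<in> S" using LeastI_ex[OF \<open>\<exists>n. P n\<close>] by (auto simp: n_def P_def)
  have mult: "int n * int k \<in> S" for k
    by (induction k) (auto simp: zero algebra_simps intro: add n)
  have mult': "int n * k \<in> S" for k
    using mult[of "nat k"] neg[OF mult[of "nat (- k)"]] by (cases "k \<ge> 0") auto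
  have "x \<in> S \<longleftrightarrow> int n dvd x" for x
  proof
    assume "int n dvd x" thus "x \<in> S" using mult' by auto
  next
    assume x: "x \<in> S"
    have "x mod int n = x - int n * (x div int n)" by (simp add: minus_mult_div_eq_mod)
    hence m: "x mod int n \<in> S" using assms(1)[OF x mult'] by simp
    have "x mod int n = 0"
    proof (rule ccontr)
      assume "x mod int n \<noteq> 0"
      hence "P (nat (x mod int n))" using m n by (auto simp: P_def le_neq_implies_less)
      hence "n \<le> nat (x mod int n)" unfolding n_def by (rule Least_le)
      thus False using n pos_mod_bound[of "int n" x] by linarith
    qed
    thus "int n dvd x" by auto
  qed
  thus ?thesis using that[of "int n"] n by auto
qed

lemma dvd_prime_mult_cases:
  fixes l m h :: int
  assumes "Factorial_Ring.prime l" "Factorial_Ring.prime m" "h dvd l * m" "h > 0"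
  shows "h \<in> {1, l, m, l * m}"
proof (cases "l dvd h")
  case True
  then obtain k where k: "h = l * k" by (auto elim: dvdE)
  have l0: "l > 0" using assms(1) by (simp add: prime_gt_0_int)
  have "k dvd m" using assms(3) l0 unfolding k by simp
  moreover have "k > 0" using assms(4) l0 unfolding k by (simp add: zero_less_mult_iff)
  ultimately have "k = 1 \<or> k = m" using assms(2) by (auto simp: prime_int_iff)
  thus ?thesis using k by auto
next
  case False
  hence "coprime h l" using assms(1) by (metis coprime_commute prime_imp_coprime)
  hence "h dvd m" using assms(3) by (simp add: coprime_dvd_mult_right_iff)
  moreover have "0 \<le> h" using assms(4) by simp
  ultimately have "h = 1 \<or> h = m" using assms(2) unfolding prime_int_iff by blast
  thus ?thesis by blast
qed

context biquadratic
begin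

text \<open>Only the closure conditions of a fractional ideal; that it is nonzero and has a common
  denominator is assumed separately where it matters.\<close>

definition module :: "complex set \<Rightarrow> bool" where
  "module I \<longleftrightarrow> I \<subseteq> KE \<and> (\<forall>x\<in>I. \<forall>y\<in>I. x + y \<in> I) \<and> (\<forall>a\<in>OK. \<forall>x\<in>I. a * x \<in> I)"

lemma module_add: "module I \<Longrightarrow> x \<in> I \<Longrightarrow> y \<in> I \<Longrightarrow> x + y \<in> I"
  and module_mult: "module I \<Longrightarrow> a \<in> OK \<Longrightarrow> x \<in> I \<Longrightarrow> a * x \<in> I"
  and module_KE: "module I \<Longrightarrow> x \<in> I \<Longrightarrow> x \<in> KE"
  by (auto simp: module_def)

lemma module_int: "module I \<Longrightarrow> x \<in> I \<Longrightarrow> of_int k * x \<in> I"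
  by (simp add: module_mult)

lemma module_diff: "module I \<Longrightarrow> x \<in> I \<Longrightarrow> y \<in> I \<Longrightarrow> x - y \<in> I"
  using module_add[of I x "- y"] module_int[of I y "- 1"] by simp

text \<open>The substitute for localization: membership is checked after multiplying by two coprime
  integers, each of which clears its own set of denominators.\<close>

lemma module_coprime:
  assumes I: "module I" and "of_int m * x \<in> I" "of_int n * x \<in> I" "coprime m n"
  shows "x \<in> I"
proof -
  obtain u v where "u * m + v * n = 1"
    using bezout_int[of m n] assms(4) by (metis coprime_iff_gcd_eq_1)
  hence "x = of_int (u * m + v * n) * x" by simp
  also have "\<dots> = of_int u * (of_int m * x) + of_int v * (of_int n * x)" by (simp add: algebra_simps)
  finally show ?thesis using module_add[OF I module_int[OF I assms(2)] module_int[OF I assms(3)]] by metis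
qed

lemma module_OK: "module OK"
  by (auto simp: module_def OK_closed OK_KE)

lemma module_QI: "module QI"
  by (auto simp: module_def QI_closed OK_KE QI_subset_OK)

lemma module_scale:
  assumes "module I" "c \<in> KE" shows "module ((\<lambda>x. c * x) ` I)"
  unfolding module_def
proof (intro conjI ballI)
  show "(\<lambda>x. c * x) ` I \<subseteq> KE" using assms(2) module_KE[OF assms(1)] by (auto intro!: KE_closed)
  show "x + y \<in> (\<lambda>x. c * x) ` I" if xy: "x \<in> (\<lambda>x. c * x) ` I" "y \<in> (\<lambda>x. c * x) ` I" for x y
  proof -
    obtain x' y' where "x' \<in> I" "y' \<in> I" "x = c * x'" "y = c * y'" using xy by auto
    thus ?thesis using module_add[OF assms(1), of x' y'] by (auto intro!: image_eqI[of _ _ "x' + y'"] simp: algebra_simps)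
  qed
  show "a * x \<in> (\<lambda>x. c * x) ` I" if ax: "a \<in> OK" "x \<in> (\<lambda>x. c * x) ` I" for a x
  proof -
    obtain x' where "x' \<in> I" "x = c * x'" using ax by auto
    thus ?thesis using module_mult[OF assms(1) ax(1), of x'] by (auto intro!: image_eqI[of _ _ "a * x'"] simp: algebra_simps)
  qed
qed

definition invariant :: "complex set \<Rightarrow> bool" where
  "invariant I \<longleftrightarrow> (\<forall>e f. signs e f \<longrightarrow> (\<forall>x\<in>I. conj e f x \<in> I))"

lemma invariantD: "invariant I \<Longrightarrow> signs e f \<Longrightarrow> x \<in> I \<Longrightarrow> conj e f x \<in> I"
  by (simp add: invariant_def)

subsection \<open>Invariant fractional ideals\<close>

lemma el_OK: "el (of_int a) (of_int b) (of_int c) (of_int d) \<in> OK"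
  unfolding el_def of_rat_of_int_eq by (intro OK_closed) auto

lemma el_OK': "a \<in> \<int> \<Longrightarrow> b \<in> \<int> \<Longrightarrow> c \<in> \<int> \<Longrightarrow> d \<in> \<int> \<Longrightarrow> el a b c d \<in> OK"
  by (auto elim!: Ints_cases simp: el_OK)

lemma el_scale: "of_int k * el a b c d = el (of_int k * a) (of_int k * b) (of_int k * c) (of_int k * d)"
  by (simp add: el_def of_rat_mult algebra_simps)

lemma half_Ints: "even (k::int) \<Longrightarrow> of_int k / 2 \<in> (\<int> :: rat set)"
  by (elim evenE) simp

text \<open>Traces give integral \<open>2 * a\<close>, and after multiplication by \<open>u\<close>
  also integral \<open>2 * D * b\<close>. Hence the \<open>b\<close>-coordinates form a cyclic
  group, and two elements with the same \<open>b\<close> differ by an element of Z. The map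
  \<open>\<phi>\<close> abstracts from the choice between Q(s) and Q(t).\<close>

lemma rational_quadratic_generator:
  fixes \<phi> :: "rat \<Rightarrow> rat \<Rightarrow> complex" and D :: nat
  assumes I: "module I" "invariant I" and Z: "\<And>z. of_rat z \<in> I \<longleftrightarrow> z \<in> \<int>"
    and \<phi>: "\<And>a b. \<phi> a b = of_rat a + of_rat b * u" and u: "u \<in> OK" "u * u = of_nat D" "D > 0"
    and ef: "signs e f" "\<And>a b. conj e f (\<phi> a b) = \<phi> a (- b)"
  obtains g h :: int where "h > 0" "h dvd 2 * int D" "\<phi> (of_int g / 2) (of_int h / (2 * of_nat D)) \<in> I"
    "\<And>a b. \<phi> a b \<in> I \<Longrightarrow> \<exists>i k. a = of_int i + of_int k * (of_int g / 2) \<and> b = of_int k * (of_int h / (2 * of_nat D))"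
proof -
  define P :: rat where "P = of_nat D"
  have P0: "P > 0" using u by (simp add: P_def)
  have diff: "\<phi> a b - \<phi> a' b' = \<phi> (a - a') (b - b')" for a b a' b'
    by (simp add: \<phi> of_rat_diff algebra_simps)
  have h2: "2 * a \<in> \<int>" if "\<phi> a b \<in> I" for a b
  proof -
    have "\<phi> a b + conj e f (\<phi> a b) \<in> I" using module_add[OF I(1) that] invariantD[OF I(2) ef(1) that] by simp
    moreover have "\<phi> a b + conj e f (\<phi> a b) = of_rat (2 * a)"
      unfolding ef(2) unfolding \<phi> by (simp add: of_rat_minus of_rat_mult)
    ultimately show ?thesis using Z by simp
  qed
  have h2p: "2 * P * b \<in> \<int>" if "\<phi> a b \<in> I" for a b
  proof -
    have "u * \<phi> a b = \<phi> (P * b) a" using u(2) by (simp add: \<phi> P_def of_rat_mult algebra_simps)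
    thus ?thesis using h2 module_mult[OF I(1) u(1) that] by (metis mult.assoc)
  qed
  \<comment> \<open>The \<open>b\<close>-coordinates scaled by \<open>2 * D\<close>. Since
    \<open>u\<close> itself lies in \<open>I\<close>, the number \<open>2 * D\<close> is in
    \<open>H\<close>, whence \<open>h\<close> divides it.\<close>
  define H where "H = {h::int. \<exists>a. \<phi> a (of_int h / (2 * P)) \<in> I}"
  have Hdiff: "x - y \<in> H" if xy: "x \<in> H" "y \<in> H" for x y
  proof -
    obtain a b where "\<phi> a (of_int x / (2 * P)) \<in> I" "\<phi> b (of_int y / (2 * P)) \<in> I"
      using xy by (auto simp: H_def)
    from module_diff[OF I(1) this] have "\<phi> (a - b) (of_int (x - y) / (2 * P)) \<in> I"
      by (simp add: diff diff_divide_distrib)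
    thus ?thesis unfolding H_def by blast
  qed
  have "\<phi> 0 (of_int (2 * int D) / (2 * P)) = u * 1" using P0 by (simp add: P_def \<phi>)
  moreover have "u * 1 \<in> I" using Z[of 1] by (intro module_mult[OF I(1) u(1)]) simp
  ultimately have HD: "2 * int D \<in> H" unfolding H_def by (metis (mono_tags) mem_Collect_eq)
  obtain h where h: "h > 0" "h \<in> H" "\<And>x. x \<in> H \<longleftrightarrow> h dvd x"
    using int_subgroup_cyclic[OF Hdiff HD] u by auto
  obtain a0 where x0: "\<phi> a0 (of_int h / (2 * P)) \<in> I" using h(2) by (auto simp: H_def)
  obtain g where "2 * a0 = of_int g" using h2[OF x0] by (auto elim: Ints_cases)
  hence g: "a0 = of_int g / 2" by simp
  have "\<exists>i k. a = of_int i + of_int k * a0 \<and> b = of_int k * (of_int h / (2 * P))"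
    if ab: "\<phi> a b \<in> I" for a b
  proof -
    obtain l where l: "2 * P * b = of_int l" using h2p[OF ab] by (auto elim: Ints_cases)
    hence b: "b = of_int l / (2 * P)" using P0 by (simp add: field_simps)
    hence "l \<in> H" using ab by (auto simp: H_def)
    then obtain k where k: "l = h * k" using h(3) by (auto elim: dvdE)
    have "\<phi> a b - of_int k * \<phi> a0 (of_int h / (2 * P)) \<in> I"
      by (intro module_diff[OF I(1)] module_int[OF I(1)] ab x0)
    moreover have "\<phi> a b - of_int k * \<phi> a0 (of_int h / (2 * P)) = of_rat (a - of_int k * a0)"
      unfolding b k by (simp add: \<phi> of_rat_diff of_rat_mult of_rat_divide algebra_simps)
    ultimately have "a - of_int k * a0 \<in> \<int>" using Z by simp
    then obtain i where "a - of_int k * a0 = of_int i" by (auto elim: Ints_cases)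
    hence "a = of_int i + of_int k * a0" by simp
    moreover have "b = of_int k * (of_int h / (2 * P))" by (simp add: b k mult.commute)
    ultimately show ?thesis by blast
  qed
  thus ?thesis using that[of h g] h HD x0 unfolding g P_def by blast
qed

text \<open>Stability under \<open>s\<close> forces \<open>g0\<close> and \<open>h0\<close> to have
  the same parity, and \<open>h0\<close> divides \<open>2 * p\<close>. In Q(s) the lattices spanned
  by 1 and the four values of \<open>y\<close> are the unit ideal, the inverse of
  \<open>(s)\<close>, the inverse of the prime above 2, and the product of these two
  inverses.\<close>

lemma k1_part_generator:
  assumes I: "module I" "invariant I" and Z: "\<And>z. of_rat z \<in> I \<longleftrightarrow> z \<in> \<int>"
  obtains y where "y \<in> I" "\<And>a b. el a b 0 0 \<in> I \<Longrightarrow> \<exists>i k. el a b 0 0 = of_int i + of_int k * y"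
    "y \<in> {el 0 1 0 0, el 0 (1 / of_nat p) 0 0, el (1/2) (1/2) 0 0, el (1/2) (1 / (2 * of_nat p)) 0 0}"
proof -
  define P :: rat where "P = of_nat p"
  have P0: "P > 0" using pos by (simp add: P_def)
  have \<phi>: "el a b 0 0 = of_rat a + of_rat b * s" "conj (- 1) 1 (el a b 0 0) = el a (- b) 0 0" for a b
    by (simp add: el_def) (simp add: conj_el)
  obtain g0 h0 :: int where h0: "h0 > 0" "h0 dvd 2 * int p" and x0: "el (of_int g0 / 2) (of_int h0 / (2 * P)) 0 0 \<in> I"
    and gen: "\<And>a b. el a b 0 0 \<in> I \<Longrightarrow>
      \<exists>i k. a = of_int i + of_int k * (of_int g0 / 2) \<and> b = of_int k * (of_int h0 / (2 * P))"
    by (rule rational_quadratic_generator[OF I Z \<phi>(1) OK_basic(1) s_sq pos(1) _ \<phi>(2), folded P_def])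
      (simp, rule that, assumption+)
  have "el (P * (of_int h0 / (2 * P))) (of_int g0 / 2) 0 0 \<in> I"
    using module_mult[OF I(1) OK_basic(1) x0] by (simp add: el_basic(1) el_mult P_def)
  then obtain i k where ik: "P * (of_int h0 / (2 * P)) = of_int i + of_int k * (of_int g0 / 2)"
      "of_int g0 / 2 = of_int k * (of_int h0 / (2 * P))"
    using gen by blast
  have "2 * P * (of_int g0 / 2) = 2 * P * (of_int k * (of_int h0 / (2 * P)))" unfolding ik(2) ..
  hence "of_int (int p * g0) = (of_int (k * h0) :: rat)" using P0 by (simp add: P_def)
  hence pg: "int p * g0 = k * h0" by (simp only: of_int_eq_iff)
  have "P * (of_int h0 / (2 * P)) = of_int h0 / 2" using P0 by simp
  hence "of_int h0 = (of_int (2 * i + k * g0) :: rat)" using ik(1) by (simp add: add_divide_distrib)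
  hence hi: "h0 = 2 * i + k * g0" by (simp only: of_int_eq_iff)
  note result = that
  \<comment> \<open>Only the class of \<open>g0 / 2\<close> modulo Z matters, because Z lies in
    \<open>I\<close>; it is brought to 0 or 1/2.\<close>
  have concl: thesis
    if c: "of_int g0 / 2 = c + of_int m" "el c (of_int h0 / (2 * P)) 0 0 \<in>
      {el 0 1 0 0, el 0 (1 / P) 0 0, el (1/2) (1/2) 0 0, el (1/2) (1 / (2 * P)) 0 0}" for c and m :: int
  proof (rule result[of "el c (of_int h0 / (2 * P)) 0 0"])
    have "el c (of_int h0 / (2 * P)) 0 0 = el (of_int g0 / 2) (of_int h0 / (2 * P)) 0 0 - of_int m"
      by (simp add: el_basic(4) el_diff c(1))
    moreover have "of_int m \<in> I" using Z[of "of_int m"] by simp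
    ultimately show "el c (of_int h0 / (2 * P)) 0 0 \<in> I" using module_diff[OF I(1) x0] by simp
    fix a b assume "el a b 0 0 \<in> I"
    then obtain i k where "a = of_int i + of_int k * (of_int g0 / 2)" "b = of_int k * (of_int h0 / (2 * P))"
      using gen by blast
    hence "el a b 0 0 = of_int (i + k * m) + of_int k * el c (of_int h0 / (2 * P)) 0 0"
      unfolding el_scale el_basic(4)[of "i + k * m"] el_add c(1) by (simp add: algebra_simps)
    thus "\<exists>i k. el a b 0 0 = of_int i + of_int k * el c (of_int h0 / (2 * P)) 0 0" by blast
  qed (use c(2) in \<open>simp add: P_def\<close>)
  have pp: "Factorial_Ring.prime (2::int)" "Factorial_Ring.prime (int p)" using p by simp_all
  have cases: "h0 \<in> {1, 2, int p, 2 * int p}" using dvd_prime_mult_cases[OF pp h0(2,1)] .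
  show ?thesis
  proof (cases "even h0")
    case True
    hence h: "h0 = 2 \<or> h0 = 2 * int p" using cases p_odd by auto
    have "even (int p * g0)" using pg True by simp
    hence "even g0" using p_odd by simp
    then obtain m where "g0 = 2 * m" by (elim evenE)
    hence "of_int g0 / 2 = 0 + (of_int m :: rat)" by simp
    moreover have "of_int h0 / (2 * P) = 1 / P \<or> of_int h0 / (2 * P) = 1" using h P0 by (auto simp: P_def)
    ultimately show ?thesis by (intro concl[of 0 m]) (simp_all only:, elim disjE, simp_all only: insert_iff simp_thms)
  next
    case False
    hence h: "h0 = 1 \<or> h0 = int p" using cases by auto
    have "odd g0" using hi False by auto
    then obtain m where "g0 = 2 * m + 1" by (elim oddE)
    hence "of_int g0 / 2 = 1/2 + (of_int m :: rat)" by simp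
    moreover have "of_int h0 / (2 * P) = 1 / (2 * P) \<or> of_int h0 / (2 * P) = 1/2" using h P0 by (auto simp: P_def)
    ultimately show ?thesis by (intro concl[of "1/2" m]) (simp_all only:, elim disjE, simp_all only: insert_iff simp_thms)
  qed
qed

text \<open>In each of the four cases an explicit \<open>\<alpha>\<close> generates the part in Q(s)
  and its inverse \<open>\<alpha>'\<close> is integral. The bound on the denominator of
  \<open>\<alpha>\<close> by \<open>2 * p\<close> is recorded because it is coprime to the
  denominator that comes from Q(t).\<close>

lemma k1_part_principal:
  assumes I: "module I" "invariant I" and Z: "\<And>z. of_rat z \<in> I \<longleftrightarrow> z \<in> \<int>"
  obtains \<alpha> \<alpha>' where "\<alpha> \<in> I" "\<alpha>' \<in> OK" "\<alpha> * \<alpha>' = 1" "2 * of_nat p * \<alpha> \<in> OK"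
    "\<And>a b. el a b 0 0 \<in> I \<Longrightarrow> el a b 0 0 * \<alpha>' \<in> OK"
proof -
  obtain y where y: "y \<in> I" "\<And>a b. el a b 0 0 \<in> I \<Longrightarrow> \<exists>i k. el a b 0 0 = of_int i + of_int k * y"
    "y \<in> {el 0 1 0 0, el 0 (1 / of_nat p) 0 0, el (1/2) (1/2) 0 0, el (1/2) (1 / (2 * of_nat p)) 0 0}"
    using k1_part_generator[OF I Z] by metis
  have one: "1 \<in> I" using Z[of 1] by simp
  have OKI: "x \<in> I" if "x \<in> OK" for x using module_mult[OF I(1) that one] by simp
  note result = that
  have concl: thesis if a: "\<alpha> \<in> I" "\<alpha>' \<in> OK" "\<alpha> * \<alpha>' = 1" "2 * of_nat p * \<alpha> \<in> OK" "y * \<alpha>' \<in> OK" for \<alpha> \<alpha>'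
  proof (rule result[OF a(1-4)])
    fix a b assume "el a b 0 0 \<in> I"
    then obtain i k where "el a b 0 0 = of_int i + of_int k * y" using y(2) by blast
    hence "el a b 0 0 * \<alpha>' = of_int i * \<alpha>' + of_int k * (y * \<alpha>')" by (simp add: algebra_simps)
    thus "el a b 0 0 * \<alpha>' \<in> OK" using a by (simp add: OK_closed)
  qed
  obtain u v :: int where uv: "u\<^sup>2 - int p * v\<^sup>2 = 2 \<or> u\<^sup>2 - int p * v\<^sup>2 = - 2" "odd u" "odd v"
    using norm_two_exists[OF p] .
  \<comment> \<open>The sign that makes the norm of \<open>u + v * s\<close> equal to 2 after
    multiplication.\<close>
  define \<eta> :: int where "\<eta> = (if u\<^sup>2 - int p * v\<^sup>2 = 2 then 1 else - 1)"
  have eta: "\<eta> * (u\<^sup>2 - int p * v\<^sup>2) = 2" using uv by (auto simp: \<eta>_def)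
  hence "of_int (\<eta> * (u\<^sup>2 - int p * v\<^sup>2)) = (2::rat)" by (simp only: of_int_numeral)
  hence etar: "of_int \<eta> * (of_int u * of_int u - of_nat p * (of_int v * of_int v)) = (2::rat)"
    by (simp add: power2_eq_square)
  have p0: "of_nat p \<noteq> (0::rat)" "of_nat p \<noteq> (0::complex)" using pos by auto
  have twop: "2 * of_nat p * el a b 0 0 = el (2 * of_nat p * a) (2 * of_nat p * b) 0 0" for a b
    using el_scale[of "2 * int p" a b 0 0] by simp
  from y(3) consider "y = el 0 1 0 0" | "y = el 0 (1 / of_nat p) 0 0" | "y = el (1/2) (1/2) 0 0"
    | "y = el (1/2) (1 / (2 * of_nat p)) 0 0" by blast
  thus thesis
  proof cases
    case 1
    show thesis
    proof (rule concl[of 1 1])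
      show "1 \<in> I" by (rule one)
      have "of_nat (2 * p) \<in> OK" by (rule OK_basic)
      thus "2 * of_nat p * 1 \<in> OK" by simp
      show "y * 1 \<in> OK" using 1 el_basic(1) OK_basic(1) by simp
    qed auto
  next
    case 2
    show thesis
    proof (rule concl[of y s])
      show "y * s = 1" "y * s \<in> OK" using p0 by (simp_all add: 2 el_basic(1) el_mult el_basic(6)[symmetric])
      show "2 * of_nat p * y \<in> OK" unfolding 2 twop using p0 by (intro el_OK') auto
    qed (auto intro: y)
  next
    case 3
    \<comment> \<open>Half of the element of norm 2 or -2; up to sign it is the inverse of the
      conjugate \<open>u - v * s\<close>, which generates the prime above 2.\<close>
    define \<alpha> where "\<alpha> = el (of_int u / 2) (of_int v / 2) 0 0"
    define \<alpha>' where "\<alpha>' = el (of_int (\<eta> * u)) (of_int (- \<eta> * v)) 0 0"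
    have "even (u - v)" using uv by simp
    then obtain m where m: "u - v = 2 * m" by (elim evenE)
    have "u = 2 * m + v" using m by simp
    hence "\<alpha> = of_int m + of_int v * y"
      unfolding \<alpha>_def 3 el_scale el_basic(4)[of m] el_add by (simp add: add_divide_distrib)
    hence 1: "\<alpha> \<in> I" using module_add[OF I(1) OKI[OF OK_basic(3)] module_int[OF I(1) y(1)]] by simp
    have 2: "\<alpha>' \<in> OK" unfolding \<alpha>'_def by (intro el_OK') auto
    have 4: "\<alpha> * \<alpha>' = 1"
      using etar unfolding \<alpha>_def \<alpha>'_def el_mult el_basic(6) el_eq_iff by (simp add: algebra_simps)
    have 5: "2 * of_nat p * \<alpha> \<in> OK" unfolding \<alpha>_def twop by (intro el_OK') auto
    have "y * \<alpha>' = el (of_int (\<eta> * (u - int p * v)) / 2) (of_int (\<eta> * (u - v)) / 2) 0 0"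
      unfolding 3 \<alpha>'_def el_mult el_eq_iff by (simp add: field_simps)
    moreover have "even (\<eta> * (u - int p * v))" "even (\<eta> * (u - v))" using uv p_odd by simp_all
    ultimately have "y * \<alpha>' \<in> OK" by (simp only:) (intro el_OK' half_Ints, auto)
    thus thesis using concl[OF 1 2 4 5] by blast
  next
    case 4
    \<comment> \<open>The generator of the previous case divided by \<open>s\<close>, written with
      \<open>1 / s = s / p\<close>.\<close>
    define \<alpha> where "\<alpha> = el (of_int v / 2) (of_int u / (2 * of_nat p)) 0 0"
    define \<alpha>' where "\<alpha>' = el (of_int (- \<eta> * int p * v)) (of_int (\<eta> * u)) 0 0"
    have "even (v - u)" using uv by simp
    then obtain m where m: "v - u = 2 * m" by (elim evenE)
    have "v = 2 * m + u" using m by simp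
    hence "\<alpha> = of_int m + of_int u * y"
      unfolding \<alpha>_def 4 el_scale el_basic(4)[of m] el_add by (simp add: add_divide_distrib)
    hence 1: "\<alpha> \<in> I" using module_add[OF I(1) OKI[OF OK_basic(3)] module_int[OF I(1) y(1)]] by simp
    have 2: "\<alpha>' \<in> OK" unfolding \<alpha>'_def by (intro el_OK') auto
    have 3: "\<alpha> * \<alpha>' = 1"
      using etar p0 unfolding \<alpha>_def \<alpha>'_def el_mult el_basic(6) el_eq_iff by (simp add: field_simps)
    have 5: "2 * of_nat p * \<alpha> \<in> OK" unfolding \<alpha>_def twop using p0 by (intro el_OK') auto
    have "y * \<alpha>' = el (of_int (\<eta> * (u - int p * v)) / 2) (of_int (\<eta> * (u - v)) / 2) 0 0"
      unfolding 4 \<alpha>'_def el_mult el_eq_iff using p0 by (simp add: field_simps)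
    moreover have "even (\<eta> * (u - int p * v))" "even (\<eta> * (u - v))" using uv p_odd by simp_all
    ultimately have "y * \<alpha>' \<in> OK" by (simp only:) (intro el_OK' half_Ints, auto)
    thus thesis using concl[OF 1 2 3 5] by blast
  qed
qed

text \<open>With \<open>q = 2 * m + 1\<close> the element is \<open>q * \<omega> - m * t\<close>. It
  is the image of the second lattice generator when an ideal is compared with
  \<open>QI\<close>.\<close>

lemma half_q_plus_t_in_QI: "el (of_nat q / 2) 0 (1/2) 0 \<in> QI"
proof -
  obtain m where m: "int q = 2 * m + 1" using q_odd by (metis even_of_nat oddE)
  have "of_nat q * \<omega> + t * of_int (- m) \<in> QI" by (rule QI_I[OF omega_OK OK_basic(3)])
  moreover have "of_nat q * \<omega> + t * of_int (- m) = el (of_nat q / 2) 0 (1/2) 0"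
  proof -
    have "of_nat q = (of_int (2 * m + 1) :: rat)" using m by (metis of_int_of_nat_eq)
    hence "of_nat q / 2 - of_int m = (1/2 :: rat)" by simp
    moreover have "of_nat q * \<omega> + t * of_int (- m) = el (of_nat q / 2) 0 (of_nat q / 2 - of_int m) 0"
      unfolding omega_el el_basic(2) el_basic(4)[of "- m"] el_basic(5)[of q] el_mult el_add el_eq_iff by simp
    ultimately show ?thesis by (simp only:)
  qed
  ultimately show ?thesis by (simp only:)
qed

text \<open>Since 1 lies in \<open>I\<close>, so does \<open>\<omega>\<close>. Expressing
  \<open>\<omega>\<close> by the generator forces \<open>g0\<close> to be odd and \<open>h0\<close>
  to divide \<open>q * r\<close>.\<close>

lemma k2_part_generator:
  assumes I: "module I" "invariant I" and Z: "\<And>z. of_rat z \<in> I \<longleftrightarrow> z \<in> \<int>"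
  obtains y and h0 :: int where "y \<in> I" "\<And>a c. el a 0 c 0 \<in> I \<Longrightarrow> \<exists>i k. el a 0 c 0 = of_int i + of_int k * y"
    "y = el (1/2) 0 (of_int h0 / (2 * (of_nat q * of_nat r))) 0" "h0 \<in> {1, int q, int r, int q * int r}"
proof -
  define P :: rat where "P = of_nat (q * r)"
  have P0: "P > 0" using pos by (simp add: P_def)
  have \<phi>: "el a 0 c 0 = of_rat a + of_rat c * t" "t * t = of_nat (q * r)"
    "conj 1 (- 1) (el a 0 c 0) = el a 0 (- c) 0" for a c
    by (simp add: el_def) (simp_all add: t_sq conj_el)
  obtain g0 h0 :: int where h0: "h0 > 0" and x0: "el (of_int g0 / 2) 0 (of_int h0 / (2 * P)) 0 \<in> I"
    and gen: "\<And>a c. el a 0 c 0 \<in> I \<Longrightarrow>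
      \<exists>i k. a = of_int i + of_int k * (of_int g0 / 2) \<and> c = of_int k * (of_int h0 / (2 * P))"
    by (rule rational_quadratic_generator[OF I Z \<phi>(1) OK_basic(2) \<phi>(2) _ _ \<phi>(3), folded P_def])
      (simp add: pos, simp, rule that, assumption+)
  have "\<omega> * 1 \<in> I" using Z[of 1] by (intro module_mult[OF I(1) omega_OK]) simp
  hence "el (1/2) 0 (1/2) 0 \<in> I" by (simp add: omega_el)
  then obtain i k where ik: "(1::rat)/2 = of_int i + of_int k * (of_int g0 / 2)" "1/2 = of_int k * (of_int h0 / (2 * P))"
    using gen by blast
  have "2 * (1 / 2 :: rat) = 2 * (of_int i + of_int k * (of_int g0 / 2))" unfolding ik(1)[symmetric] ..
  hence "of_int 1 = (of_int (2 * i + k * g0) :: rat)" by (simp add: distrib_left)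
  hence "1 = 2 * i + k * g0" by (simp only: of_int_eq_iff)
  hence "odd g0" by (metis even_add even_mult_iff even_numeral odd_one dvd_triv_left)
  then obtain m where m: "g0 = 2 * m + 1" by (elim oddE)
  have "2 * P * (1 / 2) = 2 * P * (of_int k * (of_int h0 / (2 * P)))" unfolding ik(2)[symmetric] ..
  also have "\<dots> = of_int k * of_int h0" using P0 by simp
  finally have "of_int (int q * int r) = (of_int (h0 * k) :: rat)" by (simp add: P_def mult.commute)
  hence "int q * int r = h0 * k" by (simp only: of_int_eq_iff)
  hence "h0 dvd int q * int r" by simp
  hence "h0 \<in> {1, int q, int r, int q * int r}"
    using dvd_prime_mult_cases[of "int q" "int r" h0] h0 q r by simp
  moreover define y where "y = el (1/2) 0 (of_int h0 / (2 * P)) 0"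
  have "y = el (of_int g0 / 2) 0 (of_int h0 / (2 * P)) 0 - of_int m"
    by (simp add: y_def el_basic(4) el_diff m add_divide_distrib)
  hence "y \<in> I" using module_diff[OF I(1) x0, of "of_int m"] Z[of "of_int m"] by simp
  moreover have "\<exists>i k. el a 0 c 0 = of_int i + of_int k * y" if ac: "el a 0 c 0 \<in> I" for a c
  proof -
    obtain i k where "a = of_int i + of_int k * (of_int g0 / 2)" "c = of_int k * (of_int h0 / (2 * P))"
      using gen[OF ac] by blast
    hence "el a 0 c 0 = of_int (i + k * m) + of_int k * y"
      unfolding y_def el_scale el_basic(4)[of "i + k * m"] el_add by (simp add: m add_divide_distrib algebra_simps)
    thus ?thesis by blast
  qed
  ultimately show ?thesis using that[of y h0] y_def by (simp add: P_def)
qed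

text \<open>The values \<open>q * r\<close>, 1, \<open>r\<close>, \<open>q\<close> of
  \<open>h0\<close> belong to the unit ideal, its quotient by \<open>t\<close>, \<open>QI\<close>
  divided by \<open>q\<close>, and \<open>QI\<close> divided by \<open>t\<close>. The last one is
  the inverse of the ideal above \<open>r\<close>, because the ideals above \<open>q\<close> and
  \<open>r\<close> multiply to \<open>(t)\<close>.\<close>

lemma k2_part_cases:
  assumes I: "module I" "invariant I" and Z: "\<And>z. of_rat z \<in> I \<longleftrightarrow> z \<in> \<int>"
  obtains \<beta> T where "(T = OK \<and> \<beta> \<in> {1, inverse t}) \<or> (T = QI \<and> \<beta> \<in> {inverse (of_nat q), inverse t})"
    "\<And>x. x \<in> T \<Longrightarrow> \<beta> * x \<in> I" "\<And>x. x \<in> T \<Longrightarrow> of_nat (q * r) * (\<beta> * x) \<in> OK"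
    "\<And>a c. el a 0 c 0 \<in> I \<Longrightarrow> \<exists>x\<in>T. el a 0 c 0 = \<beta> * x"
proof -
  obtain y h0 where y: "y \<in> I" "\<And>a c. el a 0 c 0 \<in> I \<Longrightarrow> \<exists>i k. el a 0 c 0 = of_int i + of_int k * y"
    "y = el (1/2) 0 (of_int h0 / (2 * (of_nat q * of_nat r))) 0" "h0 \<in> {1, int q, int r, int q * int r}"
    using k2_part_generator[OF I Z] by metis
  note result = that
  have one: "1 \<in> I" using Z[of 1] by simp
  have OKI: "x \<in> I" if "x \<in> OK" for x using module_mult[OF I(1) that one] by simp
  \<comment> \<open>It is enough that multiplication by \<open>\<beta>'\<close>, the inverse of
    \<open>\<beta>\<close>, sends the two lattice generators 1 and \<open>y\<close> into
    \<open>T\<close>.\<close>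
  have ev: "\<exists>x\<in>T. el a 0 c 0 = \<beta> * x"
    if T: "module T" and b: "\<beta> * \<beta>' = 1" "\<beta>' \<in> T" "y * \<beta>' \<in> T" and e: "el a 0 c 0 \<in> I" for T \<beta> \<beta>' a c
  proof -
    obtain i k where ik: "el a 0 c 0 = of_int i + of_int k * y" using y(2)[OF e] by blast
    have "of_int i * \<beta>' + of_int k * (y * \<beta>') \<in> T"
      by (intro module_add[OF T] module_int[OF T] b)
    moreover have "el a 0 c 0 = (\<beta> * \<beta>') * el a 0 c 0" using b(1) by simp
    hence "el a 0 c 0 = \<beta> * (of_int i * \<beta>' + of_int k * (y * \<beta>'))" unfolding ik by (simp add: algebra_simps)
    ultimately show ?thesis by blast
  qed
  have q0: "of_nat q \<noteq> (0::complex)" "of_nat r \<noteq> (0::complex)" "of_nat q \<noteq> (0::rat)" "of_nat r \<noteq> (0::rat)"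
    using pos by auto
  have ti: "t * inverse t = 1" "inverse t * t = 1" "of_nat q * of_nat r * inverse t = t"
    using t_nz t_sq[symmetric] by simp_all
  have it: "inverse t = el 0 0 (1 / (of_nat q * of_nat r)) 0"
  proof (rule inverse_unique)
    show "t * el 0 0 (1 / (of_nat q * of_nat r)) 0 = 1"
      using q0 by (simp add: el_basic(2) el_mult el_basic(6)[symmetric])
  qed
  have y21: "2 * y - 1 = el 0 0 (of_int h0 / (of_nat q * of_nat r)) 0"
    using el_scale[of 2 "1/2" 0 "of_int h0 / (2 * (of_nat q * of_nat r))" 0]
    by (simp add: y(3) el_basic(6) el_diff)
  have y21I: "2 * y - 1 \<in> I" using module_diff[OF I(1) module_int[OF I(1) y(1), of 2] one] by simp
  have yt: "y * t = el (of_int h0 / 2) 0 (1/2) 0"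
    using q0 by (simp add: y(3) el_basic(2) el_mult)
  have QIgen: "\<beta> * x \<in> I" if x: "x \<in> QI" and b: "\<beta> * of_nat q \<in> I" "\<beta> * t \<in> I" for x \<beta>
  proof -
    obtain a c where ac: "a \<in> OK" "c \<in> OK" "x = of_nat q * a + t * c" using x by (auto simp: QI_def)
    have "a * (\<beta> * of_nat q) + c * (\<beta> * t) \<in> I"
      by (intro module_add[OF I(1)] module_mult[OF I(1)] ac b)
    thus ?thesis by (simp add: ac(3) algebra_simps)
  qed
  from y(4) consider "h0 = int q * int r" | "h0 = 1" | "h0 = int r" | "h0 = int q" by blast
  thus thesis
  proof cases
    case 1
    hence "y = \<omega>" using q0 by (simp add: y(3) omega_el)
    hence yO: "y * 1 \<in> OK" by simp
    show thesis
    proof (rule result[of OK 1])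
      show "\<exists>x\<in>OK. el a 0 c 0 = 1 * x" if "el a 0 c 0 \<in> I" for a c
        by (rule ev[OF module_OK _ _ yO that]) auto
      show "of_nat (q * r) * (1 * x) \<in> OK" if "x \<in> OK" for x
        unfolding mult_1_left by (intro OK_closed that OK_basic)
    qed (auto simp: OKI)
  next
    case 2
    have yO: "y * t \<in> OK" using omega_OK by (simp add: yt 2 omega_el)
    have "inverse t \<in> I" using y21I unfolding y21 it by (simp add: 2)
    show thesis
    proof (rule result[of OK "inverse t"])
      show "\<exists>x\<in>OK. el a 0 c 0 = inverse t * x" if "el a 0 c 0 \<in> I" for a c
        by (rule ev[OF module_OK ti(2) _ yO that]) auto
      show "inverse t * x \<in> I" if "x \<in> OK" for x
        using module_mult[OF I(1) that \<open>inverse t \<in> I\<close>] by (simp add: mult.commute)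
      show "of_nat (q * r) * (inverse t * x) \<in> OK" if "x \<in> OK" for x
        using ti(3) that by (simp add: OK_closed flip: mult.assoc)
    qed auto
  next
    case 3
    have yq: "y * of_nat q = el (of_nat q / 2) 0 (1/2) 0"
      using q0 by (simp add: y(3) el_basic(5) el_mult 3)
    have tq: "2 * y - 1 = inverse (of_nat q) * t"
    proof -
      have "of_nat q * (2 * y - 1) = t" unfolding y21 3 using q0 by (simp add: el_basic el_mult)
      thus ?thesis using q0 by (metis mult.assoc left_inverse mult_1_left)
    qed
    show thesis
    proof (rule result[of QI "inverse (of_nat q)"])
      show "\<exists>x\<in>QI. el a 0 c 0 = inverse (of_nat q) * x" if "el a 0 c 0 \<in> I" for a c
        by (rule ev[OF module_QI _ q_in_QI _ that]) (use q0 yq half_q_plus_t_in_QI in auto)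
      show "inverse (of_nat q) * x \<in> I" if "x \<in> QI" for x
        by (rule QIgen[OF that]) (use q0 one y21I tq in auto)
      show "of_nat (q * r) * (inverse (of_nat q) * x) \<in> OK" if "x \<in> QI" for x
      proof -
        have "of_nat (q * r) * (inverse (of_nat q) * x) = of_nat r * x" using q0 by (simp add: field_simps)
        moreover have "of_nat r * x \<in> OK" by (intro OK_closed QI_subset_OK that OK_basic)
        ultimately show ?thesis by (simp only:)
      qed
    qed auto
  next
    case 4
    have yq: "y * t = el (of_nat q / 2) 0 (1/2) 0" by (simp add: yt 4)
    have tq: "2 * y - 1 = inverse t * of_nat q" unfolding y21 4 it by (simp add: el_basic(5) el_mult)
    show thesis
    proof (rule result[of QI "inverse t"])
      show "\<exists>x\<in>QI. el a 0 c 0 = inverse t * x" if "el a 0 c 0 \<in> I" for a c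
        by (rule ev[OF module_QI ti(2) t_in_QI _ that]) (use yq half_q_plus_t_in_QI in auto)
      show "inverse t * x \<in> I" if "x \<in> QI" for x
        by (rule QIgen[OF that]) (use ti one y21I tq in auto)
      show "of_nat (q * r) * (inverse t * x) \<in> OK" if "x \<in> QI" for x
        using ti(3) QI_subset_OK[OF that] by (simp add: OK_closed flip: mult.assoc)
    qed auto
  qed
qed

lemma inverse_KE_basic: "inverse t \<in> KE" "inverse (of_nat q) \<in> KE" "(1::complex) \<in> KE"
  by (auto intro: KE_inverse)

text \<open>Both inclusions are checked after multiplication by \<open>2 * p\<close> and by
  \<open>q * r\<close>: the former clears \<open>\<alpha>\<close>, the latter
  \<open>\<beta>\<close>. Conversely, traces to Q(s) recover \<open>q * r * x\<close> and traces to
  Q(t) recover \<open>2 * p * x\<close> from parts of \<open>I\<close> already known.\<close>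

lemma normalized_invariant_ideal:
  assumes I: "module I" "invariant I" and Z: "\<And>z. of_rat z \<in> I \<longleftrightarrow> z \<in> \<int>"
  obtains \<alpha> \<alpha>' \<beta> T where "\<alpha> \<in> KE" "\<alpha>' \<in> OK" "\<alpha> * \<alpha>' = 1" "2 * of_nat p * \<alpha> \<in> OK"
    "(T = OK \<and> \<beta> \<in> {1, inverse t}) \<or> (T = QI \<and> \<beta> \<in> {inverse (of_nat q), inverse t})"
    "I = (\<lambda>x. \<alpha> * \<beta> * x) ` T"
proof -
  obtain \<alpha> \<alpha>' where A: "\<alpha> \<in> I" "\<alpha>' \<in> OK" "\<alpha> * \<alpha>' = 1" "2 * of_nat p * \<alpha> \<in> OK"
    "\<And>a b. el a b 0 0 \<in> I \<Longrightarrow> el a b 0 0 * \<alpha>' \<in> OK"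
    using k1_part_principal[OF I Z] by metis
  obtain \<beta> T where B: "(T = OK \<and> \<beta> \<in> {1, inverse t}) \<or> (T = QI \<and> \<beta> \<in> {inverse (of_nat q), inverse t})"
    "\<And>x. x \<in> T \<Longrightarrow> \<beta> * x \<in> I" "\<And>x. x \<in> T \<Longrightarrow> of_nat (q * r) * (\<beta> * x) \<in> OK"
    "\<And>a c. el a 0 c 0 \<in> I \<Longrightarrow> \<exists>x\<in>T. el a 0 c 0 = \<beta> * x"
    by (rule k2_part_cases[OF I Z]) (rule that, assumption+)
  have T: "module T" using B(1) module_OK module_QI by auto
  have aK: "\<alpha> \<in> KE" using A(1) module_KE[OF I(1)] by blast
  have bK: "\<beta> \<in> KE" using B(1) inverse_KE_basic by auto
  have one: "1 \<in> I" using Z[of 1] by simp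
  have cop: "coprime (2 * int p) (int q * int r)"
  proof -
    have "coprime (int p) (int q)" by (rule primes_coprime) (use p q pq in simp_all)
    moreover have "coprime (int p) (int r)" by (rule primes_coprime) (use p r pr in simp_all)
    moreover have "odd (int q * int r)" using q_odd r_odd by simp
    hence "coprime 2 (int q * int r)" by (subst coprime_left_2_iff_odd)
    ultimately show ?thesis by (simp only: coprime_mult_left_iff coprime_mult_right_iff)
  qed
  define M where "M = (\<lambda>x. \<alpha> * \<beta> * x) ` T"
  have M: "module M" unfolding M_def using T aK bK by (intro module_scale KE_closed)
  have "M \<subseteq> I"
  proof
    fix z assume "z \<in> M"
    then obtain x where x: "x \<in> T" "z = \<alpha> * (\<beta> * x)" by (auto simp: M_def mult.assoc)
    have "of_int (2 * int p) * z = (2 * of_nat p * \<alpha>) * (\<beta> * x)" by (simp add: x(2) mult_ac)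
    hence 1: "of_int (2 * int p) * z \<in> I" using module_mult[OF I(1) A(4) B(2)[OF x(1)]] by (simp only:)
    have "of_int (int q * int r) * z = (of_nat (q * r) * (\<beta> * x)) * \<alpha>" by (simp add: x(2) mult_ac)
    hence 2: "of_int (int q * int r) * z \<in> I" using module_mult[OF I(1) B(3)[OF x(1)] A(1)] by (simp only:)
    show "z \<in> I" by (rule module_coprime[OF I(1) 1 2 cop])
  qed
  moreover have "I \<subseteq> M"
  proof
    fix x assume x: "x \<in> I"
    obtain a b c d where xe: "x = el a b c d" using module_KE[OF I(1) x] by (rule KE_cases)
    have sg: "z + conj 1 (-1) z \<in> I" "z + conj (-1) 1 z \<in> I" if "z \<in> I" for z
      using that module_add[OF I(1)] invariantD[OF I(2)] by auto
    have "of_int (int q * int r) * x \<in> M"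
    proof -
      have e1: "el (2 * a) (2 * b) 0 0 \<in> I"
        using sg(1)[OF x] by (simp add: xe conj_el el_add)
      have "t * x \<in> I" by (intro module_mult[OF I(1)] x) simp
      from sg(1)[OF this] have e2: "el (2 * of_nat (q * r) * c) (2 * of_nat (q * r) * d) 0 0 \<in> I"
        by (simp add: xe el_basic(2) el_mult conj_el el_add algebra_simps)
      have "\<omega> * x \<in> I" by (intro module_mult[OF I(1)] x) simp
      from sg(1)[OF this] have e3: "el (a + of_nat (q * r) * c) (b + of_nat (q * r) * d) 0 0 \<in> I"
        by (simp add: xe omega_el el_mult conj_el el_add algebra_simps)
      have "odd (int q * int r)" using q_odd r_odd by simp
      then obtain n where n: "int q * int r = 2 * n + 1" by (elim oddE)
      define m where "m = n + 1"
      have m: "int q * int r = 2 * m - 1" by (simp add: m_def n)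
      hence mr: "of_nat q * of_nat r = (2 * of_int m - 1 :: rat)"
        by (metis of_int_1 of_int_diff of_int_mult of_int_numeral of_int_of_nat_eq)
      \<comment> \<open>\<open>Y + Z * \<omega>\<close> expands \<open>q * r * x\<close> in the
        basis 1, \<open>\<omega>\<close> over Q(s). The traces of \<open>x\<close> and
        \<open>t * x\<close> alone would leave a factor 2; the trace of \<open>\<omega> * x\<close>,
        with \<open>q * r = 2 * m - 1\<close>, removes it.\<close>
      define Y where "Y = of_int m * el (2 * a) (2 * b) 0 0
        - el (a + of_nat (q * r) * c) (b + of_nat (q * r) * d) 0 0"
      define Z where "Z = el (2 * of_nat (q * r) * c) (2 * of_nat (q * r) * d) 0 0"
      have Ye: "Y = el (of_nat (q * r) * (a - c)) (of_nat (q * r) * (b - d)) 0 0"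
        unfolding Y_def el_scale el_diff by (simp add: mr algebra_simps)
      have YI: "Y \<in> I" unfolding Y_def by (intro module_diff[OF I(1)] module_int[OF I(1)] e1 e3)
      have "Y * \<alpha>' \<in> OK" using A(5) YI unfolding Ye by blast
      moreover have "Z * \<alpha>' \<in> OK" unfolding Z_def by (rule A(5)[OF e2])
      ultimately have w: "Y * \<alpha>' + Z * \<alpha>' * \<omega> \<in> OK"
        by (intro OK_closed(1) OK_closed(4)[OF _ omega_OK])
      have YZ: "of_int (int q * int r) * x = Y + Z * \<omega>"
        unfolding Ye Z_def xe omega_el el_basic(4) el_mult el_add el_eq_iff by (simp add: algebra_simps)
      \<comment> \<open>Since 1 lies in \<open>I\<close>, it lies in \<open>\<beta> * T\<close>;
        inserting it as a factor moves an integral multiple of \<open>\<alpha>\<close> into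
        \<open>M\<close>.\<close>
      obtain \<tau> where tau: "\<tau> \<in> T" "1 = \<beta> * \<tau>" using B(4)[of 1 0] one by (auto simp: el_basic(6))
      have "of_int (int q * int r) * x = (\<alpha> * \<alpha>') * (\<beta> * \<tau>) * (Y + Z * \<omega>)" using YZ A(3) tau(2) by simp
      also have "\<dots> = \<alpha> * \<beta> * ((Y * \<alpha>' + Z * \<alpha>' * \<omega>) * \<tau>)" by (simp add: algebra_simps)
      also have "\<dots> \<in> M" unfolding M_def by (intro imageI module_mult[OF T] w tau)
      finally show ?thesis .
    qed
    moreover have "of_int (2 * int p) * x \<in> M"
    proof -
      have f1: "el (2 * a) 0 (2 * c) 0 \<in> I" using sg(2)[OF x] by (simp add: xe conj_el el_add)
      have "s * x \<in> I" by (intro module_mult[OF I(1)] x) simp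
      from sg(2)[OF this] have f2: "el (2 * of_nat p * b) 0 (2 * of_nat p * d) 0 \<in> I"
        by (simp add: xe el_basic(1) el_mult conj_el el_add algebra_simps)
      obtain x1 where x1: "x1 \<in> T" "el (2 * a) 0 (2 * c) 0 = \<beta> * x1" using B(4)[OF f1] by blast
      obtain x2 where x2: "x2 \<in> T" "el (2 * of_nat p * b) 0 (2 * of_nat p * d) 0 = \<beta> * x2" using B(4)[OF f2] by blast
      \<comment> \<open>The expansion over Q(t) in 1 and \<open>s\<close>, from the traces of
        \<open>x\<close> and of \<open>s * x\<close>.\<close>
      have "of_int (2 * int p) * x = of_nat p * el (2 * a) 0 (2 * c) 0 + el (2 * of_nat p * b) 0 (2 * of_nat p * d) 0 * s"
        unfolding xe el_basic el_mult el_add el_eq_iff by (simp add: algebra_simps)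
      also have "\<dots> = (\<alpha> * \<alpha>') * (of_nat p * (\<beta> * x1) + \<beta> * x2 * s)" using A(3) by (simp add: x1 x2)
      also have "\<dots> = \<alpha> * \<beta> * (\<alpha>' * of_nat p * x1 + \<alpha>' * s * x2)" by (simp add: algebra_simps)
      also have "\<dots> \<in> M" unfolding M_def
        by (intro imageI module_add[OF T] module_mult[OF T] x1 x2 OK_closed A OK_basic)
      finally show ?thesis .
    qed
    ultimately show "x \<in> M" using module_coprime[OF M _ _ cop] by blast
  qed
  ultimately have "I = M" by blast
  thus ?thesis using that[OF aK A(2-4) B(1)] unfolding M_def by blast
qed

text \<open>The ideal is rescaled to meet Q in Z. Replacing \<open>d\<close> by its norm gives an
  integer denominator \<open>n\<close>, so the rational elements form a subgroup of the fractions
  over \<open>n\<close>; the norm of \<open>n * x\<close> is a nonzero integer in the ideal, so this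
  group is cyclic and nonzero, with generator \<open>c\<close>.\<close>

theorem invariant_ideal_cases:
  assumes I: "module I" "invariant I" and x: "x \<in> I" "x \<noteq> 0"
    and d: "d \<in> OK" "d \<noteq> 0" "\<And>x. x \<in> I \<Longrightarrow> d * x \<in> OK"
  obtains c \<alpha> \<alpha>' \<beta> T where "c \<noteq> 0" "\<And>z. of_rat z \<in> I \<longleftrightarrow> z / c \<in> \<int>"
    "\<alpha> \<in> KE" "\<alpha>' \<in> OK" "\<alpha> * \<alpha>' = 1" "2 * of_nat p * \<alpha> \<in> OK"
    "(T = OK \<and> \<beta> \<in> {1, inverse t}) \<or> (T = QI \<and> \<beta> \<in> {inverse (of_nat q), inverse t})"
    "I = (\<lambda>x. of_rat c * \<alpha> * \<beta> * x) ` T"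
proof -
  have cof: "\<exists>z'\<in>OK. nm z = z' * z" if "z \<in> OK" for z
  proof
    show "conj 1 (-1) z * conj (-1) 1 z * conj (-1) (-1) z \<in> OK" using that by (intro OK_closed conj_OK) auto
    show "nm z = conj 1 (-1) z * conj (-1) 1 z * conj (-1) (-1) z * z" by (simp add: nm_def)
  qed
  obtain n where n: "nm d = of_int n" using nm_OK[OF d(1)] .
  have n0: "n \<noteq> 0" using nm_eq_0_iff[OF OK_KE[OF d(1)]] d(2) n by auto
  have nI: "of_int n * z \<in> OK" if "z \<in> I" for z
  proof -
    obtain d' where "d' \<in> OK" "of_int n = d' * d" using cof[OF d(1)] n by metis
    thus ?thesis using OK_closed(4)[OF _ d(3)[OF that]] by (simp add: mult.assoc)
  qed
  define S where "S = {k::int. of_rat (of_int k / of_int n) \<in> I}"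
  have Sdiff: "k - l \<in> S" if kl: "k \<in> S" "l \<in> S" for k l
    using module_diff[OF I(1), of "of_rat (of_int k / of_int n)" "of_rat (of_int l / of_int n)"] kl
    by (simp add: S_def diff_divide_distrib flip: of_rat_diff)
  obtain m where m: "nm (of_int n * x) = of_int m" using nm_OK[OF nI[OF x(1)]] .
  have nxI: "of_int n * x \<in> I" by (rule module_int[OF I(1) x(1)])
  have m0: "m \<noteq> 0" using nm_eq_0_iff[OF module_KE[OF I(1) nxI]] x(2) n0 m by auto
  have mI: "of_int m \<in> I"
  proof -
    obtain z' where "z' \<in> OK" "of_int m = z' * (of_int n * x)" using cof[OF nI[OF x(1)]] m by metis
    thus ?thesis using module_mult[OF I(1) _ nxI] by simp
  qed
  have "m * n \<in> S" using mI n0 by (simp add: S_def)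
  then obtain g where g: "g > 0" "\<And>k. k \<in> S \<longleftrightarrow> g dvd k"
    using int_subgroup_cyclic[OF Sdiff, of "m * n"] m0 n0 by auto
  define c :: rat where "c = of_int g / of_int n"
  have c0: "c \<noteq> 0" using g n0 by (simp add: c_def)
  have Zc: "of_rat z \<in> I \<longleftrightarrow> z / c \<in> \<int>" for z
  proof
    assume z: "of_rat z \<in> I"
    have "of_rat (of_int n * z) \<in> OK" using nI[OF z] by (simp add: of_rat_mult)
    then obtain k where k: "of_int n * z = of_int k" using OK_rational by (auto elim: Ints_cases)
    hence zk: "z = of_int k / of_int n" using n0 by (simp add: field_simps)
    hence "k \<in> S" using z by (simp add: S_def)
    then obtain l where "k = g * l" using g(2) by (auto elim: dvdE)
    hence "z / c = of_int l" using zk g(1) n0 by (simp add: c_def)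
    thus "z / c \<in> \<int>" by simp
  next
    assume "z / c \<in> \<int>"
    then obtain l where l: "z / c = of_int l" by (auto elim: Ints_cases)
    have "g * l \<in> S" using g(2) by simp
    moreover have "z = of_int (g * l) / of_int n" using l c0 n0 by (simp add: c_def field_simps)
    ultimately show "of_rat z \<in> I" by (simp add: S_def)
  qed
  have cc: "of_rat c \<noteq> (0::complex)" using c0 by simp
  define J where "J = (\<lambda>x. of_rat (1 / c) * x) ` I"
  have J: "module J" unfolding J_def by (intro module_scale I KE_basic)
  have Jinv: "invariant J" unfolding invariant_def J_def
  proof (intro allI impI ballI)
    fix e f :: rat and z assume ef: "signs e f" and "z \<in> (\<lambda>x. of_rat (1 / c) * x) ` I"
    then obtain z' where z': "z' \<in> I" "z = of_rat (1 / c) * z'" by blast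
    have "conj e f z = of_rat (1 / c) * conj e f z'"
      unfolding z'(2) using conj_hom(3)[OF ef KE_basic(3) module_KE[OF I(1) z'(1)]] by (simp only: conj_basic)
    thus "conj e f z \<in> (\<lambda>x. of_rat (1 / c) * x) ` I" using invariantD[OF I(2) ef z'(1)] by blast
  qed
  have JI: "z \<in> J \<longleftrightarrow> of_rat c * z \<in> I" for z
  proof
    assume "z \<in> J"
    thus "of_rat c * z \<in> I" using cc by (auto simp: J_def of_rat_divide)
  next
    assume "of_rat c * z \<in> I"
    moreover have "z = of_rat (1 / c) * (of_rat c * z)" using cc by (simp add: of_rat_divide)
    ultimately show "z \<in> J" unfolding J_def by blast
  qed
  have JZ: "of_rat z \<in> J \<longleftrightarrow> z \<in> \<int>" for z
    using JI[of "of_rat z"] Zc[of "c * z"] c0 by (simp add: of_rat_mult)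
  obtain \<alpha> \<alpha>' \<beta> T where N: "\<alpha> \<in> KE" "\<alpha>' \<in> OK" "\<alpha> * \<alpha>' = 1" "2 * of_nat p * \<alpha> \<in> OK"
    "(T = OK \<and> \<beta> \<in> {1, inverse t}) \<or> (T = QI \<and> \<beta> \<in> {inverse (of_nat q), inverse t})"
    and JT: "J = (\<lambda>x. \<alpha> * \<beta> * x) ` T"
    using normalized_invariant_ideal[OF J Jinv JZ] by metis
  have "I = (\<lambda>x. of_rat c * \<alpha> * \<beta> * x) ` T"
  proof (intro equalityI subsetI)
    fix z assume z: "z \<in> I"
    have "of_rat (1 / c) * z \<in> J" unfolding J_def by (rule imageI[OF z])
    then obtain w where "w \<in> T" "of_rat (1 / c) * z = \<alpha> * \<beta> * w" using JT by blast
    moreover have "z = of_rat c * (of_rat (1 / c) * z)" using cc by (simp add: of_rat_divide)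
    ultimately show "z \<in> (\<lambda>x. of_rat c * \<alpha> * \<beta> * x) ` T" by (auto simp: mult.assoc)
  next
    fix z assume "z \<in> (\<lambda>x. of_rat c * \<alpha> * \<beta> * x) ` T"
    then obtain w where w: "w \<in> T" "z = of_rat c * (\<alpha> * \<beta> * w)" by (auto simp: mult.assoc)
    have "\<alpha> * \<beta> * w \<in> J" using JT w(1) by blast
    thus "z \<in> I" using JI w(2) by simp
  qed
  thus ?thesis using that[OF c0 Zc N] by blast
qed

end

subsection \<open>Leading coefficients and divided differences\<close>

text \<open>The leading coefficient is the n-th divided difference. Each step removes one node and
  divides by differences of nodes, which costs one factor \<open>m\<close>. With
  \<open>m = 1\<close> it is applied in a localization, with a factorial in
  \<open>OK\<close>.\<close>

lemma leading_coeff_divided_difference: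
  fixes R :: "'a :: field set" and f :: "'a poly"
  assumes R: "\<And>x y. x \<in> R \<Longrightarrow> y \<in> R \<Longrightarrow> x - y \<in> R" "\<And>x y. x \<in> R \<Longrightarrow> y \<in> R \<Longrightarrow> x * y \<in> R"
    and "card A = Suc n" "Polynomial.degree f = n"
    and "\<And>a. a \<in> A \<Longrightarrow> poly f a \<in> R"
    and "\<And>a b. a \<in> A \<Longrightarrow> b \<in> A \<Longrightarrow> a \<noteq> b \<Longrightarrow> m / (a - b) \<in> R"
  shows "m ^ n * lead_coeff f \<in> R"
  using assms(3-)
proof (induction n arbitrary: A f)
  case 0
  have "A \<noteq> {}" using 0(1) by (metis card.empty nat.distinct(1))
  then obtain a where a: "a \<in> A" by blast
  obtain c where "f = [:c:]" using 0(2) by (rule degree_eq_zeroE)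
  thus ?case using 0(3)[OF a] by simp
next
  case (Suc n)
  have finA: "finite A" using Suc.prems(1) by (metis card.infinite nat.distinct(1))
  have "A \<noteq> {}" using Suc.prems(1) by (metis card.empty nat.distinct(1))
  then obtain a where a: "a \<in> A" by blast
  have "poly (f - [:poly f a:]) a = 0" by simp
  then obtain g where g: "f - [:poly f a:] = [:- a, 1:] * g" by (metis poly_eq_0_iff_dvd dvdE)
  have df: "Polynomial.degree (f - [:poly f a:]) = Suc n"
    using Suc.prems(2) by (metis degree_diff_less degree_pCons_0 degree_add_eq_left diff_conv_add_uminus
      degree_minus zero_less_Suc)
  have g0: "g \<noteq> 0" using g df by auto
  have "Polynomial.degree ([:- a, 1:] * g) = Suc (Polynomial.degree g)"
    using g0 by (subst degree_mult_eq) auto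
  hence dg: "Polynomial.degree g = n" using g df by simp
  have "lead_coeff (f - [:poly f a:]) = lead_coeff f"
    unfolding df Suc.prems(2) by simp
  moreover have "lead_coeff ([:- a, 1:] * g) = lead_coeff g" by (subst lead_coeff_mult) simp
  ultimately have lg: "lead_coeff g = lead_coeff f" using g by simp
  show ?case
  \<comment> \<open>For \<open>m = 0\<close> the scaled quotient loses its degree, and only
    \<open>0\<close> in \<open>R\<close> has to be shown.\<close>
  proof (cases "m = 0")
    case True
    have "poly f a - poly f a \<in> R" by (intro R Suc.prems(3) a)
    thus ?thesis using True by simp
  next
    case False
    have "m ^ n * lead_coeff (Polynomial.smult m g) \<in> R"
    proof (rule Suc.IH[of "A - {a}"])
      show "card (A - {a}) = Suc n" using Suc.prems(1) a finA by simp
      show "Polynomial.degree (Polynomial.smult m g) = n" using dg False by simp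
      fix b assume b: "b \<in> A - {a}"
      have "poly f b - poly f a = (b - a) * poly g b"
        using arg_cong[OF g, of "\<lambda>h. poly h b"] by (simp add: left_diff_distrib)
      hence "poly (Polynomial.smult m g) b = (m / (b - a)) * (poly f b - poly f a)" using b by simp
      moreover have "m / (b - a) \<in> R" "poly f b - poly f a \<in> R" using b a by (auto intro: R Suc.prems(3,4))
      ultimately show "poly (Polynomial.smult m g) b \<in> R" by (simp only: R(2))
    next
      fix b c assume "b \<in> A - {a}" "c \<in> A - {a}" "b \<noteq> c"
      thus "m / (b - c) \<in> R" using Suc.prems(4) by blast
    qed
    moreover have "m ^ Suc n * lead_coeff f = m ^ n * lead_coeff (Polynomial.smult m g)"
      by (simp only: lead_coeff_smult lg power_Suc mult_ac)
    ultimately show ?thesis by (simp only:)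
  qed
qed

context biquadratic
begin

subsection \<open>The characteristic ideals\<close>

abbreviation J where "J n \<equiv> char_ideal K n"

lemma Int_iff: "f \<in> int_valued_polys K \<longleftrightarrow>
    (\<forall>i. Polynomial.coeff f i \<in> KE) \<and> (\<forall>x\<in>OK. poly f x \<in> OK)"
  by (simp add: int_valued_polys_def K_eq)

lemma J_I: "f \<in> int_valued_polys K \<Longrightarrow> Polynomial.degree f = n \<Longrightarrow> lead_coeff f \<in> J n"
  by (auto simp: char_ideal_def)

lemma J_cases:
  assumes "x \<in> J n" "x \<noteq> 0"
  obtains f where "f \<in> int_valued_polys K" "Polynomial.degree f = n" "x = lead_coeff f"
  using assms by (auto simp: char_ideal_def)

lemma module_J: "module (J n)"
  unfolding module_def
proof (intro conjI ballI subsetI)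
  fix x assume "x \<in> J n"
  thus "x \<in> KE" by (auto simp: char_ideal_def Int_iff)
next
  fix x y assume x: "x \<in> J n" and y: "y \<in> J n"
  show "x + y \<in> J n"
  \<comment> \<open>If \<open>x + y = 0\<close>, the sum of the polynomials has smaller degree and
    is no witness; the adjoined 0 covers this case.\<close>
  proof (cases "x = 0 \<or> y = 0 \<or> x + y = 0")
    case True
    moreover have "0 \<in> J n" by (simp add: char_ideal_def)
    ultimately show ?thesis using x y by (elim disjE) simp_all
  next
    case False
    obtain f where f: "f \<in> int_valued_polys K" "Polynomial.degree f = n" "x = lead_coeff f"
      using J_cases[OF x] False by blast
    obtain g where g: "g \<in> int_valued_polys K" "Polynomial.degree g = n" "y = lead_coeff g"
      using J_cases[OF y] False by blast
    have c: "Polynomial.coeff (f + g) n = x + y" using f g by simp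
    have "Polynomial.degree (f + g) \<le> n" using f g by (simp add: degree_add_le)
    hence d: "Polynomial.degree (f + g) = n" using c False le_degree[of "f + g" n] by simp
    have "f + g \<in> int_valued_polys K" using f g by (simp add: Int_iff KE_closed OK_closed)
    from J_I[OF this d] show ?thesis using c d by simp
  qed
next
  fix a x assume a: "a \<in> OK" and x: "x \<in> J n"
  show "a * x \<in> J n"
  proof (cases "a = 0 \<or> x = 0")
    case True
    thus ?thesis by (auto simp: char_ideal_def)
  next
    case False
    obtain f where f: "f \<in> int_valued_polys K" "Polynomial.degree f = n" "x = lead_coeff f"
      using J_cases[OF x] False by blast
    have "Polynomial.smult a f \<in> int_valued_polys K" using f a OK_KE by (simp add: Int_iff KE_closed OK_closed)
    moreover have "Polynomial.degree (Polynomial.smult a f) = n" using f False by simp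
    ultimately have "lead_coeff (Polynomial.smult a f) \<in> J n" by (rule J_I)
    thus ?thesis by (simp only: lead_coeff_smult f(3))
  qed
qed

lemma one_in_J: "1 \<in> J n"
proof -
  have "Polynomial.monom 1 n \<in> int_valued_polys K"
  proof -
    have "x ^ n \<in> OK" if "x \<in> OK" for x by (induction n) (auto intro: OK_closed that)
    thus ?thesis by (simp add: Int_iff poly_monom)
  qed
  from J_I[OF this, of n] show ?thesis by (simp add: degree_monom_eq)
qed

lemma poly_map_conj:
  assumes ef: "signs e f" and x: "x \<in> KE" and F: "\<And>i. Polynomial.coeff F i \<in> KE"
  shows "poly F x \<in> KE \<and> poly (map_poly (conj e f) F) (conj e f x) = conj e f (poly F x)"
  using F
proof (induction F)
  case 0
  thus ?case by (simp add: conj_basic)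
next
  case (pCons a F)
  have a: "a \<in> KE" using pCons.prems[of 0] by simp
  have "\<And>i. Polynomial.coeff F i \<in> KE"
  proof -
    fix i show "Polynomial.coeff F i \<in> KE" using pCons.prems[of "Suc i"] by simp
  qed
  note IH = pCons.IH[OF this]
  have "map_poly (conj e f) (pCons a F) = pCons (conj e f a) (map_poly (conj e f) F)"
    by (rule Polynomial.map_poly_pCons) (rule conj_basic(7))
  thus ?case using IH a x by (simp add: KE_closed conj_hom(1,3)[OF ef])
qed

text \<open>Conjugating the coefficients of \<open>F\<close> gives a polynomial whose value at
  \<open>y\<close> is the conjugate of the value of \<open>F\<close> at a conjugate of
  \<open>y\<close>; since \<open>OK\<close> is stable, it is again integer-valued.\<close>

lemma invariant_J: "invariant (J n)"
  unfolding invariant_def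
proof (intro allI impI ballI)
  fix e f :: rat and x assume ef: "signs e f" and x: "x \<in> J n"
  show "conj e f x \<in> J n"
  proof (cases "x = 0")
    case True
    thus ?thesis by (simp add: conj_basic char_ideal_def)
  next
    case False
    then obtain F where F: "F \<in> int_valued_polys K" "Polynomial.degree F = n" "x = lead_coeff F"
      using J_cases[OF x] by blast
    define G where "G = map_poly (conj e f) F"
    have cG: "Polynomial.coeff G i = conj e f (Polynomial.coeff F i)" for i
      by (simp add: G_def coeff_map_poly conj_basic)
    have xK: "x \<in> KE" using F by (simp add: Int_iff)
    have "conj e f x \<noteq> 0" using conj_eq_0_iff[OF ef xK] False by simp
    hence "Polynomial.coeff G n \<noteq> 0" using cG F by simp
    moreover have "Polynomial.degree G \<le> n"
      using F by (intro degree_le) (auto simp: cG coeff_eq_0 conj_basic)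
    ultimately have dG: "Polynomial.degree G = n" using le_degree[of G n] by simp
    have "G \<in> int_valued_polys K"
      unfolding Int_iff
    proof (intro conjI allI ballI)
      show "Polynomial.coeff G i \<in> KE" for i by (simp add: cG)
      fix y assume y: "y \<in> OK"
      define z where "z = conj e f y"
      have z: "z \<in> OK" "y = conj e f z" using conj_OK[OF ef y] conj_conj[OF ef OK_KE[OF y]] by (simp_all add: z_def)
      have "poly G y = conj e f (poly F z)"
        unfolding G_def z(2) using poly_map_conj[OF ef OK_KE[OF z(1)]] F by (simp add: Int_iff)
      thus "poly G y \<in> OK" using conj_OK[OF ef] F z by (simp add: Int_iff)
    qed
    from J_I[OF this dG] show ?thesis using cG dG F by simp
  qed
qed

text \<open>Divided differences at the nodes 0 to \<open>n\<close>, whose differences divide the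
  factorial of \<open>n\<close>.\<close>

lemma J_bounded: "\<exists>d\<in>OK. d \<noteq> 0 \<and> (\<forall>x\<in>J n. d * x \<in> OK)"
proof (intro bexI conjI ballI)
  define m :: complex where "m = of_nat (fact n)"
  show "m ^ n \<noteq> 0" by (simp add: m_def)
  show "m ^ n \<in> OK" unfolding m_def of_nat_power[symmetric] by (rule OK_basic)
  fix x assume x: "x \<in> J n"
  show "m ^ n * x \<in> OK"
  proof (cases "x = 0")
    case False
    then obtain F where F: "F \<in> int_valued_polys K" "Polynomial.degree F = n" "x = lead_coeff F"
      using J_cases[OF x] by blast
    have "m ^ n * lead_coeff F \<in> OK"
    proof (rule leading_coeff_divided_difference[where A = "of_nat ` {..n}"])
      show "card ((of_nat :: nat \<Rightarrow> complex) ` {..n}) = Suc n" by (subst card_image) (auto simp: inj_on_def)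
      show "poly F a \<in> OK" if "a \<in> of_nat ` {..n}" for a using F that by (auto simp: Int_iff)
      fix a b :: complex assume "a \<in> of_nat ` {..n}" "b \<in> of_nat ` {..n}" "a \<noteq> b"
      then obtain i j where ij: "a = of_nat i" "b = of_nat j" "i \<le> n" "j \<le> n" "i \<noteq> j" by auto
      have "nat \<bar>int i - int j\<bar> dvd fact n" using ij by (intro dvd_fact) auto
      hence "int (nat \<bar>int i - int j\<bar>) dvd int (fact n)" by (simp only: int_dvd_int_iff)
      hence "int i - int j dvd int (fact n)" by simp
      then obtain k where k: "int (fact n) = (int i - int j) * k" by (auto elim: dvdE)
      have "m = of_int (int (fact n))" by (simp add: m_def)
      also have "\<dots> = (a - b) * of_int k" unfolding k ij by simp
      finally have "m / (a - b) = of_int k" using \<open>a \<noteq> b\<close> by simp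
      thus "m / (a - b) \<in> OK" by simp
    qed (auto simp: F OK_closed)
    thus ?thesis by (simp add: F)
  qed auto
qed

lemma J_cases_invariant:
  obtains c \<alpha> \<alpha>' \<beta> T where "c \<noteq> 0" "\<And>z. of_rat z \<in> J n \<longleftrightarrow> z / c \<in> \<int>"
    "\<alpha>' \<in> OK" "\<alpha> * \<alpha>' = 1" "2 * of_nat p * \<alpha> \<in> OK"
    "(T = OK \<and> \<beta> \<in> {1, inverse t}) \<or> (T = QI \<and> \<beta> \<in> {inverse (of_nat q), inverse t})"
    "of_rat c * \<alpha> * \<beta> \<in> KE" "of_rat c * \<alpha> * \<beta> \<noteq> 0" "J n = (\<lambda>x. of_rat c * \<alpha> * \<beta> * x) ` T"
proof -
  obtain d where d: "d \<in> OK" "d \<noteq> 0" "\<And>x. x \<in> J n \<Longrightarrow> d * x \<in> OK" using J_bounded by blast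
  obtain c \<alpha> \<alpha>' \<beta> T where c: "c \<noteq> 0" "\<And>z. of_rat z \<in> J n \<longleftrightarrow> z / c \<in> \<int>"
    and A: "\<alpha> \<in> KE" "\<alpha>' \<in> OK" "\<alpha> * \<alpha>' = 1" "2 * of_nat p * \<alpha> \<in> OK"
    and B: "(T = OK \<and> \<beta> \<in> {1, inverse t}) \<or> (T = QI \<and> \<beta> \<in> {inverse (of_nat q), inverse t})"
    and JT: "J n = (\<lambda>x. of_rat c * \<alpha> * \<beta> * x) ` T"
    by (rule invariant_ideal_cases[OF module_J[of n] invariant_J[of n] one_in_J[of n] _ d])
      (simp, assumption, rule that, assumption+)
  have bc: "\<beta> = 1 \<or> \<beta> = inverse t \<or> \<beta> = inverse (of_nat q)" using B by blast
  have "\<beta> \<in> KE" using bc inverse_KE_basic by blast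
  hence "of_rat c * \<alpha> * \<beta> \<in> KE" by (intro KE_closed(4) A KE_basic)
  moreover have "\<beta> \<noteq> 0" using bc t_nz pos by (elim disjE) simp_all
  moreover have "\<alpha> \<noteq> 0" using A(3) by auto
  ultimately show ?thesis using that[OF c A(2-4) B _ _ JT] c(1) by simp
qed

subsection \<open>Localization and complete residue systems\<close>

text \<open>The localization of \<open>OK\<close> at the rational prime \<open>l\<close>: all primes
  above \<open>l\<close> are kept together, and the denominators are integers prime to
  \<open>l\<close>.\<close>

definition Loc :: "nat \<Rightarrow> complex set" where
  "Loc l = {x \<in> KE. \<exists>M::int. \<not> int l dvd M \<and> of_int M * x \<in> OK}"

lemma Loc_closed:
  assumes l: "Factorial_Ring.prime l" and x: "x \<in> Loc l" and y: "y \<in> Loc l"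
  shows "x - y \<in> Loc l" "x * y \<in> Loc l"
proof -
  obtain M where M: "\<not> int l dvd M" "of_int M * x \<in> OK" "x \<in> KE" using x by (auto simp: Loc_def)
  obtain N where N: "\<not> int l dvd N" "of_int N * y \<in> OK" "y \<in> KE" using y by (auto simp: Loc_def)
  have MN: "\<not> int l dvd M * N" using M N l by (simp add: prime_dvd_mult_iff)
  have "of_int (M * N) * (x - y) = of_int N * (of_int M * x) - of_int M * (of_int N * y)"
    by (simp add: algebra_simps)
  also have "\<dots> \<in> OK" by (intro OK_closed(3) OK_closed(4) OK_basic M N)
  finally show "x - y \<in> Loc l" using MN M N unfolding Loc_def by (blast intro: KE_closed)
  have "of_int (M * N) * (x * y) = (of_int M * x) * (of_int N * y)" by (simp add: algebra_simps)
  also have "\<dots> \<in> OK" by (intro OK_closed(4) M N)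
  finally show "x * y \<in> Loc l" using MN M N unfolding Loc_def by (blast intro: KE_closed)
qed

lemma OK_Loc: "Factorial_Ring.prime l \<Longrightarrow> x \<in> OK \<Longrightarrow> x \<in> Loc l"
  unfolding Loc_def by (auto simp: OK_KE not_prime_unit intro!: exI[of _ 1] dest: not_prime_unit)

lemma inverse_in_Loc:
  assumes "x \<in> OK" "nm x = of_int k" "\<not> int l dvd k"
  shows "1 / x \<in> Loc l"
proof -
  have "k \<noteq> 0" using assms(3) by auto
  hence x0: "x \<noteq> 0" using assms(2) by (auto simp: nm_def conj_basic)
  have "of_int k * (1 / x) = conj 1 (-1) x * conj (-1) 1 x * conj (-1) (-1) x"
    unfolding assms(2)[symmetric] using x0 by (simp add: nm_def)
  also have "\<dots> \<in> OK" using assms(1) by (intro OK_closed conj_OK) auto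
  finally show ?thesis using assms OK_KE KE_inverse by (auto simp: Loc_def divide_inverse)
qed

text \<open>Representatives of the residue field at a prime above \<open>l\<close>, which has \<open>l\<close> elements if \<open>p\<close> is a
  square modulo \<open>l\<close>, and \<open>l\<^sup>2\<close> elements otherwise (for \<open>l\<close> equal to \<open>q\<close> or \<open>r\<close>).\<close>

definition pts :: "nat \<Rightarrow> complex set" where
  "pts l = (if QuadRes (int l) (int p) then (\<lambda>i. of_int i) ` {0..<int l}
    else (\<lambda>(i, j). of_int i + of_int j * s) ` ({0..<int l} \<times> {0..<int l}))"

lemma int_pt_el: "of_int i + of_int j * s = el (of_int i) (of_int j) 0 0"
  by (simp add: el_def)

lemma card_pts: "card (pts l) = (if QuadRes (int l) (int p) then l else l * l)"
proof -
  have "inj_on (\<lambda>(i, j). of_int i + of_int j * s) ({0..<int l} \<times> {0..<int l})"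
    unfolding int_pt_el by (auto simp: inj_on_def el_eq_iff)
  moreover have "inj_on (of_int :: int \<Rightarrow> complex) {0..<int l}" by (auto simp: inj_on_def)
  ultimately show ?thesis by (simp add: pts_def card_image card_cartesian_product)
qed

lemma finite_pts: "finite (pts l)" by (simp add: pts_def)

lemma pts_OK: "a \<in> pts l \<Longrightarrow> a \<in> OK"
  by (auto simp: pts_def split: if_splits intro!: OK_closed)

lemma pts_el:
  assumes "a \<in> pts l"
  obtains i j where "a = el (of_int i) (of_int j) 0 0" "0 \<le> i" "i < int l" "0 \<le> j" "j < int l"
    "QuadRes (int l) (int p) \<Longrightarrow> j = 0"
proof (cases "QuadRes (int l) (int p)")
  case True
  then obtain i where "a = of_int i" "0 \<le> i" "i < int l" using assms by (auto simp: pts_def)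
  thus ?thesis using that[of i 0] by (simp add: el_basic(4))
next
  case False
  then obtain i j where "a = of_int i + of_int j * s" "0 \<le> i" "i < int l" "0 \<le> j" "j < int l"
    using assms by (auto simp: pts_def)
  thus ?thesis using that[of i j] False by (simp add: int_pt_el)
qed

lemma small_dvd_0: "\<bar>i\<bar> < int l \<Longrightarrow> int l dvd i \<Longrightarrow> i = 0"
  using dvd_imp_le_int[of i "int l"] by (cases "i = 0") simp_all

text \<open>If \<open>p\<close> is no square modulo \<open>l\<close>, the form
  \<open>i\<^sup>2 - p * j\<^sup>2\<close> has no nontrivial zero there; otherwise
  \<open>j = 0\<close>. The full norm of a difference is the square of this form, so distinct points
  stay distinct at every prime above \<open>l\<close>.\<close>

lemma pts_diff_norm:
  assumes l: "Factorial_Ring.prime l" and a: "a \<in> pts l" and b: "b \<in> pts l" and ab: "a \<noteq> b"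
  obtains i j where "a - b = el (of_int i) (of_int j) 0 0" "\<not> int l dvd i\<^sup>2 - int p * j\<^sup>2"
proof -
  obtain i1 j1 where 1: "a = el (of_int i1) (of_int j1) 0 0" "0 \<le> i1" "i1 < int l" "0 \<le> j1" "j1 < int l"
    "QuadRes (int l) (int p) \<Longrightarrow> j1 = 0" using pts_el[OF a] by metis
  obtain i2 j2 where 2: "b = el (of_int i2) (of_int j2) 0 0" "0 \<le> i2" "i2 < int l" "0 \<le> j2" "j2 < int l"
    "QuadRes (int l) (int p) \<Longrightarrow> j2 = 0" using pts_el[OF b] by metis
  define i where "i = i1 - i2"
  define j where "j = j1 - j2"
  have d: "a - b = el (of_int i) (of_int j) 0 0" by (simp add: 1 2 el_diff i_def j_def)
  have sm: "\<bar>i\<bar> < int l" "\<bar>j\<bar> < int l" using 1 2 by (auto simp: i_def j_def)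
  have nz: "i \<noteq> 0 \<or> j \<noteq> 0" using ab 1 2 by (auto simp: i_def j_def)
  have pl: "Factorial_Ring.prime (int l)" using l by simp
  have "\<not> int l dvd i\<^sup>2 - int p * j\<^sup>2"
  proof
    assume dv: "int l dvd i\<^sup>2 - int p * j\<^sup>2"
    have "int l dvd j"
    proof (rule ccontr)
      assume nj: "\<not> int l dvd j"
      have "int l dvd int p * j\<^sup>2 - i\<^sup>2" using dv by (simp only: dvd_diff_commute)
      hence "[int p * j\<^sup>2 = i\<^sup>2] (mod int l)" by (simp only: cong_iff_dvd_diff)
      moreover have "QuadRes (int l) (i\<^sup>2)" unfolding QuadRes_def by (intro exI[of _ i]) simp
      ultimately have "QuadRes (int l) (int p)" using QuadRes_of_mult_square[OF l _ _ nj] by blast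
      hence "j = 0" using 1(6) 2(6) by (simp add: j_def)
      thus False using nj by simp
    qed
    hence j0: "j = 0" using small_dvd_0 sm by blast
    hence "int l dvd i\<^sup>2" using dv by simp
    hence "int l dvd i" using pl prime_dvd_power by blast
    hence "i = 0" using small_dvd_0 sm by blast
    thus False using nz j0 by simp
  qed
  thus ?thesis using that d by blast
qed

lemma nm_k1: "nm (el (of_int i) (of_int j) 0 0) = of_int ((i\<^sup>2 - int p * j\<^sup>2)\<^sup>2)"
  unfolding nm_def conj_el el_mult el_basic(4) el_eq_iff by (simp add: power2_eq_square algebra_simps)

lemma pts_inverse_Loc:
  assumes l: "Factorial_Ring.prime l" and ab: "a \<in> pts l" "b \<in> pts l" "a \<noteq> b"
  shows "1 / (a - b) \<in> Loc l"
proof -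
  obtain i j where ij: "a - b = el (of_int i) (of_int j) 0 0" "\<not> int l dvd i\<^sup>2 - int p * j\<^sup>2"
    using pts_diff_norm[OF l ab] .
  have "Factorial_Ring.prime (int l)" using l by simp
  hence "\<not> int l dvd (i\<^sup>2 - int p * j\<^sup>2)\<^sup>2" using ij(2) prime_dvd_power by blast
  moreover have "nm (a - b) = of_int ((i\<^sup>2 - int p * j\<^sup>2)\<^sup>2)" unfolding ij(1) by (rule nm_k1)
  moreover have "a - b \<in> OK" using pts_OK ab by (intro OK_closed)
  ultimately show ?thesis using inverse_in_Loc by blast
qed

text \<open>As long as \<open>n + 1\<close> points with differences invertible at \<open>l\<close>
  exist, the leading coefficients acquire no denominator at \<open>l\<close>.\<close>

lemma J_Loc:
  assumes l: "Factorial_Ring.prime l" and n: "n < card (pts l)" and x: "x \<in> J n"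
  shows "x \<in> Loc l"
proof (cases "x = 0")
  case True
  thus ?thesis using OK_Loc[OF l, of 0] by simp
next
  case False
  then obtain F where F: "F \<in> int_valued_polys K" "Polynomial.degree F = n" "x = lead_coeff F"
    using J_cases[OF x] by blast
  have "Suc n \<le> card (pts l)" using n by simp
  then obtain A where A: "A \<subseteq> pts l" "card A = Suc n"
    by (rule obtain_subset_with_card_n)
  have "1 ^ n * lead_coeff F \<in> Loc l"
  proof (rule leading_coeff_divided_difference[OF Loc_closed[OF l] A(2) F(2)])
    fix a assume "a \<in> A"
    hence "a \<in> OK" using A(1) pts_OK by blast
    thus "poly F a \<in> Loc l" using F(1) OK_Loc[OF l] by (simp add: Int_iff)
  next
    fix a b assume "a \<in> A" "b \<in> A" "a \<noteq> b"
    thus "1 / (a - b) \<in> Loc l" using pts_inverse_Loc[OF l, of a b] A(1) by blast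
  qed
  thus ?thesis using F by simp
qed

lemma zero_in_pts: "l > 0 \<Longrightarrow> 0 \<in> pts l"
  by (auto simp: pts_def intro!: image_eqI[of _ _ 0] image_eqI[of _ _ "(0,0)"])

text \<open>Every prime above \<open>q\<close> contains \<open>t\<close>, so \<open>t - a\<close> is
  invertible there together with \<open>a\<close>.\<close>

lemma t_minus_pt_inverse_Loc:
  assumes a: "a \<in> pts q" "a \<noteq> 0"
  shows "1 / (t - a) \<in> Loc q" "1 / (a - t) \<in> Loc q"
proof -
  obtain i j where ij: "a - 0 = el (of_int i) (of_int j) 0 0" "\<not> int q dvd i\<^sup>2 - int p * j\<^sup>2"
    using pts_diff_norm[OF q(1) a(1) zero_in_pts[OF pos(2)] a(2)] .
  have pl: "Factorial_Ring.prime (int q)" using q by simp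
  have d: "t - a = el (- of_int i) (- of_int j) 1 0" using ij(1) by (simp add: el_basic(2) el_diff)
  \<comment> \<open>modulo \<open>q\<close> the norm of \<open>t - a\<close> is that of \<open>a\<close>\<close>
  define u where "u = i\<^sup>2 + int p * j\<^sup>2 - int q * int r"
  define v where "v = 2 * i * j"
  have "nm (t - a) = of_int (u\<^sup>2 - int p * v\<^sup>2)"
    unfolding d nm_def conj_el el_mult el_basic(4) el_eq_iff u_def v_def
    by (simp add: power2_eq_square algebra_simps)
  moreover have "u\<^sup>2 - int p * v\<^sup>2 = (i\<^sup>2 - int p * j\<^sup>2)\<^sup>2 + int q * (int q * (int r)\<^sup>2 - 2 * int r * (i\<^sup>2 + int p * j\<^sup>2))"
    by (simp add: u_def v_def power2_eq_square algebra_simps)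
  moreover have "\<not> int q dvd (i\<^sup>2 - int p * j\<^sup>2)\<^sup>2" using ij(2) pl prime_dvd_power by blast
  ultimately have nm: "nm (t - a) = of_int (u\<^sup>2 - int p * v\<^sup>2)" "\<not> int q dvd u\<^sup>2 - int p * v\<^sup>2"
    by (simp_all add: dvd_add_left_iff)
  have O: "t - a \<in> OK" using pts_OK[OF a(1)] by (intro OK_closed) auto
  show "1 / (t - a) \<in> Loc q" by (rule inverse_in_Loc[OF O nm])
  from Loc_closed(1)[OF q(1) OK_Loc[OF q(1)] this, of 0]
  have "0 - 1 / (t - a) \<in> Loc q" by simp
  moreover have "0 - 1 / (t - a) = 1 / (a - t)" by (metis diff_0 minus_diff_eq minus_divide_right)
  ultimately show "1 / (a - t) \<in> Loc q" by simp
qed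

text \<open>The degree now equals the number of points, so one more node is required, and
  \<open>t\<close> is added; it collides only with 0. Splitting off the value at 0 leaves
  \<open>F = F(0) + X * g\<close>, and \<open>t * g\<close> is integral at \<open>q\<close> on the
  remaining nodes, including \<open>t\<close>, where it equals \<open>F(t) - F(0)\<close>. So the
  denominator is at most \<open>t\<close>.\<close>

lemma t_J_Loc:
  assumes x: "x \<in> J (card (pts q))"
  shows "t * x \<in> Loc q"
proof (cases "x = 0")
  case True
  thus ?thesis using OK_Loc[OF q(1), of 0] by simp
next
  case False
  define n where "n = card (pts q)"
  obtain F where F: "F \<in> int_valued_polys K" "Polynomial.degree F = n" "x = lead_coeff F"
    using J_cases[OF x False] n_def by blast
  have n0: "n > 0" unfolding n_def using zero_in_pts[OF pos(2)] finite_pts card_gt_0_iff by blast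
  have "poly (F - [:poly F 0:]) 0 = 0" by simp
  then obtain g where g: "F - [:poly F 0:] = [:- 0, 1:] * g" by (metis poly_eq_0_iff_dvd dvdE)
  have df: "Polynomial.degree (F - [:poly F 0:]) = n"
  proof -
    have "Polynomial.coeff (F - [:poly F 0:]) n = x" using F n0 by (cases n) auto
    moreover have "Polynomial.degree (F - [:poly F 0:]) \<le> n" using F by (intro degree_diff_le) auto
    ultimately show ?thesis using False le_degree[of "F - [:poly F 0:]" n] by simp
  qed
  have lf: "lead_coeff (F - [:poly F 0:]) = x" unfolding df using F n0 by (cases n) auto
  have g0: "g \<noteq> 0" using g lf False by auto
  have "Polynomial.degree ([:- 0, 1:] * g) = Suc (Polynomial.degree g)"
    using g0 by (subst degree_mult_eq) auto
  hence dg: "Polynomial.degree g = n - 1" using g df by simp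
  have lg: "lead_coeff g = x" using g lf by (metis lead_coeff_mult lead_coeff_pCons(1) lead_coeff_1 mult_1_left one_pCons zero_neq_one pCons_eq_0_iff)
  have gb: "b * poly g b = poly F b - poly F 0" for b
    using arg_cong[OF g, of "\<lambda>h. poly h b"] by simp
  \<comment> \<open>The node 0 is already used up, so \<open>t\<close> can take its place without a
    collision.\<close>
  define A where "A = insert t (pts q - {0})"
  have tn: "t \<notin> pts q"
  proof
    assume "t \<in> pts q"
    then obtain i j where "t = el (of_int i) (of_int j) 0 0" using pts_el by metis
    thus False by (simp add: el_basic(2) el_eq_iff)
  qed
  have cA: "card A = Suc (n - 1)"
    using n0 zero_in_pts[OF pos(2)] finite_pts tn by (simp add: A_def n_def)
  have FO: "poly F b \<in> OK" if "b \<in> OK" for b using F that by (simp add: Int_iff)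
  have "1 ^ (n - 1) * lead_coeff (Polynomial.smult t g) \<in> Loc q"
  proof (rule leading_coeff_divided_difference[OF Loc_closed[OF q(1)] cA])
    show "Polynomial.degree (Polynomial.smult t g) = n - 1" using dg t_nz by simp
    fix b assume b: "b \<in> A"
    show "poly (Polynomial.smult t g) b \<in> Loc q"
    proof (cases "b = t")
      case True
      have "poly (Polynomial.smult t g) b = poly F t - poly F 0" using gb[of t] True by simp
      also have "\<dots> \<in> Loc q" by (intro OK_Loc[OF q(1)] OK_closed FO) auto
      finally show ?thesis .
    next
      case False
      hence b': "b \<in> pts q" "b \<noteq> 0" using b by (auto simp: A_def)
      have inv: "1 / (b - 0) \<in> Loc q"
        by (rule pts_inverse_Loc[OF q(1) b'(1) zero_in_pts[OF pos(2)] b'(2)])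
      have "poly (Polynomial.smult t g) b = t * (poly F b - poly F 0) * (1 / (b - 0))"
        using gb[of b, symmetric] b'(2) by simp
      also have "\<dots> \<in> Loc q"
        by (intro Loc_closed(2)[OF q(1) _ inv] OK_Loc[OF q(1)] OK_closed(3,4) FO pts_OK[OF b'(1)] OK_basic)
      finally show ?thesis .
    qed
  next
    fix a b assume ab: "a \<in> A" "b \<in> A" "a \<noteq> b"
    thus "1 / (a - b) \<in> Loc q"
      using t_minus_pt_inverse_Loc pts_inverse_Loc[OF q(1)] by (auto simp: A_def)
  qed
  thus ?thesis by (simp only: power_one mult_1_left lead_coeff_smult lg)
qed

subsection \<open>Residues modulo the prime above \<open>q\<close>\<close>

text \<open>Traces show that \<open>4 * p * x\<close> has integral coordinates. Since
  \<open>4 * p\<close> is invertible modulo \<open>q\<close>, suitable \<open>i\<close> and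
  \<open>j\<close> can be solved for, and the coordinates along \<open>t\<close> and
  \<open>s * t\<close> only contribute multiples of \<open>t\<close>.\<close>

lemma residue_mod_QI:
  assumes x: "x \<in> OK"
  obtains i j where "0 \<le> i" "i < int q" "0 \<le> j" "j < int q" "x - el (of_int i) (of_int j) 0 0 \<in> QI"
proof -
  obtain a b c d where xe: "x = el a b c d" using OK_KE[OF x] by (rule KE_cases)
  have x': "conj (-1) 1 x \<in> OK" using x by (intro conj_OK) auto
  have "x + conj (-1) 1 x = el (2 * a) 0 (2 * c) 0" by (simp add: xe conj_el el_add)
  hence "el (2 * a) 0 (2 * c) 0 \<in> OK" using OK_closed(1)[OF x x'] by simp
  from OK_k2(1,2)[OF this] obtain a' c' where ac: "4 * a = of_int a'" "4 * c = of_int c'"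
    by (auto elim!: Ints_cases)
  have "(x - conj (-1) 1 x) * s = el (2 * of_nat p * b) 0 (2 * of_nat p * d) 0"
    by (simp add: xe conj_el el_diff el_basic(1) el_mult mult_ac)
  hence "el (2 * of_nat p * b) 0 (2 * of_nat p * d) 0 \<in> OK"
    using OK_closed(4)[OF OK_closed(3)[OF x x'] OK_basic(1)] by simp
  from OK_k2(1,2)[OF this] obtain b' d' where bd: "4 * of_nat p * b = of_int b'" "4 * of_nat p * d = of_int d'"
    by (auto elim!: Ints_cases simp: mult.assoc)
  define M where "M = 4 * int p"
  have "coprime (int p) (int q)" by (rule primes_coprime) (use p q pq in simp_all)
  moreover have "coprime 2 (int q)" using q_odd by simp
  ultimately have "coprime (2 * 2 * int p) (int q)" by (simp only: coprime_mult_left_iff)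
  hence cop: "coprime M (int q)" by (simp add: M_def)
  obtain M' where M': "[M * M' = 1] (mod int q)" using cong_solve_coprime_int[OF cop] by blast
  have res: "\<exists>i. 0 \<le> i \<and> i < int q \<and> int q dvd A - M * i" for A
  proof -
    have "[M * ((M' * A) mod int q) = M * (M' * A)] (mod int q)" by (intro cong_mult) simp_all
    also have "M * (M' * A) = (M * M') * A" by simp
    also have "[(M * M') * A = 1 * A] (mod int q)" by (intro cong_mult M') simp
    finally have "int q dvd A - M * ((M' * A) mod int q)" by (simp add: cong_iff_dvd_diff dvd_diff_commute)
    moreover have "0 \<le> (M' * A) mod int q" "(M' * A) mod int q < int q" using pos by simp_all
    ultimately show ?thesis by blast
  qed
  \<comment> \<open>The rational coordinate of \<open>4 * p * x\<close> is \<open>p * a'\<close>,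
    whereas the coordinate along \<open>s\<close> is \<open>b'\<close> itself.\<close>
  obtain i where i: "0 \<le> i" "i < int q" "int q dvd int p * a' - M * i" using res by blast
  obtain j where j: "0 \<le> j" "j < int q" "int q dvd b' - M * j" using res by blast
  obtain u where u: "int p * a' - M * i = int q * u" using i(3) by (auto elim: dvdE)
  obtain v where v: "b' - M * j = int q * v" using j(3) by (auto elim: dvdE)
  define w where "w = x - el (of_int i) (of_int j) 0 0"
  have "of_int M * w = of_nat q * (of_int u + of_int v * s) + t * (of_int (int p * c') + of_int d' * s)"
  proof -
    have "of_int (int p * a' - M * i) = (of_int (int q * u) :: rat)" "of_int (b' - M * j) = (of_int (int q * v) :: rat)"
      using u v by simp_all
    hence "4 * of_nat p * (a - of_int i) = of_nat q * of_int u" "4 * of_nat p * (b - of_int j) = of_nat q * of_int v"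
      using ac bd by (simp_all add: M_def algebra_simps)
    moreover have "4 * of_nat p * c = of_nat p * of_int c'" using ac by simp
    moreover have "of_int M * w = el (4 * of_nat p * (a - of_int i)) (4 * of_nat p * (b - of_int j)) (4 * of_nat p * c) (4 * of_nat p * d)"
      unfolding w_def xe el_diff el_scale by (simp add: M_def)
    ultimately have "of_int M * w = el (of_nat q * of_int u) (of_nat q * of_int v) (of_nat p * of_int c') (of_int d')"
      using bd(2) by (simp only:)
    also have "\<dots> = of_nat q * (of_int u + of_int v * s) + t * (of_int (int p * c') + of_int d' * s)"
      by (simp add: el_def of_rat_mult algebra_simps)
    finally show ?thesis .
  qed
  hence 1: "of_int M * w \<in> QI" using QI_I[of "of_int u + of_int v * s" "of_int (int p * c') + of_int d' * s"]
    by (simp add: OK_closed)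
  have "w \<in> OK" unfolding w_def using el_OK[of i j 0 0] by (intro OK_closed x) simp
  hence 2: "of_int (int q) * w \<in> QI" using QI_closed(2)[OF _ q_in_QI] by (simp add: mult.commute)
  have "w \<in> QI" by (rule module_coprime[OF module_QI 1 2 cop])
  thus ?thesis using that i j w_def by blast
qed

text \<open>If \<open>p\<close> is no square modulo \<open>q\<close>, one point is congruent to
  \<open>x\<close> modulo \<open>QI\<close>. If \<open>p = k\<^sup>2\<close> modulo
  \<open>q\<close>, then \<open>QI\<close> splits according to \<open>s = k\<close> and
  \<open>s = - k\<close>; one integer point is congruent to \<open>x\<close> in each sense, and the
  product of the two factors lies in \<open>QI\<close>.\<close>

lemma prod_pts_in_QI:
  assumes x: "x \<in> OK"
  shows "(\<Prod>a\<in>pts q. x - a) \<in> QI"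
proof -
  have rest: "(\<Prod>a\<in>B. x - a) \<in> OK" if "B \<subseteq> pts q" for B
    using that by (induction B rule: infinite_finite_induct) (auto intro: OK_closed(4)[OF OK_closed(3)[OF x pts_OK]])
  have single: ?thesis if a: "a \<in> pts q" "x - a \<in> QI" for a
  proof -
    have "(\<Prod>a\<in>pts q. x - a) = (x - a) * (\<Prod>a\<in>pts q - {a}. x - a)"
      by (rule prod.remove[OF finite_pts a(1)])
    also have "\<dots> = (\<Prod>a\<in>pts q - {a}. x - a) * (x - a)" by (rule mult.commute)
    also have "\<dots> \<in> QI" by (intro QI_closed(2) rest a) auto
    finally show ?thesis .
  qed
  obtain i j where ij: "0 \<le> i" "i < int q" "0 \<le> j" "j < int q" "x - el (of_int i) (of_int j) 0 0 \<in> QI"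
    using residue_mod_QI[OF x] .
  show ?thesis
  proof (cases "QuadRes (int q) (int p)")
    case False
    hence "el (of_int i) (of_int j) 0 0 \<in> pts q"
      using ij by (auto simp: pts_def int_pt_el[symmetric] intro!: image_eqI[of _ _ "(i, j)"])
    thus ?thesis using single ij by blast
  next
    case True
    then obtain k where k: "[k\<^sup>2 = int p] (mod int q)" by (auto simp: QuadRes_def)
    have pqi: "Factorial_Ring.prime (int q)" using q by simp
    have nk: "\<not> int q dvd k"
    proof
      assume "int q dvd k"
      hence "int q dvd k\<^sup>2" by (simp add: power2_eq_square)
      hence "int q dvd int p" using k by (simp add: cong_dvd_iff)
      hence "q dvd p" by (simp only: int_dvd_int_iff)
      thus False using primes_dvd_imp_eq[OF q(1) p(1)] pq by simp
    qed
    \<comment> \<open>The residues of \<open>i + j * s\<close> under \<open>s = k\<close> and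
      \<open>s = - k\<close>.\<close>
    define i1 where "i1 = (i + j * k) mod int q"
    define i2 where "i2 = (i - j * k) mod int q"
    have memb: "of_int i1 \<in> pts q" "of_int i2 \<in> pts q"
      using True pos by (auto simp: pts_def i1_def i2_def)
    show ?thesis
    proof (cases "i1 = i2")
      case False
      have d: "int q dvd (i + j * k) - i1" "int q dvd (i - j * k) - i2"
        unfolding i1_def i2_def by (simp_all add: minus_mod_eq_mult_div)
      obtain u1 where u1: "(i + j * k) - i1 = int q * u1" using d(1) by (auto elim: dvdE)
      obtain u2 where u2: "(i - j * k) - i2 = int q * u2" using d(2) by (auto elim: dvdE)
      obtain u3 where u3: "int p - k\<^sup>2 = int q * u3"
        using k by (auto simp: cong_iff_dvd_diff dvd_diff_commute elim: dvdE)
      define w where "w = x - el (of_int i) (of_int j) 0 0"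
      define w1 where "w1 = w + of_int u1 * of_nat q"
      define w2 where "w2 = w + of_int u2 * of_nat q"
      have w: "w1 \<in> QI" "w2 \<in> QI" unfolding w1_def w2_def w_def
        by (intro QI_closed ij q_in_QI OK_basic)+
      have xw: "x = of_int i + of_int j * s + w" by (simp add: w_def int_pt_el)
      have i1: "of_int i1 = of_int i + of_int j * of_int k - of_int u1 * (of_nat q :: complex)"
      proof -
        have "i1 = i + j * k - u1 * int q" using u1 by (simp add: algebra_simps)
        thus ?thesis by simp
      qed
      have i2: "of_int i2 = of_int i - of_int j * of_int k - of_int u2 * (of_nat q :: complex)"
      proof -
        have "i2 = i - j * k - u2 * int q" using u2 by (simp add: algebra_simps)
        thus ?thesis by simp
      qed
      have x1: "x - of_int i1 = of_int j * (s - of_int k) + w1"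
        unfolding xw i1 w1_def by (simp add: algebra_simps)
      have x2: "x - of_int i2 = of_int j * (s + of_int k) + w2"
        unfolding xw i2 w2_def by (simp add: algebra_simps)
      have "(s - of_int k) * (s + of_int k) = of_int (int p - k\<^sup>2)"
        using s_sq by (simp add: algebra_simps power2_eq_square)
      also have "\<dots> = of_nat q * of_int u3" unfolding u3 by simp
      finally have su: "(s - of_int k) * (s + of_int k) = of_nat q * of_int u3" .
      have "(x - of_int i1) * (x - of_int i2) =
          of_int j * of_int j * ((s - of_int k) * (s + of_int k)) + of_int j * (s - of_int k) * w2 + (x - of_int i2) * w1"
        unfolding x1 x2 by (simp add: algebra_simps)
      also have "\<dots> = (of_int j * of_int j * of_int u3) * of_nat q + of_int j * (s - of_int k) * w2 + (x - of_int i2) * w1"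
        unfolding su by (simp add: mult_ac)
      also have "\<dots> \<in> QI"
        by (intro QI_closed w q_in_QI OK_closed x OK_basic)
      finally have Q12: "(x - of_int i1) * (x - of_int i2) \<in> QI" .
      have ne: "of_int i1 \<noteq> (of_int i2 :: complex)" using False by simp
      have "(\<Prod>a\<in>pts q. x - a) = (x - of_int i1) * (\<Prod>a\<in>pts q - {of_int i1}. x - a)"
        by (rule prod.remove[OF finite_pts memb(1)])
      also have "(\<Prod>a\<in>pts q - {of_int i1}. x - a) = (x - of_int i2) * (\<Prod>a\<in>pts q - {of_int i1} - {of_int i2}. x - a)"
        using ne memb finite_pts by (intro prod.remove) auto
      also have "(x - of_int i1) * ((x - of_int i2) * (\<Prod>a\<in>pts q - {of_int i1} - {of_int i2}. x - a)) =
          (\<Prod>a\<in>pts q - {of_int i1} - {of_int i2}. x - a) * ((x - of_int i1) * (x - of_int i2))"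
        by (simp only: mult_ac)
      also have "\<dots> \<in> QI" by (intro QI_closed(2) rest Q12) auto
      finally show ?thesis .
    next
      \<comment> \<open>The same point cannot be used as two factors; but then \<open>j = 0\<close>,
        and a single factor lies in \<open>QI\<close>.\<close>
      case eq: True
      hence "[i + j * k = i - j * k] (mod int q)"
        by (simp add: i1_def i2_def unique_euclidean_semiring_class.cong_def)
      hence "int q dvd 2 * (j * k)" by (simp add: cong_iff_dvd_diff)
      moreover have "\<not> int q dvd 2"
      proof
        assume "int q dvd 2"
        hence "q dvd 2" by (metis int_dvd_int_iff of_nat_numeral)
        hence "q = 2" by (rule primes_dvd_imp_eq[OF q(1) two_is_prime_nat])
        thus False using q_odd by simp
      qed
      ultimately have "int q dvd j" using nk pqi by (auto simp: prime_dvd_mult_iff)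
      moreover have "\<bar>j\<bar> < int q" using ij(3,4) by simp
      ultimately have "j = 0" using small_dvd_0 by blast
      hence "x - of_int i \<in> QI" using ij(5) by (simp add: el_basic(4))
      moreover have "of_int i \<in> pts q" using True ij by (auto simp: pts_def)
      ultimately show ?thesis using single by blast
    qed
  qed
qed

text \<open>Multiplication by \<open>t / q\<close> maps \<open>QI\<close> into \<open>OK\<close>,
  because \<open>t * t / q = r\<close>.\<close>

lemma t_over_q_in_J: "t / of_nat q \<in> J (card (pts q))"
proof -
  define F where "F = Polynomial.smult (t / of_nat q) (\<Prod>a\<in>pts q. [:- a, 1:])"
  have q0: "of_nat q \<noteq> (0::complex)" using pos by simp
  have c0: "t / of_nat q \<noteq> 0" using t_nz q0 by simp
  have tK: "t / of_nat q \<in> KE" unfolding divide_inverse by (intro KE_closed KE_inverse KE_basic)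
  have dp: "Polynomial.degree (\<Prod>a\<in>pts q. [:- a, 1:]) = card (pts q)"
    by (subst degree_prod_eq_sum_degree) auto
  have "monic (\<Prod>a\<in>pts q. [:- a, 1:])" by (rule monic_prod) auto
  hence lF: "lead_coeff F = t / of_nat q" unfolding F_def by (simp only: lead_coeff_smult mult_1_right)
  have dF: "Polynomial.degree F = card (pts q)" using dp c0 by (simp add: F_def)
  have cK: "\<forall>i. Polynomial.coeff (\<Prod>a\<in>B. [:- a, 1:]) i \<in> KE" if "B \<subseteq> pts q" for B
    using that
  proof (induction B rule: infinite_finite_induct)
    case (insert a B)
    have a: "a \<in> KE" using insert.prems pts_OK OK_KE by auto
    have "Polynomial.coeff ([:- a, 1:] * G) i \<in> KE" if "\<forall>i. Polynomial.coeff G i \<in> KE" for G i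
    proof -
      have "Polynomial.coeff ([:- a, 1:] * G) i = Polynomial.coeff (pCons 0 G) i - a * Polynomial.coeff G i"
        by simp
      moreover have "Polynomial.coeff (pCons 0 G) i \<in> KE" using that by (cases i) auto
      ultimately show ?thesis using that a by (simp add: KE_closed)
    qed
    thus ?case using insert by simp
  next
    case empty
    thus ?case by (simp add: Polynomial.coeff_1)
  next
    case (infinite A)
    thus ?case by (simp add: Polynomial.coeff_1)
  qed
  have "F \<in> int_valued_polys K"
    unfolding Int_iff
  proof (intro conjI allI ballI)
    show "Polynomial.coeff F i \<in> KE" for i
      unfolding F_def coeff_smult using cK[of "pts q"] tK by (intro KE_closed) auto
    fix x assume x: "x \<in> OK"
    have "poly F x = (t / of_nat q) * (\<Prod>a\<in>pts q. x - a)" by (simp add: F_def poly_prod)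
    moreover obtain u v where uv: "u \<in> OK" "v \<in> OK" "(\<Prod>a\<in>pts q. x - a) = of_nat q * u + t * v"
      using prod_pts_in_QI[OF x] by (auto simp: QI_def)
    ultimately have "poly F x = t * u + (t * t) / of_nat q * v" using q0 by (simp add: field_simps)
    also have "\<dots> = t * u + of_nat r * v" unfolding t_sq using q0 by simp
    also have "\<dots> \<in> OK" by (intro OK_closed uv OK_basic)
    finally show "poly F x \<in> OK" .
  qed
  from J_I[OF this dF] show ?thesis using lF by simp
qed

text \<open>Elements that are a rational number times \<open>t\<close> or its inverse are tested
  through their rational squares.\<close>

lemma square_rational_OK:
  assumes "x \<in> OK" "x * x = of_rat y" shows "y \<in> \<int>"
  using OK_rational[of y] OK_closed(4)[OF assms(1,1)] assms(2) by simp

text \<open>In the case \<open>T = OK\<close> the exponents of the primes above \<open>q\<close> and \<open>r\<close> in \<open>J n\<close> have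
  the same parity; but for \<open>n = card (pts q)\<close> they are \<open>- 1\<close> and \<open>0\<close>.\<close>

lemma J_not_principal:
  assumes less: "card (pts q) < card (pts r)" and g: "\<gamma> \<in> KE"
  shows "J (card (pts q)) \<noteq> (\<lambda>x. \<gamma> * x) ` OK"
proof
  define n where "n = card (pts q)"
  assume "J (card (pts q)) = (\<lambda>x. \<gamma> * x) ` OK"
  hence Jg: "J n = (\<lambda>x. \<gamma> * x) ` OK" by (simp add: n_def)
  obtain c \<alpha> \<alpha>' \<beta> T where c0: "c \<noteq> 0" and Z: "\<And>z. of_rat z \<in> J n \<longleftrightarrow> z / c \<in> \<int>"
    and A: "\<alpha>' \<in> OK" "\<alpha> * \<alpha>' = 1" "2 * of_nat p * \<alpha> \<in> OK"
    and B: "(T = OK \<and> \<beta> \<in> {1, inverse t}) \<or> (T = QI \<and> \<beta> \<in> {inverse (of_nat q), inverse t})"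
    and d: "of_rat c * \<alpha> * \<beta> \<in> KE" "of_rat c * \<alpha> * \<beta> \<noteq> 0"
    and JT: "J n = (\<lambda>x. of_rat c * \<alpha> * \<beta> * x) ` T"
    by (rule J_cases_invariant[of n]) (rule that, assumption+)
  have q0: "of_nat q \<noteq> (0::complex)" "of_nat q \<noteq> (0::rat)" using pos by auto
  have pqi: "Factorial_Ring.prime (int q)" "Factorial_Ring.prime (int r)" "Factorial_Ring.prime (int p)" using p q r by simp_all
  have nd: "\<not> int q dvd int r" "\<not> int r dvd int q" "\<not> int q dvd int p"
    using primes_dvd_imp_eq[OF q(1) r(1)] primes_dvd_imp_eq[OF r(1) q(1)] primes_dvd_imp_eq[OF q(1) p(1)] qr pq
    unfolding int_dvd_int_iff by auto
  define \<delta> where "\<delta> = of_rat c * \<alpha> * \<beta>"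
  have dK: "\<delta> \<in> KE" and d0: "\<delta> \<noteq> 0" using d by (simp_all add: \<delta>_def)
  from B show False
  proof
    assume "T = QI \<and> \<beta> \<in> {inverse (of_nat q), inverse t}"
    hence e: "(\<lambda>x. \<delta> * x) ` QI = (\<lambda>x. \<gamma> * x) ` OK" using JT Jg by (simp add: \<delta>_def)
    have "QI = (\<lambda>x. inverse \<delta> * x) ` (\<lambda>x. \<delta> * x) ` QI" using d0 by (simp add: image_image flip: mult.assoc)
    also have "\<dots> = (\<lambda>x. (inverse \<delta> * \<gamma>) * x) ` OK" unfolding e by (simp add: image_image mult.assoc)
    finally have "QI = (\<lambda>x. (inverse \<delta> * \<gamma>) * x) ` OK" .
    moreover have "inverse \<delta> * \<gamma> \<in> KE" by (intro KE_closed(4) KE_inverse dK g)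
    ultimately show False using QI_not_principal by blast
  next
    assume T: "T = OK \<and> \<beta> \<in> {1, inverse t}"
    \<comment> \<open>Since 1 lies in the ideal, \<open>c\<close> is the reciprocal of an integer
      \<open>k\<close>.\<close>
    have "1 / c \<in> \<int>" using Z[of 1] one_in_J by simp
    then obtain k where k: "1 / c = of_int k" by (auto elim: Ints_cases)
    have k0: "k \<noteq> 0" using k c0 by auto
    have ck: "c = 1 / of_int k" using k[symmetric] by simp
    have cJ: "of_rat c \<in> J n" using Z[of c] c0 by simp
    \<comment> \<open>The bound on denominators at \<open>q\<close> keeps \<open>q\<close> out of
      \<open>k\<close>: a factor \<open>q\<close> in \<open>k\<close> could not be compensated by
      \<open>t\<close>, whose square contains \<open>q\<close> only once.\<close>
    have "t * of_rat c \<in> Loc q" using t_J_Loc cJ by (simp add: n_def)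
    then obtain M where M: "\<not> int q dvd M" "of_int M * (t * of_rat c) \<in> OK" by (auto simp: Loc_def)
    have "(of_int M * (t * of_rat c)) * (of_int M * (t * of_rat c)) = of_rat (of_int M * of_int M * c * c * of_nat q * of_nat r)"
    proof -
      have "(of_int M * (t * of_rat c)) * (of_int M * (t * of_rat c)) = of_int M * of_int M * of_rat c * of_rat c * (t * t)"
        by (simp only: mult_ac)
      thus ?thesis unfolding t_sq by (simp add: of_rat_mult)
    qed
    from square_rational_OK[OF M(2) this]
    obtain z where "of_int M * of_int M * c * c * of_nat q * of_nat r = of_int z" by (auto elim: Ints_cases)
    hence "of_int (M * M * int q * int r) = (of_int (z * k * k) :: rat)" using k0 by (simp add: ck field_simps)
    hence Mk: "M * M * int q * int r = z * k * k" by (simp only: of_int_eq_iff)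
    have nqk: "\<not> int q dvd k"
    proof
      assume "int q dvd k"
      then obtain k' where k': "k = int q * k'" by (auto elim: dvdE)
      have "int q * (M * M * int r) = int q * (int q * (z * k' * k'))" using Mk by (simp add: k' algebra_simps)
      hence "M * M * int r = int q * (z * k' * k')" using pos by simp
      hence "int q dvd M * M * int r" by simp
      thus False using M(1) nd pqi by (simp add: prime_dvd_mult_iff)
    qed
    show False
    proof (cases "\<beta> = 1")
      case True
      \<comment> \<open>With \<open>\<beta> = 1\<close> the ideal is generated by
        \<open>\<alpha> / k\<close>, and \<open>2 * p * \<alpha>\<close> is integral. So
        \<open>2 * p * k * t / q\<close> would be integral, but its square has \<open>q\<close> in
        the denominator.\<close>
      have "t / of_nat q \<in> J n" using t_over_q_in_J by (simp add: n_def)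
      then obtain w where w: "w \<in> OK" "t / of_nat q = of_rat c * \<alpha> * w" using JT T True by auto
      have "of_rat c * of_int k = (1::complex)" using k0 by (simp add: ck of_rat_divide)
      hence "(2 * of_nat p * \<alpha>) * w = 2 * of_nat p * of_int k * (of_rat c * \<alpha> * w)" by (simp add: mult_ac)
      also have "\<dots> = 2 * of_nat p * of_int k * (t / of_nat q)" unfolding w(2) ..
      finally have 1: "2 * of_nat p * of_int k * (t / of_nat q) \<in> OK" using OK_closed(4)[OF A(3) w(1)] by simp
      have "(2 * of_nat p * of_int k * (t / of_nat q)) * (2 * of_nat p * of_int k * (t / of_nat q))
        = 4 * of_nat p * of_nat p * of_int k * of_int k * (t * t) / (of_nat q * of_nat q)" by simp
      also have "\<dots> = of_rat (4 * of_nat p * of_nat p * of_int k * of_int k * of_nat r / of_nat q)"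
        unfolding t_sq using q0 by (simp add: of_rat_mult of_rat_divide)
      finally have "4 * of_nat p * of_nat p * of_int k * of_int k * of_nat r / of_nat q \<in> (\<int> :: rat set)"
        using square_rational_OK[OF 1] by blast
      then obtain z where "4 * of_nat p * of_nat p * of_int k * of_int k * of_nat r / of_nat q = (of_int z :: rat)"
        by (auto elim: Ints_cases)
      hence "of_int (2 * 2 * int p * int p * k * k * int r) = (of_int (z * int q) :: rat)" using q0 by (simp add: field_simps)
      hence "2 * 2 * int p * int p * k * k * int r = z * int q" by (simp only: of_int_eq_iff)
      hence "int q dvd 2 * 2 * int p * int p * k * k * int r" by simp
      hence "int q dvd 2" using nd nqk unfolding prime_dvd_mult_iff[OF pqi(1)] by blast
      hence "q dvd 2" by (metis int_dvd_int_iff of_nat_numeral)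
      hence "q = 2" by (rule primes_dvd_imp_eq[OF q(1) two_is_prime_nat])
      thus False using q_odd by simp
    next
      case False
      hence bt: "\<beta> = inverse t" using T by auto
      \<comment> \<open>With \<open>\<beta> = 1 / t\<close> the generator has \<open>t\<close> in
        the denominator, hence \<open>r\<close> in that of its square, although at \<open>r\<close>
        the degree is still below the number of residues. Multiplying by \<open>\<alpha>'\<close>
        removes \<open>\<alpha>\<close> first.\<close>
      have "of_rat c * \<alpha> * \<beta> * 1 \<in> J n" unfolding JT using T by (intro imageI) simp
      hence "of_rat c * \<alpha> * \<beta> \<in> Loc r" using J_Loc[OF r(1)] less by (simp add: n_def)
      hence "of_rat c * \<alpha> * \<beta> * \<alpha>' \<in> Loc r" using Loc_closed(2)[OF r(1)] OK_Loc[OF r(1) A(1)] by blast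
      moreover have "of_rat c * \<alpha> * \<beta> * \<alpha>' = of_rat c * \<beta> * (\<alpha> * \<alpha>')" by (simp only: mult_ac)
      ultimately have "of_rat c * \<beta> * 1 \<in> Loc r" using A(2) by (simp only:)
      hence "of_rat c * inverse t \<in> Loc r" using bt by simp
      then obtain N where N: "\<not> int r dvd N" "of_int N * (of_rat c * inverse t) \<in> OK" by (auto simp: Loc_def)
      have r0: "of_nat r \<noteq> (0::complex)" "of_nat r \<noteq> (0::rat)" using pos by auto
      have "(of_int N * (of_rat c * inverse t)) * (of_int N * (of_rat c * inverse t))
          = of_int N * of_int N * of_rat c * of_rat c * inverse (t * t)" by simp
      also have "\<dots> = of_rat (of_int N * of_int N * c * c / (of_nat q * of_nat r))"
        unfolding t_sq by (simp add: of_rat_mult of_rat_divide divide_inverse of_rat_inverse)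
      finally have "of_int N * of_int N * c * c / (of_nat q * of_nat r) \<in> \<int>"
        using square_rational_OK[OF N(2)] by blast
      then obtain z where "of_int N * of_int N * c * c / (of_nat q * of_nat r) = of_int z" by (auto elim: Ints_cases)
      hence "of_int (N * N) = (of_int (z * k * k * int q * int r) :: rat)" using k0 q0 r0 by (simp add: ck field_simps)
      hence "N * N = z * k * k * int q * int r" by (simp only: of_int_eq_iff)
      hence "int r dvd N * N" by simp
      thus False using N(1) pqi by (simp add: prime_dvd_mult_iff)
    qed
  qed
qed

end

subsection \<open>Products of fractional ideals\<close>

abbreviation ideal_mult :: "complex set \<Rightarrow> complex set \<Rightarrow> complex set" (infixl "\<odot>" 70) where
  "ideal_mult \<equiv> ideal_prod complex_field"

lemma ideal_mult_prod: "i \<in> A \<Longrightarrow> j \<in> B \<Longrightarrow> i * j \<in> A \<odot> B"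
  using ideal_prod.prod[of i A j B complex_field] by (simp add: ring_of_type_algebra_def)

lemma ideal_mult_add: "x \<in> A \<odot> B \<Longrightarrow> y \<in> A \<odot> B \<Longrightarrow> x + y \<in> A \<odot> B"
  using ideal_prod.sum[of x complex_field A B y] by (simp add: ring_of_type_algebra_def)

lemma ideal_mult_least:
  assumes "\<And>i j. i \<in> A \<Longrightarrow> j \<in> B \<Longrightarrow> i * j \<in> M" "\<And>x y. x \<in> M \<Longrightarrow> y \<in> M \<Longrightarrow> x + y \<in> M"
  shows "A \<odot> B \<subseteq> M"
proof
  fix x assume "x \<in> A \<odot> B"
  thus "x \<in> M"
    by (induction rule: ideal_prod.induct) (use assms in \<open>simp_all add: ring_of_type_algebra_def\<close>)
qed

lemma ideal_mult_comm: "A \<odot> B = B \<odot> A"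
proof -
  have "A \<odot> B \<subseteq> B \<odot> A" for A B
    by (rule ideal_mult_least) (simp_all add: ideal_mult_add, subst mult.commute, rule ideal_mult_prod)
  thus ?thesis by blast
qed

lemma ideal_mult_assoc: "(A \<odot> B) \<odot> C = A \<odot> (B \<odot> C)"
proof -
  have 1: "A \<odot> (B \<odot> C) \<subseteq> (A \<odot> B) \<odot> C" for A B C
  proof (rule ideal_mult_least)
    fix a x assume a: "a \<in> A" and x: "x \<in> B \<odot> C"
    have "B \<odot> C \<subseteq> {x. a * x \<in> (A \<odot> B) \<odot> C}"
    proof (rule ideal_mult_least)
      fix b c assume "b \<in> B" "c \<in> C"
      thus "b * c \<in> {x. a * x \<in> (A \<odot> B) \<odot> C}"
        using ideal_mult_prod[OF ideal_mult_prod[OF a, of b B], of c C] by (simp add: mult.assoc)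
    qed (simp add: distrib_left ideal_mult_add)
    thus "a * x \<in> (A \<odot> B) \<odot> C" using x by blast
  qed (rule ideal_mult_add)
  \<comment> \<open>The other inclusion is the one just proved, read with the factors in reverse
    order.\<close>
  have "(A \<odot> B) \<odot> C = C \<odot> (B \<odot> A)" by (metis ideal_mult_comm)
  also have "\<dots> \<subseteq> (C \<odot> B) \<odot> A" by (rule 1)
  also have "\<dots> = A \<odot> (B \<odot> C)" by (metis ideal_mult_comm)
  finally show ?thesis using 1 by blast
qed

lemma ideal_mult_scale: "((\<lambda>x. a * x) ` A) \<odot> ((\<lambda>x. b * x) ` B) = (\<lambda>x. (a * b) * x) ` (A \<odot> B)"
proof
  show "((\<lambda>x. a * x) ` A) \<odot> ((\<lambda>x. b * x) ` B) \<subseteq> (\<lambda>x. (a * b) * x) ` (A \<odot> B)"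
  proof (rule ideal_mult_least)
    fix i j assume "i \<in> (\<lambda>x. a * x) ` A" "j \<in> (\<lambda>x. b * x) ` B"
    then obtain i' j' where ij: "i' \<in> A" "i = a * i'" "j' \<in> B" "j = b * j'" by blast
    have "i * j = (a * b) * (i' * j')" by (simp add: ij mult_ac)
    thus "i * j \<in> (\<lambda>x. (a * b) * x) ` (A \<odot> B)" using ideal_mult_prod[OF ij(1,3)] by blast
  next
    fix x y assume "x \<in> (\<lambda>x. (a * b) * x) ` (A \<odot> B)" "y \<in> (\<lambda>x. (a * b) * x) ` (A \<odot> B)"
    then obtain x' y' where xy: "x' \<in> A \<odot> B" "x = (a * b) * x'" "y' \<in> A \<odot> B" "y = (a * b) * y'" by blast
    have "x + y = (a * b) * (x' + y')" by (simp add: xy distrib_left)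
    thus "x + y \<in> (\<lambda>x. (a * b) * x) ` (A \<odot> B)" using ideal_mult_add[OF xy(1,3)] by blast
  qed
  have "A \<odot> B \<subseteq> {x. (a * b) * x \<in> ((\<lambda>x. a * x) ` A) \<odot> ((\<lambda>x. b * x) ` B)}"
  proof (rule ideal_mult_least)
    fix i j assume "i \<in> A" "j \<in> B"
    hence "(a * i) * (b * j) \<in> ((\<lambda>x. a * x) ` A) \<odot> ((\<lambda>x. b * x) ` B)" by (intro ideal_mult_prod) auto
    moreover have "(a * b) * (i * j) = (a * i) * (b * j)" by (simp add: mult_ac)
    ultimately show "i * j \<in> {x. (a * b) * x \<in> ((\<lambda>x. a * x) ` A) \<odot> ((\<lambda>x. b * x) ` B)}"
      by (simp only: mem_Collect_eq)
  qed (simp add: distrib_left ideal_mult_add)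
  thus "(\<lambda>x. (a * b) * x) ` (A \<odot> B) \<subseteq> ((\<lambda>x. a * x) ` A) \<odot> ((\<lambda>x. b * x) ` B)" by blast
qed

context biquadratic
begin

lemma OK_ideal_mult: "module M \<Longrightarrow> OK \<odot> M = M"
proof
  assume M: "module M"
  show "OK \<odot> M \<subseteq> M" by (rule ideal_mult_least) (auto intro: module_mult[OF M] module_add[OF M])
  show "M \<subseteq> OK \<odot> M" using ideal_mult_prod[of 1 OK _ M] by auto
qed

lemma QI_ideal_mult: "QI \<odot> QI = (\<lambda>x. of_nat q * x) ` OK"
proof
  have m: "module ((\<lambda>x. of_nat q * x) ` OK)" by (intro module_scale module_OK KE_basic)
  show "QI \<odot> QI \<subseteq> (\<lambda>x. of_nat q * x) ` OK"
  proof (rule ideal_mult_least)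
    fix i j assume "i \<in> QI" "j \<in> QI"
    then obtain c where "c \<in> OK" "i * j = of_nat q * c" by (rule QI_mult)
    thus "i * j \<in> (\<lambda>x. of_nat q * x) ` OK" by blast
  qed (rule module_add[OF m])
  show "(\<lambda>x. of_nat q * x) ` OK \<subseteq> QI \<odot> QI"
  proof
    fix y assume "y \<in> (\<lambda>x. of_nat q * x) ` OK"
    then obtain x where x: "x \<in> OK" "y = of_nat q * x" by blast
    obtain A B where AB: "int q * A + int r * B = 1" using coprime_bezout .
    have "y = of_int (int q * A + int r * B) * (of_nat q * x)" unfolding AB x(2) by simp
    also have "\<dots> = of_nat q * (of_int A * x * of_nat q) + (t * t) * (of_int B * x)"
      unfolding t_sq by (simp add: algebra_simps)
    also have "\<dots> = of_nat q * (of_int A * x * of_nat q) + t * (of_int B * x * t)" by (simp only: mult_ac)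
    also have "\<dots> \<in> QI \<odot> QI"
      by (intro ideal_mult_add ideal_mult_prod q_in_QI t_in_QI QI_closed(2) OK_closed(4) x OK_basic)
    finally show "y \<in> QI \<odot> QI" .
  qed
qed

subsection \<open>Ideal classes\<close>

text \<open>For a module this is its ideal class as a coset (\<open>ideal_class_eq\<close>), in a
  form that needs no ideal products.\<close>

definition scalings :: "complex set \<Rightarrow> complex set set" where
  "scalings I = {(\<lambda>x. a * x) ` I | a. a \<in> KE \<and> a \<noteq> 0}"

lemma scalings_self: "I \<in> scalings I"
  unfolding scalings_def using KE_basic(6) by (auto intro!: exI[of _ 1])

lemma scalings_scale:
  assumes "c \<in> KE" "c \<noteq> 0"
  shows "scalings ((\<lambda>x. c * x) ` I) = scalings I"
proof (intro equalityI subsetI)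
  fix A assume "A \<in> scalings ((\<lambda>x. c * x) ` I)"
  then obtain a where a: "a \<in> KE" "a \<noteq> 0" "A = (\<lambda>x. a * x) ` (\<lambda>x. c * x) ` I" by (auto simp: scalings_def)
  have "A = (\<lambda>x. (a * c) * x) ` I" unfolding a(3) by (simp add: image_image mult.assoc)
  moreover have "a * c \<in> KE" "a * c \<noteq> 0" using a assms by (simp_all add: KE_closed)
  ultimately show "A \<in> scalings I" unfolding scalings_def by blast
next
  fix A assume "A \<in> scalings I"
  then obtain a where a: "a \<in> KE" "a \<noteq> 0" "A = (\<lambda>x. a * x) ` I" by (auto simp: scalings_def)
  have "A = (\<lambda>x. (a * inverse c) * x) ` (\<lambda>x. c * x) ` I" 
  proof -
    have "(\<lambda>x. (a * inverse c) * x) ` (\<lambda>x. c * x) ` I = (\<lambda>x. a * (inverse c * (c * x))) ` I"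
      by (simp only: image_image mult.assoc)
    also have "\<dots> = (\<lambda>x. a * x) ` I" using assms(2) by (intro image_cong refl) simp
    finally show ?thesis unfolding a(3) ..
  qed
  moreover have "a * inverse c \<in> KE" "a * inverse c \<noteq> 0" using a assms by (simp_all add: KE_closed KE_inverse)
  ultimately show "A \<in> scalings ((\<lambda>x. c * x) ` I)" unfolding scalings_def by blast
qed

lemma principal_eq: "principal_fractional_ideals K = scalings OK"
  by (simp add: principal_fractional_ideals_def scalings_def K_eq)

lemma ideal_class_eq:
  assumes "module I" shows "ideal_class K I = scalings I"
proof -
  have "((\<lambda>x. a * x) ` OK) \<odot> I = (\<lambda>x. a * x) ` I" for a
    using ideal_mult_scale[of a OK 1 I] OK_ideal_mult[OF assms] by simp
  thus ?thesis
    unfolding ideal_class_def r_coset_def principal_eq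
    by (auto simp: scalings_def fractional_ideal_group_def)
qed

lemma set_mult_scalings: "set_mult (fractional_ideal_group K) (scalings A) (scalings B) = scalings (A \<odot> B)"
proof (intro equalityI subsetI)
  fix C assume "C \<in> set_mult (fractional_ideal_group K) (scalings A) (scalings B)"
  then obtain a b where ab: "a \<in> KE" "a \<noteq> 0" "b \<in> KE" "b \<noteq> 0"
    "C = ((\<lambda>x. a * x) ` A) \<odot> ((\<lambda>x. b * x) ` B)"
    by (auto simp: set_mult_def scalings_def fractional_ideal_group_def)
  have "C = (\<lambda>x. (a * b) * x) ` (A \<odot> B)" unfolding ab(5) by (rule ideal_mult_scale)
  moreover have "a * b \<in> KE" "a * b \<noteq> 0" using ab by (simp_all add: KE_closed)
  ultimately show "C \<in> scalings (A \<odot> B)" unfolding scalings_def by blast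
next
  fix C assume "C \<in> scalings (A \<odot> B)"
  then obtain a where a: "a \<in> KE" "a \<noteq> 0" "C = (\<lambda>x. (a * 1) * x) ` (A \<odot> B)" by (auto simp: scalings_def)
  hence "C = ((\<lambda>x. a * x) ` A) \<odot> ((\<lambda>x. 1 * x) ` B)" by (simp only: ideal_mult_scale)
  moreover have "(\<lambda>x. a * x) ` A \<in> scalings A" "(\<lambda>x. 1 * x) ` B \<in> scalings B"
    using a scalings_self by (auto simp: scalings_def)
  ultimately show "C \<in> set_mult (fractional_ideal_group K) (scalings A) (scalings B)"
    by (auto simp: set_mult_def fractional_ideal_group_def)
qed

lemma fractional_ideal_module: "I \<in> fractional_ideals K \<Longrightarrow> module I"
  by (auto simp: fractional_ideals_def module_def K_eq)

lemma QI_fractional: "QI \<in> fractional_ideals K" and OK_fractional: "OK \<in> fractional_ideals K"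
proof -
  have "0 \<in> QI" using QI_I[of 0 0] by simp
  moreover have "of_nat q \<noteq> (0::complex)" using pos by simp
  ultimately show "QI \<in> fractional_ideals K"
    using q_in_QI QI_subset_OK QI_closed OK_KE OK_basic(5)
    by (auto simp: fractional_ideals_def K_eq intro!: bexI[of _ 1])
  have "(1::complex) \<in> OK" "(1::complex) \<noteq> 0" by simp_all
  thus "OK \<in> fractional_ideals K"
    using OK_closed OK_KE OK_basic(6)
    by (auto simp: fractional_ideals_def K_eq intro!: bexI[of _ 1])
qed

lemma class_group_simps:
  "carrier (class_group K) = {scalings I | I. I \<in> fractional_ideals K}"
  "one (class_group K) = scalings OK"
  "monoid.mult (class_group K) (scalings A) (scalings B) = scalings (A \<odot> B)"
proof -
  have "scalings OK #>\<^bsub>fractional_ideal_group K\<^esub> I = scalings I" if "I \<in> fractional_ideals K" for I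
    using ideal_class_eq[OF fractional_ideal_module[OF that]] by (simp add: ideal_class_def principal_eq)
  thus "carrier (class_group K) = {scalings I | I. I \<in> fractional_ideals K}"
    by (auto simp: class_group_def FactGroup_def RCOSETS_def principal_eq fractional_ideal_group_def)
  show "one (class_group K) = scalings OK" by (simp add: class_group_def FactGroup_def principal_eq)
  show "monoid.mult (class_group K) (scalings A) (scalings B) = scalings (A \<odot> B)"
    by (simp add: class_group_def FactGroup_def set_mult_scalings)
qed

lemma scalings_mult_table:
  "scalings OK = scalings (OK \<odot> OK)" "scalings QI = scalings (OK \<odot> QI)"
  "scalings QI = scalings (QI \<odot> OK)" "scalings OK = scalings (QI \<odot> QI)"
proof -
  show "scalings OK = scalings (OK \<odot> OK)" "scalings QI = scalings (OK \<odot> QI)"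
    using OK_ideal_mult module_OK module_QI by simp_all
  thus "scalings QI = scalings (QI \<odot> OK)" by (simp add: ideal_mult_comm)
  show "scalings OK = scalings (QI \<odot> QI)"
    unfolding QI_ideal_mult using pos by (subst scalings_scale) auto
qed

text \<open>\<open>m_inv\<close> is a definite description, so uniqueness is checked directly: if
  \<open>QI\<close> times \<open>I\<close> is generated by \<open>a\<close>, another multiplication
  by \<open>QI\<close> turns this into \<open>q * I = a * QI\<close>, and \<open>I\<close> lies in
  the class of \<open>QI\<close>.\<close>

lemma class_inverse:
  "m_inv (class_group K) (scalings OK) = scalings OK"
  "m_inv (class_group K) (scalings QI) = scalings QI"
proof -
  show "m_inv (class_group K) (scalings OK) = scalings OK"
    unfolding m_inv_def
  proof (rule the_equality)
    fix y assume y: "y \<in> carrier (class_group K) \<and> monoid.mult (class_group K) (scalings OK) y = one (class_group K)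
      \<and> monoid.mult (class_group K) y (scalings OK) = one (class_group K)"
    then obtain I where I: "y = scalings I" "I \<in> fractional_ideals K" unfolding class_group_simps by blast
    hence "scalings (OK \<odot> I) = scalings OK" using y by (simp add: class_group_simps)
    thus "y = scalings OK" using OK_ideal_mult[OF fractional_ideal_module[OF I(2)]] I(1) by simp
  qed (use scalings_mult_table(1)[symmetric] OK_fractional in \<open>unfold class_group_simps, blast\<close>)
  show "m_inv (class_group K) (scalings QI) = scalings QI"
    unfolding m_inv_def
  proof (rule the_equality)
    fix y assume y: "y \<in> carrier (class_group K) \<and> monoid.mult (class_group K) (scalings QI) y = one (class_group K)
      \<and> monoid.mult (class_group K) y (scalings QI) = one (class_group K)"
    then obtain I where I: "y = scalings I" "I \<in> fractional_ideals K" unfolding class_group_simps by blast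
    have M: "module I" by (rule fractional_ideal_module[OF I(2)])
    have "scalings (QI \<odot> I) = scalings OK" using y I by (simp add: class_group_simps)
    hence "QI \<odot> I \<in> scalings OK" using scalings_self by blast
    then obtain a where a: "a \<in> KE" "a \<noteq> 0" "QI \<odot> I = (\<lambda>x. a * x) ` OK" by (auto simp: scalings_def)
    have "(\<lambda>x. (of_nat q * 1) * x) ` (OK \<odot> I) = (QI \<odot> QI) \<odot> I"
      unfolding QI_ideal_mult using ideal_mult_scale[of "of_nat q" OK 1 I] by simp
    also have "\<dots> = QI \<odot> (\<lambda>x. a * x) ` OK" unfolding ideal_mult_assoc a(3) ..
    also have "\<dots> = (\<lambda>x. a * x) ` QI"
      using ideal_mult_scale[of 1 QI a OK] OK_ideal_mult[OF module_QI] by (simp add: ideal_mult_comm)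
    finally have "(\<lambda>x. of_nat q * x) ` I = (\<lambda>x. a * x) ` QI" using OK_ideal_mult[OF M] by simp
    hence "scalings ((\<lambda>x. of_nat q * x) ` I) = scalings ((\<lambda>x. a * x) ` QI)" by simp
    moreover have "scalings ((\<lambda>x. of_nat q * x) ` I) = scalings I" using pos by (intro scalings_scale) auto
    moreover have "scalings ((\<lambda>x. a * x) ` QI) = scalings QI" using a by (intro scalings_scale)
    ultimately show "y = scalings QI" using I(1) by simp
  qed (use scalings_mult_table(4)[symmetric] QI_fractional in \<open>unfold class_group_simps, blast\<close>)
qed

lemma OK_QI_classes_distinct: "scalings OK \<noteq> scalings QI"
proof
  assume "scalings OK = scalings QI"
  hence "QI \<in> scalings OK" using scalings_self by blast
  thus False using QI_not_principal by (auto simp: scalings_def)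
qed

section \<open>Classes of the characteristic ideals and regular bases\<close>

lemma class_J: 
  "ideal_class K (J n) = scalings OK \<or> ideal_class K (J n) = scalings QI"
  "ideal_class K (J n) = scalings OK \<longleftrightarrow> (\<exists>\<gamma>\<in>KE. J n = (\<lambda>x. \<gamma> * x) ` OK)"
proof -
  have cl: "ideal_class K (J n) = scalings (J n)" by (rule ideal_class_eq[OF module_J])
  obtain \<delta> T where "\<delta> \<in> KE" "\<delta> \<noteq> 0" "J n = (\<lambda>x. \<delta> * x) ` T" and T: "T = OK \<or> T = QI"
    by (rule J_cases_invariant[of n]) blast
  hence "scalings (J n) = scalings T" using scalings_scale by simp
  thus "ideal_class K (J n) = scalings OK \<or> ideal_class K (J n) = scalings QI" using cl T by auto
  show "ideal_class K (J n) = scalings OK \<longleftrightarrow> (\<exists>\<gamma>\<in>KE. J n = (\<lambda>x. \<gamma> * x) ` OK)"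
  proof
    assume "ideal_class K (J n) = scalings OK"
    hence "J n \<in> scalings OK" using cl scalings_self by blast
    thus "\<exists>\<gamma>\<in>KE. J n = (\<lambda>x. \<gamma> * x) ` OK" by (auto simp: scalings_def)
  next
    assume "\<exists>\<gamma>\<in>KE. J n = (\<lambda>x. \<gamma> * x) ` OK"
    then obtain \<gamma> where g: "\<gamma> \<in> KE" "J n = (\<lambda>x. \<gamma> * x) ` OK" by blast
    have "\<gamma> \<noteq> 0" using one_in_J[of n] g(2) by auto
    hence "scalings (J n) = scalings OK" unfolding g(2) using g(1) by (intro scalings_scale)
    thus "ideal_class K (J n) = scalings OK" using cl by simp
  qed
qed

text \<open>Distinct degrees prevent cancellation at the top: in the expansion of a polynomial of
  degree \<open>n\<close> the basis elements beyond \<open>n\<close> do not occur, so its leading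
  coefficient is an integral multiple of that of \<open>f n\<close>.\<close>

lemma regular_basis_principal:
  assumes f: "regular_basis K f" and n: "n \<ge> 1"
  shows "\<exists>\<gamma>\<in>KE. J n = (\<lambda>x. \<gamma> * x) ` OK"
proof
  have fI: "f j \<in> int_valued_polys K" and deg: "Polynomial.degree (f j) = j" for j
    using f by (auto simp: regular_basis_def int_valued_basis_def)
  have rep: "\<exists>c. (\<forall>j. c j \<in> OK) \<and> finite {j. c j \<noteq> 0} \<and> g = (\<Sum>j | c j \<noteq> 0. Polynomial.smult (c j) (f j))"
    if "g \<in> int_valued_polys K" for g
    using f that unfolding regular_basis_def int_valued_basis_def by blast
  show "lead_coeff (f n) \<in> KE" using fI[of n] by (simp add: Int_iff)
  show "J n = (\<lambda>x. lead_coeff (f n) * x) ` OK"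
  proof
    show "(\<lambda>x. lead_coeff (f n) * x) ` OK \<subseteq> J n"
      using module_mult[OF module_J _ J_I[OF fI deg]] by (auto simp: mult.commute)
    show "J n \<subseteq> (\<lambda>x. lead_coeff (f n) * x) ` OK"
    proof
      fix x assume x: "x \<in> J n"
      show "x \<in> (\<lambda>x. lead_coeff (f n) * x) ` OK"
      proof (cases "x = 0")
        case True
        thus ?thesis by (auto intro!: image_eqI[of _ _ 0])
      next
        case False
        obtain g where g: "g \<in> int_valued_polys K" "Polynomial.degree g = n" "x = lead_coeff g"
          using J_cases[OF x False] .
        obtain c where c: "\<And>j. c j \<in> OK" "finite {j. c j \<noteq> 0}"
          "g = (\<Sum>j | c j \<noteq> 0. Polynomial.smult (c j) (f j))" using rep[OF g(1)] by blast
        define S where "S = {j. c j \<noteq> 0}"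
        have S: "finite S" using c(2) by (simp add: S_def)
        \<comment> \<open>Used twice: with the largest index to bound the support, then with
          \<open>n\<close> to read off the leading coefficient.\<close>
        have top: "Polynomial.coeff g m = c m * lead_coeff (f m)" if m: "\<And>j. j \<in> S \<Longrightarrow> j \<le> m" for m
        proof -
          have "Polynomial.coeff g m = (\<Sum>j\<in>S. c j * Polynomial.coeff (f j) m)"
            unfolding c(3) S_def by (simp add: coeff_sum)
          also have "\<dots> = (\<Sum>j\<in>S. if j = m then c m * lead_coeff (f m) else 0)"
            using m deg by (intro sum.cong refl) (auto intro!: coeff_eq_0 simp: le_neq_implies_less)
          also have "\<dots> = c m * lead_coeff (f m)" using S by (auto simp: S_def)
          finally show ?thesis .
        qed
        have "j \<le> n" if j: "j \<in> S" for j
        proof (rule ccontr)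
          assume "\<not> j \<le> n"
          define m where "m = Max S"
          have m: "m \<in> S" "j \<le> m" unfolding m_def using S j by (auto intro: Max_in)
          have "Polynomial.coeff g m = c m * lead_coeff (f m)" using S by (intro top) (simp add: m_def)
          moreover have "Polynomial.coeff g m = 0" using g(2) m \<open>\<not> j \<le> n\<close> by (intro coeff_eq_0) simp
          moreover have "f m \<noteq> 0" using deg[of m] m \<open>\<not> j \<le> n\<close> by auto
          ultimately show False using m(1) by (simp add: S_def)
        qed
        hence "x = c n * lead_coeff (f n)" using top[of n] g by simp
        thus ?thesis using c(1) by (auto simp: mult.commute)
      qed
    qed
  qed
qed

lemma polya_group_of_order_two:
  assumes n: "n \<ge> 1" and np: "\<And>\<gamma>. \<gamma> \<in> KE \<Longrightarrow> J n \<noteq> (\<lambda>x. \<gamma> * x) ` OK"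
  shows "polya_group K \<cong> integer_mod_group 2 \<and> \<not> polya_field K"
proof
  define C1 where "C1 = scalings OK"
  define C2 where "C2 = scalings QI"
  define G where "G = {ideal_class K (J n) | n. n \<ge> 1}"
  have C12: "C1 \<noteq> C2" using OK_QI_classes_distinct by (simp add: C1_def C2_def)
  have G2: "C2 \<in> G" using class_J[of n] np n unfolding G_def C2_def by blast
  have GC: "G \<subseteq> {C1, C2}" using class_J(1) unfolding G_def C1_def C2_def by blast
  have mult: "monoid.mult (class_group K) C1 C1 = C1" "monoid.mult (class_group K) C1 C2 = C2"
    "monoid.mult (class_group K) C2 C1 = C2" "monoid.mult (class_group K) C2 C2 = C1"
    unfolding C1_def C2_def class_group_simps using scalings_mult_table by simp_all
  have inv: "m_inv (class_group K) C1 = C1" "m_inv (class_group K) C2 = C2"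
    unfolding C1_def C2_def by (rule class_inverse)+
  have one: "one (class_group K) = C1" by (simp add: C1_def class_group_simps)
  have gen: "generate (class_group K) G = {C1, C2}"
  proof
    show "generate (class_group K) G \<subseteq> {C1, C2}"
    proof
      fix x assume "x \<in> generate (class_group K) G"
      thus "x \<in> {C1, C2}"
        by (induction rule: generate.induct) (use GC inv mult one in auto)
    qed
    show "{C1, C2} \<subseteq> generate (class_group K) G"
      using generate.one[of "class_group K" G] generate.incl[OF G2, of "class_group K"] one by simp
  qed
  define h :: "complex set set \<Rightarrow> int" where "h = (\<lambda>x. if x = C1 then 0 else 1)"
  have "h \<in> iso (polya_group K) (integer_mod_group 2)"
  proof (rule isoI)
    show "h \<in> hom (polya_group K) (integer_mod_group 2)"
      unfolding hom_def polya_group_def G_def[symmetric] gen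
      using mult C12 by (auto simp: h_def integer_mod_group_def)
    have "{0..<2} = {0, 1::int}" by auto
    thus "bij_betw h (carrier (polya_group K)) (carrier (integer_mod_group 2))"
      unfolding polya_group_def G_def[symmetric] gen
      using C12 by (auto simp: h_def bij_betw_def integer_mod_group_def)
  qed
  thus "polya_group K \<cong> integer_mod_group 2" by (auto simp: is_iso_def)
  show "\<not> polya_field K" using regular_basis_principal n np unfolding polya_field_def by blast
qed

lemma biquadratic_swap: "biquadratic p r q"
  using p q r pq pr qr nqr nrq by unfold_locales auto

text \<open>One count is \<open>q\<close> or its square, the other \<open>r\<close> or its square,
  and \<open>q\<close> and \<open>r\<close> are distinct primes.\<close>

lemma card_pts_distinct: "card (pts q) \<noteq> card (pts r)"
proof -
  have "q \<noteq> r * r" "r \<noteq> q * q"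
    using primes_dvd_imp_eq[OF r(1) q(1)] primes_dvd_imp_eq[OF q(1) r(1)] qr by auto
  moreover have "q * q \<noteq> r * r"
    using prime_dvd_mult_iff[OF q(1), of r r] primes_dvd_imp_eq[OF q(1) r(1)] qr by (metis dvd_triv_left)
  ultimately show ?thesis using qr by (simp add: card_pts)
qed

lemma card_pts_pos: "card (pts l) \<ge> 1" if "l > 0"
  using that by (simp add: card_pts)

end

theorem theorem1:
  fixes p q r :: nat
  assumes "Factorial_Ring.prime p" and "Factorial_Ring.prime q" and "Factorial_Ring.prime r"
    and "p \<noteq> q" and "p \<noteq> r" and "q \<noteq> r"
    and "[p = 3] (mod 4)" and "[q = 1] (mod 8)" and "[r = 1] (mod 8)"
    and "Legendre (int q) (int r) = -1"
  shows "polya_group (biquadratic_field p (q * r)) \<cong> integer_mod_group 2 \<and>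
         \<not> polya_field (biquadratic_field p (q * r))"
proof -
  have q2: "2 < q" and r2: "2 < r"
    using assms(2,3,8,9) prime_ge_2_nat[of q] prime_ge_2_nat[of r]
    by (auto simp: unique_euclidean_semiring_class.cong_def intro!: le_neq_implies_less)
  have nqr: "\<not> QuadRes (int r) (int q)"
    using assms(10) unfolding Legendre_def by (auto split: if_splits)
  have nrq: "\<not> QuadRes (int q) (int r)"
  proof -
    have "even ((q - 1) div 2)" using assms(8)
      by (simp add: unique_euclidean_semiring_class.cong_def) presburger
    hence "even ((q - 1) div 2 * ((r - 1) div 2))" by simp
    hence "Legendre (int q) (int r) * Legendre (int r) (int q) = 1"
      using Quadratic_Reciprocity[OF assms(2) q2 assms(3) r2 assms(6)] by simp
    hence "Legendre (int r) (int q) = - 1" using assms(10) by simp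
    thus ?thesis unfolding Legendre_def by (auto split: if_splits)
  qed
  interpret A: biquadratic p q r by unfold_locales (fact assms nqr nrq)+
  interpret B: biquadratic p r q by (rule A.biquadratic_swap)
  consider "card (A.pts q) < card (A.pts r)" | "card (A.pts r) < card (A.pts q)"
    using A.card_pts_distinct by linarith
  thus ?thesis
  proof cases
    case 1
    show ?thesis
      by (rule A.polya_group_of_order_two[OF A.card_pts_pos[OF A.pos(2)]]) (rule A.J_not_principal[OF 1])
  next
    case 2
    \<comment> \<open>The locale with \<open>q\<close> and \<open>r\<close> exchanged describes the
      same field, since only their product enters.\<close>
    hence "card (B.pts r) < card (B.pts q)" by (simp add: A.card_pts B.card_pts)
    hence "polya_group B.K \<cong> integer_mod_group 2 \<and> \<not> polya_field B.K"
      by (intro B.polya_group_of_order_two[OF B.card_pts_pos[OF B.pos(2)]]) (rule B.J_not_principal)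
    thus ?thesis unfolding mult.commute[of r q] .
  qed
qed

end
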